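(* Let $A:D(A)\subset X\to X$ generate a $C_0$-semigroup $S(\cdot)$ on $X$, let $B$ be an admissible control operator with respect to $A$ in $X$, and suppose that $A$ satisfies the almost exponential decay condition (AEDC) in $X$. Then the following statements are equivalent: (i) The pair $[A,B]$ is stabilizable in $X$. (ii) The pair $[A,B]$ is stabilizable in $X$ with bounded feedback law.
   Context: Notation. $X$ and $U$ are separable complex Hilbert spaces, each identified with its dual; $\mathcal L(\cdot;\cdot)$ denotes bounded linear operators; $\mathbb R^+=(0,+\infty)$; $\mathbb C_{\beta}^+=\{z\in\mathbb C:\mathrm{Re}\,z>\beta\}$. $X_1=D(A)$, $X_1^*=D(A^* )$ (graph norms), $X_{-1}$ is the dual of $X_1^*$ with respect to the pivot space $X$. $\widetilde A\in\mathcal L(X;X_{-1})$ is the extension of $A$ given by $\langle\widetilde A\varphi,\psi\rangle_{X_{-1},X_1^*}=\langle\varphi,A^*\psi\rangle_X$, and $\widetilde S(\cdot)$ is the extension of $S(\cdot)$ to $X_{-1}$ (the semigroup generated by $\widetilde A$). $S^*(t)=S(t)^*$. Admissibility. $B$ is an admissible control operator (w.r.t. $A$) in $X$ if $B\in\mathcal L(U;X_{-1})$ and for each $T>0$ there is $C(T)>0$ with $\int_0^T\|B^*S^*(t)\varphi\|_U^2dt\le C(T)\|\varphi\|_X^2$ for all $\varphi\in X_1^*$, where $B^*\in\mathcal L(X_1^*;U)$ is defined by $\langle Bu,\varphi\rangle_{X_{-1},X_1^*}=\langle u,B^*\varphi\rangle_U$. The pair $[A,B]$ denotes the system $y_t=Ay+Bu$.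 Stabilizability. $[A,B]$ is $\alpha$-stabilizable in $X$ ($\alpha>0$) if there are a $C_0$-semigroup $\mathcal T(\cdot)$ on $X$ with generator $M:D(M)\subset X\to X$ and $K\in\mathcal L(D(M);U)$ ($D(M)$ with graph norm) such that: (a) there is $C_1\ge1$ with $\|\mathcal T(t)\|_{\mathcal L(X)}\le C_1e^{-\alpha t}$ for all $t>0$; (b) $Mx=\widetilde Ax+BKx$ for all $x\in D(M)$; (c) there is $C_2\ge0$ with $\|K\mathcal T(\cdot)x\|_{L^2(\mathbb R^+;U)}\le C_2\|x\|_X$ for all $x\in D(M)$. $[A,B]$ is stabilizable in $X$ if it is $\alpha$-stabilizable for some $\alpha>0$. Bounded feedback. $[A,B]$ is stabilizable in $X$ with bounded feedback law if there are $\alpha>0$, $C>0$ and $K\in\mathcal L(X;U)$ such that for every $y_0\in X$ the unique solution $y\in C([0,+\infty);X)$ of $y_t=Ay+BKy$, $y(0)=y_0$ (i.e. $y(t)=S(t)y_0+\int_0^t\widetilde S(t-s)BKy(s)\,ds$) satisfies $\|y(t)\|_X\le Ce^{-\alpha t}\|y_0\|_X$ for all $t>0$. (AEDC). An operator $L:D(L)\subset X\to X$ satisfies (AEDC) in $X$ if $L$ generates a $C_0$-semigroup $S_L(\cdot)$ on $X$ and for each $\alpha>0$ there are closed subspaces $Q_1,Q_2$ of $X$ (depending on $\alpha$) such that: $X=Q_1\oplus Q_2$; $Q_1$ and $Q_2$ are invariant under $S_L(\cdot)$; $L|_{Q_1}$ is bounded (in particular $Q_1\subset D(L)$) with $\sigma(L|_{Q_1})\subset\mathbb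 C_{-\alpha}^+$; $S_L(\cdot)|_{Q_2}$ is exponentially stable, i.e. there are $\varepsilon>0$, $C>0$ with $\|S_L(t)f\|_X\le Ce^{-\varepsilon t}\|f\|_X$ for all $f\in Q_2$, $t>0$. *)

theory Defs
  imports "HOL-Analysis.Analysis"
begin

section \<open>Complex Hilbert spaces\<close>

text \<open>The inner product is linear in its first and antilinear in its second argument.  Norm,
  topology and completeness are those of \<^class>\<open>banach\<close>.\<close>

class complex_hilbert_space = banach +
  fixes scaleC :: "complex \<Rightarrow> 'a \<Rightarrow> 'a"  (infixr "*\<^sub>C" 75)
    and cinner :: "'a \<Rightarrow> 'a \<Rightarrow> complex"
  assumes scaleC_add_right: "c *\<^sub>C (x + y) = c *\<^sub>C x + c *\<^sub>C y"
    and scaleC_add_left: "(c + d) *\<^sub>C x = c *\<^sub>C x + d *\<^sub>C x"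
    and scaleC_scaleC: "c *\<^sub>C (d *\<^sub>C x) = (c * d) *\<^sub>C x"
    and scaleC_of_real: "complex_of_real r *\<^sub>C x = r *\<^sub>R x"
    and cinner_add_left: "cinner (x + y) z = cinner x z + cinner y z"
    and cinner_scaleC_left: "cinner (c *\<^sub>C x) y = c * cinner x y"
    and cinner_commute: "cinner y x = cnj (cinner x y)"
    and cinner_self: "cinner x x = complex_of_real ((norm x)\<^sup>2)"

definition separable :: "'a::metric_space itself \<Rightarrow> bool" where
  "separable _ \<longleftrightarrow> (\<exists>D::'a set. countable D \<and> closure D = UNIV)"

definition csubspace :: "'x::complex_hilbert_space set \<Rightarrow> bool" where
  "csubspace Q \<longleftrightarrow> 0 \<in> Q \<and> (\<forall>x\<in>Q. \<forall>y\<in>Q. x + y \<in> Q) \<and> (\<forall>c. \<forall>x\<in>Q. c *\<^sub>C x \<in> Q)"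

definition clinear_on ::
  "'x::complex_hilbert_space set \<Rightarrow> ('x \<Rightarrow> 'y::complex_hilbert_space) \<Rightarrow> bool" where
  "clinear_on D f \<longleftrightarrow>
     (\<forall>x\<in>D. \<forall>y\<in>D. f (x + y) = f x + f y) \<and> (\<forall>c. \<forall>x\<in>D. f (c *\<^sub>C x) = c *\<^sub>C f x)"

definition bounded_clinear ::
  "('x::complex_hilbert_space \<Rightarrow> 'y::complex_hilbert_space) \<Rightarrow> bool" where
  "bounded_clinear f \<longleftrightarrow> bounded_linear f \<and> clinear_on UNIV f"


section \<open>Unbounded operators and semigroups\<close>

text \<open>An operator \<open>A\<close> with domain \<open>D\<close> is given by the set \<open>D\<close> together with a total function \<open>A\<close>
  whose values outside \<open>D\<close> are irrelevant.\<close>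

definition graph_norm :: "('x::complex_hilbert_space \<Rightarrow> 'x) \<Rightarrow> 'x \<Rightarrow> real" where
  "graph_norm A x = sqrt ((norm x)\<^sup>2 + (norm (A x))\<^sup>2)"

definition C0_semigroup :: "(real \<Rightarrow> 'x \<Rightarrow> 'x::complex_hilbert_space) \<Rightarrow> bool" where
  "C0_semigroup S \<longleftrightarrow>
     (\<forall>t\<ge>0. bounded_clinear (S t)) \<and> (\<forall>x. S 0 x = x) \<and>
     (\<forall>s\<ge>0. \<forall>t\<ge>0. \<forall>x. S (s + t) x = S s (S t x)) \<and>
     (\<forall>x. ((\<lambda>t. S t x) \<longlongrightarrow> x) (at_right 0))"

definition generates ::
  "'x set \<Rightarrow> ('x \<Rightarrow> 'x) \<Rightarrow> (real \<Rightarrow> 'x \<Rightarrow> 'x::complex_hilbert_space) \<Rightarrow> bool" where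
  "generates D A S \<longleftrightarrow>
     C0_semigroup S \<and>
     (\<forall>x y. (x \<in> D \<and> A x = y) \<longleftrightarrow> ((\<lambda>h. (1 / h) *\<^sub>R (S h x - x)) \<longlongrightarrow> y) (at_right 0))"

text \<open>The adjoint \<open>A\<^sup>*\<close> of a densely defined operator; for \<open>D = UNIV\<close> and \<open>A\<close> bounded,
  \<open>adj UNIV A\<close> is the usual bounded adjoint.\<close>

definition adj_dom :: "'x set \<Rightarrow> ('x \<Rightarrow> 'x) \<Rightarrow> 'x::complex_hilbert_space set" where
  "adj_dom D A = {\<psi>. \<exists>\<eta>. \<forall>\<phi>\<in>D. cinner (A \<phi>) \<psi> = cinner \<phi> \<eta>}"

definition adj :: "'x set \<Rightarrow> ('x \<Rightarrow> 'x) \<Rightarrow> 'x \<Rightarrow> 'x::complex_hilbert_space" where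
  "adj D A \<psi> = (THE \<eta>. \<forall>\<phi>\<in>D. cinner (A \<phi>) \<psi> = cinner \<phi> \<eta>)"


section \<open>The extrapolation space\<close>

text \<open>The space \<open>X\<^sub>-\<^sub>1\<close> is the space of bounded antilinear functionals on \<open>X\<^sub>1\<^sup>* = D(A\<^sup>*)\<close>, with
  the pairing \<open>\<langle>f, \<psi>\<rangle> = f \<psi>\<close>.  Functionals are set to \<open>0\<close> outside \<open>D(A\<^sup>*)\<close>, so that equality in
  \<open>X\<^sub>-\<^sub>1\<close> is equality of functions.  Antilinearity makes \<open>x \<mapsto> \<langle>x, \<cdot>\<rangle>\<^sub>X\<close> a linear embedding
  of the pivot space \<open>X\<close>.\<close>

definition Xm1 ::
  "'x set \<Rightarrow> ('x \<Rightarrow> 'x) \<Rightarrow> ('x::complex_hilbert_space \<Rightarrow> complex) set" where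
  "Xm1 D A = {f.
     (\<forall>\<psi>\<in>adj_dom D A. \<forall>\<eta>\<in>adj_dom D A. f (\<psi> + \<eta>) = f \<psi> + f \<eta>) \<and>
     (\<forall>c. \<forall>\<psi>\<in>adj_dom D A. f (c *\<^sub>C \<psi>) = cnj c * f \<psi>) \<and>
     (\<exists>C. \<forall>\<psi>\<in>adj_dom D A. cmod (f \<psi>) \<le> C * graph_norm (adj D A) \<psi>) \<and>
     (\<forall>\<psi>. \<psi> \<notin> adj_dom D A \<longrightarrow> f \<psi> = 0)}"

definition Xm1_norm ::
  "'x set \<Rightarrow> ('x \<Rightarrow> 'x) \<Rightarrow> ('x::complex_hilbert_space \<Rightarrow> complex) \<Rightarrow> real" where
  "Xm1_norm D A f = (SUP \<psi>\<in>{\<psi> \<in> adj_dom D A. graph_norm (adj D A) \<psi> \<le> 1}. cmod (f \<psi>))"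

definition Xm1_embed ::
  "'x set \<Rightarrow> ('x \<Rightarrow> 'x) \<Rightarrow> 'x \<Rightarrow> 'x::complex_hilbert_space \<Rightarrow> complex" where
  "Xm1_embed D A x = (\<lambda>\<psi>. if \<psi> \<in> adj_dom D A then cinner x \<psi> else 0)"

text \<open>The extension of \<open>A\<close> to an operator from \<open>X\<close> to \<open>X\<^sub>-\<^sub>1\<close>.\<close>

definition A_ext ::
  "'x set \<Rightarrow> ('x \<Rightarrow> 'x) \<Rightarrow> 'x \<Rightarrow> 'x::complex_hilbert_space \<Rightarrow> complex" where
  "A_ext D A \<phi> = (\<lambda>\<psi>. if \<psi> \<in> adj_dom D A then cinner \<phi> (adj D A \<psi>) else 0)"

text \<open>\<open>T'\<close> is a bounded linear operator on \<open>X\<^sub>-\<^sub>1\<close> that extends the operator \<open>T\<close> on \<open>X\<close>.  As \<open>X\<close> is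
  dense in \<open>X\<^sub>-\<^sub>1\<close>, this determines \<open>T'\<close> on \<open>X\<^sub>-\<^sub>1\<close>.\<close>

definition extends_to_Xm1 ::
  "'x set \<Rightarrow> ('x \<Rightarrow> 'x) \<Rightarrow> ('x \<Rightarrow> 'x) \<Rightarrow>
   (('x::complex_hilbert_space \<Rightarrow> complex) \<Rightarrow> ('x \<Rightarrow> complex)) \<Rightarrow> bool" where
  "extends_to_Xm1 D A T T' \<longleftrightarrow>
     (\<forall>f\<in>Xm1 D A. T' f \<in> Xm1 D A) \<and>
     (\<forall>f\<in>Xm1 D A. \<forall>g\<in>Xm1 D A. T' (\<lambda>\<psi>. f \<psi> + g \<psi>) = (\<lambda>\<psi>. T' f \<psi> + T' g \<psi>)) \<and>
     (\<forall>c. \<forall>f\<in>Xm1 D A. T' (\<lambda>\<psi>. c * f \<psi>) = (\<lambda>\<psi>. c * T' f \<psi>)) \<and>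
     (\<exists>C. \<forall>f\<in>Xm1 D A. Xm1_norm D A (T' f) \<le> C * Xm1_norm D A f) \<and>
     (\<forall>x. T' (Xm1_embed D A x) = Xm1_embed D A (T x))"

text \<open>The gauge integral of an \<open>X\<^sub>-\<^sub>1\<close>-valued function over a compact interval, in the norm of
  \<open>X\<^sub>-\<^sub>1\<close>; this is \<^const>\<open>has_integral\<close> with \<open>X\<^sub>-\<^sub>1\<close> as target space (which is not a type).
  It is only used for continuous integrands, where it agrees with the Riemann and Bochner
  integrals.\<close>

definition has_integral_Xm1 ::
  "'x set \<Rightarrow> ('x \<Rightarrow> 'x) \<Rightarrow> (real \<Rightarrow> 'x::complex_hilbert_space \<Rightarrow> complex) \<Rightarrow>
   real \<Rightarrow> real \<Rightarrow> ('x \<Rightarrow> complex) \<Rightarrow> bool" where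
  "has_integral_Xm1 D A f a b I \<longleftrightarrow>
     I \<in> Xm1 D A \<and> (\<forall>s\<in>{a..b}. f s \<in> Xm1 D A) \<and>
     (\<forall>e>0. \<exists>\<gamma>. gauge \<gamma> \<and>
        (\<forall>p. p tagged_division_of {a..b} \<and> \<gamma> fine p \<longrightarrow>
           Xm1_norm D A (\<lambda>\<psi>. (\<Sum>(s, k)\<in>p. measure lborel k *\<^sub>R f s \<psi>) - I \<psi>) < e))"


section \<open>Control operators\<close>

definition bounded_into_Xm1 ::
  "'x set \<Rightarrow> ('x \<Rightarrow> 'x) \<Rightarrow>
   ('u::complex_hilbert_space \<Rightarrow> 'x::complex_hilbert_space \<Rightarrow> complex) \<Rightarrow> bool" where
  "bounded_into_Xm1 D A B \<longleftrightarrow>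
     (\<forall>u. B u \<in> Xm1 D A) \<and>
     (\<forall>u v. B (u + v) = (\<lambda>\<psi>. B u \<psi> + B v \<psi>)) \<and>
     (\<forall>c u. B (c *\<^sub>C u) = (\<lambda>\<psi>. c * B u \<psi>)) \<and>
     (\<exists>C. \<forall>u. Xm1_norm D A (B u) \<le> C * norm u)"

text \<open>\<open>B\<^sup>*\<close>, meaningful on \<open>D(A\<^sup>*)\<close> only: \<open>\<langle>B u, \<psi>\<rangle> = \<langle>u, B\<^sup>* \<psi>\<rangle>\<^sub>U\<close>.\<close>

definition B_adj ::
  "('u::complex_hilbert_space \<Rightarrow> 'x::complex_hilbert_space \<Rightarrow> complex) \<Rightarrow> 'x \<Rightarrow> 'u" where
  "B_adj B \<psi> = (THE v. \<forall>u. B u \<psi> = cinner u v)"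

definition admissible_control ::
  "'x set \<Rightarrow> ('x \<Rightarrow> 'x) \<Rightarrow> (real \<Rightarrow> 'x \<Rightarrow> 'x) \<Rightarrow>
   ('u::complex_hilbert_space \<Rightarrow> 'x::complex_hilbert_space \<Rightarrow> complex) \<Rightarrow> bool" where
  "admissible_control D A S B \<longleftrightarrow>
     bounded_into_Xm1 D A B \<and>
     (\<forall>T>0. \<exists>C>0. \<forall>\<phi>\<in>adj_dom D A.
        (\<integral>\<^sup>+ t\<in>{0..T}. ennreal ((norm (B_adj B (adj UNIV (S t) \<phi>)))\<^sup>2) \<partial>lborel)
          \<le> ennreal (C * (norm \<phi>)\<^sup>2))"


section \<open>Stabilizability\<close>

text \<open>\<open>DM\<close> is the domain of the generator \<open>M\<close>; \<open>K\<close> is only meaningful on \<open>DM\<close>.  The last clause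
  is the squared form of the \<open>L\<^sup>2\<close>-bound on \<open>t \<mapsto> K (\<T> t x)\<close>.\<close>

definition alpha_stabilizable ::
  "'x set \<Rightarrow> ('x \<Rightarrow> 'x) \<Rightarrow>
   ('u::complex_hilbert_space \<Rightarrow> 'x::complex_hilbert_space \<Rightarrow> complex) \<Rightarrow> real \<Rightarrow> bool" where
  "alpha_stabilizable D A B \<alpha> \<longleftrightarrow>
     (\<exists>(\<T> :: real \<Rightarrow> 'x \<Rightarrow> 'x) DM M (K :: 'x \<Rightarrow> 'u).
        generates DM M \<T> \<and>
        clinear_on DM K \<and> (\<exists>C. \<forall>x\<in>DM. norm (K x) \<le> C * graph_norm M x) \<and>
        (\<exists>C1\<ge>1. \<forall>t>0. onorm (\<T> t) \<le> C1 * exp (- \<alpha> * t)) \<and>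
        (\<forall>x\<in>DM. Xm1_embed D A (M x) = (\<lambda>\<psi>. A_ext D A x \<psi> + B (K x) \<psi>)) \<and>
        (\<exists>C2\<ge>0. \<forall>x\<in>DM.
           (\<integral>\<^sup>+ t\<in>{0<..}. ennreal ((norm (K (\<T> t x)))\<^sup>2) \<partial>lborel)
             \<le> ennreal ((C2 * norm x)\<^sup>2)))"

definition stabilizable ::
  "'x set \<Rightarrow> ('x \<Rightarrow> 'x) \<Rightarrow>
   ('u::complex_hilbert_space \<Rightarrow> 'x::complex_hilbert_space \<Rightarrow> complex) \<Rightarrow> bool" where
  "stabilizable D A B \<longleftrightarrow> (\<exists>\<alpha>>0. alpha_stabilizable D A B \<alpha>)"

text \<open>The solution \<open>y \<in> C([0,\<infinity>); X)\<close> of the closed loop system is the solution of the variation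
  of constants formula, read as an identity in \<open>X\<^sub>-\<^sub>1\<close>; only the values of \<open>y\<close> on \<open>[0,\<infinity>)\<close>
  matter.\<close>

definition closed_loop_solution ::
  "'x set \<Rightarrow> ('x \<Rightarrow> 'x) \<Rightarrow> (real \<Rightarrow> 'x \<Rightarrow> 'x) \<Rightarrow>
   ('u::complex_hilbert_space \<Rightarrow> 'x::complex_hilbert_space \<Rightarrow> complex) \<Rightarrow> ('x \<Rightarrow> 'u) \<Rightarrow>
   'x \<Rightarrow> (real \<Rightarrow> 'x) \<Rightarrow> bool" where
  "closed_loop_solution D A S B K y0 y \<longleftrightarrow>
     continuous_on {0..} y \<and> y 0 = y0 \<and>
     (\<exists>S'. (\<forall>t\<ge>0. extends_to_Xm1 D A (S t) (S' t)) \<and>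
        (\<forall>t\<ge>0. has_integral_Xm1 D A (\<lambda>s. S' (t - s) (B (K (y s)))) 0 t
                  (Xm1_embed D A (y t - S t y0))))"

definition stabilizable_bounded_feedback ::
  "'x set \<Rightarrow> ('x \<Rightarrow> 'x) \<Rightarrow> (real \<Rightarrow> 'x \<Rightarrow> 'x) \<Rightarrow>
   ('u::complex_hilbert_space \<Rightarrow> 'x::complex_hilbert_space \<Rightarrow> complex) \<Rightarrow> bool" where
  "stabilizable_bounded_feedback D A S B \<longleftrightarrow>
     (\<exists>\<alpha>>0. \<exists>C>0. \<exists>K :: 'x \<Rightarrow> 'u. bounded_clinear K \<and>
        (\<forall>y0. \<exists>y. closed_loop_solution D A S B K y0 y \<and>
           (\<forall>z. closed_loop_solution D A S B K y0 z \<longrightarrow> (\<forall>t\<ge>0. z t = y t)) \<and>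
           (\<forall>t>0. norm (y t) \<le> C * exp (- \<alpha> * t) * norm y0)))"


section \<open>Almost exponential decay\<close>

text \<open>The spectrum of the restriction of \<open>L\<close> to an \<open>L\<close>-invariant subspace \<open>Q\<close>, on which \<open>L\<close> is
  bounded; the inequality says that \<open>(z - L|\<^sub>Q)\<^sup>-\<^sup>1\<close> is bounded.\<close>

definition spectrum_on ::
  "'x::complex_hilbert_space set \<Rightarrow> ('x \<Rightarrow> 'x) \<Rightarrow> complex set" where
  "spectrum_on Q L =
     {z. \<not> (bij_betw (\<lambda>x. z *\<^sub>C x - L x) Q Q \<and>
         (\<exists>C. \<forall>x\<in>Q. norm x \<le> C * norm (z *\<^sub>C x - L x)))}"

definition AEDC :: "'x set \<Rightarrow> ('x \<Rightarrow> 'x::complex_hilbert_space) \<Rightarrow> bool" where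
  "AEDC D L \<longleftrightarrow>
     (\<exists>S. generates D L S \<and>
        (\<forall>\<alpha>>0. \<exists>Q1 Q2.
           csubspace Q1 \<and> closed Q1 \<and> csubspace Q2 \<and> closed Q2 \<and>
           Q1 \<inter> Q2 = {0} \<and> (\<forall>x. \<exists>x1\<in>Q1. \<exists>x2\<in>Q2. x = x1 + x2) \<and>
           (\<forall>t\<ge>0. S t ` Q1 \<subseteq> Q1 \<and> S t ` Q2 \<subseteq> Q2) \<and>
           Q1 \<subseteq> D \<and> (\<exists>C. \<forall>x\<in>Q1. norm (L x) \<le> C * norm x) \<and>
           spectrum_on Q1 L \<subseteq> {z. Re z > - \<alpha>} \<and>
           (\<exists>\<epsilon>>0. \<exists>C>0. \<forall>f\<in>Q2. \<forall>t>0. norm (S t f) \<le> C * exp (- \<epsilon> * t) * norm f)))"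

end

theory Submission
  imports Defs "HOL-Complex_Analysis.Cauchy_Integral_Formula"
begin

text \<open>Write \<open>Q\<^sub>1\<close> for the subspace of (AEDC) on which the generator is bounded, and \<open>P\<close> for the projection
  onto it along \<open>Q\<^sub>2\<close>.  As \<open>A\<close> is bounded on \<open>Q\<^sub>1\<close>, the projection \<open>P\<close> extends to \<open>X\<^sub>-\<^sub>1\<close> with values in
  \<open>Q\<^sub>1\<close>.  The projected system \<open>q' = A q + P B u\<close> therefore only involves bounded operators, and it is
  the part of the system that has to be stabilized: on \<open>Q\<^sub>2\<close> the semigroup decays by itself.

  From stabilizability to a bounded feedback law.  Let \<open>T(\<cdot>)\<close> be the stabilized semigroup, with generator
  \<open>M\<close>, feedback \<open>K\<close> and rate \<open>\<alpha>\<close>, and take the splitting of (AEDC) for this \<open>\<alpha>\<close>.  The implicit Euler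
  scheme \<open>\<mu> (r\<^sub>n\<^sub>+\<^sub>1 - r\<^sub>n) = M r\<^sub>n\<^sub>+\<^sub>1\<close> decays like \<open>(\<mu> / (\<mu> + \<alpha>))\<^sup>n\<close>, and \<open>q\<^sub>n = P r\<^sub>n\<close> satisfies
  \<open>q\<^sub>n = Z q\<^sub>n\<^sub>+\<^sub>1 - P B u\<^sub>n / \<mu>\<close> with \<open>Z = 1 - A / \<mu>\<close> and \<open>u\<^sub>n = K r\<^sub>n\<^sub>+\<^sub>1\<close>.  Since the spectrum of \<open>A\<close> on
  \<open>Q\<^sub>1\<close> lies in \<open>Re z > - \<alpha>\<close>, the powers \<open>Z\<^sup>n\<close> grow more slowly than \<open>((\<mu> + \<alpha>) / \<mu>)\<^sup>n\<close> if \<open>\<mu>\<close> is large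
  (\<open>power_growth_of_spectral_bound\<close>).  Hence \<open>Z\<^sup>n q\<^sub>n\<close> tends to \<open>0\<close>, and for some \<open>n\<close> each state \<open>q\<^sub>0\<close> is, up
  to half of its norm, a combination of the vectors \<open>Z\<^sup>k P B u\<^sub>k\<close> with \<open>k < n\<close>.  By duality this is an
  observability inequality (\<open>observability_of_stabilizability\<close>).  A finite Gramian \<open>W\<close> turns it into the
  stabilizing feedback \<open>- (P B)\<^sup>* W\<^sup>-\<^sup>1\<close> of the bounded system, with \<open>\<langle>W\<^sup>-\<^sup>1 q, q\<rangle>\<close> as Lyapunov function
  (\<open>stabilizing_feedback_of_observability\<close>).  This feedback is applied to \<open>P y\<close>, which then
  solves a linear differential equation with a bounded operator, so that the control is smooth and decays.
  Integration by parts gives a formula for the state in \<open>X\<close> itself, whose component in \<open>Q\<^sub>2\<close> decays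
  term by term (\<open>feedback_solution\<close>).

  From a bounded feedback law to stabilizability.  By uniqueness the closed loop solutions form a
  semigroup.  Differentiating the variation of constants formula at time \<open>0\<close> against elements of \<open>D(A\<^sup>*)\<close>
  identifies its generator, and the square integrability of the control follows from the decay of the
  state (\<open>stabilizable_if_bounded_feedback\<close>).

  Calculations in \<open>X\<^sub>-\<^sub>1\<close> are done in coordinates.  The Riesz theorem on the graph of \<open>A\<^sup>*\<close> writes each
  element of \<open>X\<^sub>-\<^sub>1\<close> as \<open>a + A b\<close> with \<open>a, b\<close> in \<open>X\<close>, which turns the variation of constants formula into
  scalar identities (\<open>closed_loop_solution_iff_weak\<close>).\<close>

section \<open>Hilbert space geometry\<close>

lemma cinner_zero_left [simp]: "cinner 0 y = 0"
  using cinner_add_left[of 0 0 y] by simp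

lemma cinner_minus_left: "cinner (- x) y = - cinner x y"
  using cinner_add_left[of x "- x" y] minus_unique[of "cinner x y" "cinner (- x) y"] by simp

lemma cinner_diff_left: "cinner (x - y) z = cinner x z - cinner y z"
  using cinner_add_left[of x "- y" z] by (simp add: cinner_minus_left)

lemma cinner_add_right: "cinner x (y + z) = cinner x y + cinner x z"
  by (metis cinner_add_left cinner_commute complex_cnj_add)

lemma cinner_scaleC_right: "cinner x (c *\<^sub>C y) = cnj c * cinner x y"
  by (metis cinner_scaleC_left cinner_commute complex_cnj_mult)

lemma cinner_zero_right [simp]: "cinner x 0 = 0"
  by (metis cinner_zero_left cinner_commute complex_cnj_zero)

lemma cinner_minus_right: "cinner x (- y) = - cinner x y"
  by (metis cinner_minus_left cinner_commute complex_cnj_minus)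

lemma cinner_diff_right: "cinner x (y - z) = cinner x y - cinner x z"
  by (metis cinner_diff_left cinner_commute complex_cnj_diff)

lemma cinner_scaleR_left: "cinner (r *\<^sub>R x) y = r *\<^sub>R cinner x y"
  by (metis cinner_scaleC_left scaleC_of_real scaleR_conv_of_real)

lemma cinner_scaleR_right: "cinner x (r *\<^sub>R y) = r *\<^sub>R cinner x y"
  by (metis cinner_scaleC_right scaleC_of_real scaleR_conv_of_real complex_cnj_complex_of_real)

lemmas cinner_simps = cinner_add_left cinner_add_right cinner_diff_left cinner_diff_right
  cinner_minus_left cinner_minus_right cinner_scaleC_left cinner_scaleC_right
  cinner_scaleR_left cinner_scaleR_right

lemma scaleC_zero_right [simp]: "c *\<^sub>C (0::'a::complex_hilbert_space) = 0"
  using scaleC_add_right[of c 0 "0::'a"] by simp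

lemma scaleC_minus_right: "c *\<^sub>C (- x) = - (c *\<^sub>C (x::'a::complex_hilbert_space))"
  using scaleC_add_right[of c x "- x"] minus_unique[of "c *\<^sub>C x" "c *\<^sub>C (- x)"] by simp

lemma scaleC_diff_right: "c *\<^sub>C (x - y) = c *\<^sub>C x - c *\<^sub>C (y::'a::complex_hilbert_space)"
  using scaleC_add_right[of c x "- y"] by (simp add: scaleC_minus_right)

lemma scaleC_one [simp]: "1 *\<^sub>C x = (x::'a::complex_hilbert_space)"
  using scaleC_of_real[of 1 x] by simp

lemma scaleC_zero_left [simp]: "0 *\<^sub>C x = (0::'a::complex_hilbert_space)"
  using scaleC_of_real[of 0 x] by simp

lemma scaleC_minus_left: "(- c) *\<^sub>C x = - (c *\<^sub>C (x::'a::complex_hilbert_space))"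
  using scaleC_add_left[of c "- c" x] minus_unique[of "c *\<^sub>C x" "(- c) *\<^sub>C x"] by simp

lemma scaleC_diff_left: "(c - d) *\<^sub>C x = c *\<^sub>C x - d *\<^sub>C (x::'a::complex_hilbert_space)"
  using scaleC_add_left[of c "- d" x] by (simp add: scaleC_minus_left)

lemma norm_sq_cinner: "(norm x)\<^sup>2 = Re (cinner x x)"
  by (simp add: cinner_self)

lemma norm_scaleC [simp]: "norm (c *\<^sub>C x) = cmod c * norm (x::'a::complex_hilbert_space)"
proof -
  have "complex_of_real ((norm (c *\<^sub>C x))\<^sup>2) = c * cnj c * complex_of_real ((norm x)\<^sup>2)"
    unfolding cinner_self[symmetric] cinner_scaleC_left cinner_scaleC_right by simp
  also have "\<dots> = complex_of_real ((cmod c * norm x)\<^sup>2)"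
    by (simp add: complex_norm_square[symmetric] power_mult_distrib)
  finally have "(norm (c *\<^sub>C x))\<^sup>2 = (cmod c * norm x)\<^sup>2"
    using of_real_eq_iff by blast
  then show ?thesis by (simp add: power2_eq_iff_nonneg)
qed

lemma norm_add_sq: "(norm (x + y))\<^sup>2 = (norm x)\<^sup>2 + (norm y)\<^sup>2 + 2 * Re (cinner x y)"
  using cinner_commute[of x y] by (simp add: norm_sq_cinner cinner_simps)

lemma norm_diff_sq: "(norm (x - y))\<^sup>2 = (norm x)\<^sup>2 + (norm y)\<^sup>2 - 2 * Re (cinner x y)"
  using norm_add_sq[of x "- y"] by (simp add: cinner_simps)

lemma norm_diff_projection_sq:
  assumes "y \<noteq> 0"
  shows "(norm (x - (cinner x y / (norm y)\<^sup>2) *\<^sub>C y))\<^sup>2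
    = (norm x)\<^sup>2 - (cmod (cinner x y))\<^sup>2 / (norm y)\<^sup>2"
proof -
  have "Re (cinner x ((cinner x y / (norm y)\<^sup>2) *\<^sub>C y)) = (cmod (cinner x y))\<^sup>2 / (norm y)\<^sup>2"
    by (simp add: cinner_simps complex_norm_square cmod_power2 flip: of_real_power)
       (simp add: power2_eq_square)
  moreover have "(norm ((cinner x y / (norm y)\<^sup>2) *\<^sub>C y))\<^sup>2 = (cmod (cinner x y))\<^sup>2 / (norm y)\<^sup>2"
    using assms by (simp add: norm_divide norm_power power_mult_distrib power_divide)
       (simp add: power2_eq_square power4_eq_xxxx)
  ultimately show ?thesis by (simp add: norm_diff_sq)
qed

lemma cauchy_schwarz: "cmod (cinner x y) \<le> norm x * norm y"
proof (cases "y = 0")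
  case False
  have "(cmod (cinner x y))\<^sup>2 / (norm y)\<^sup>2 \<le> (norm x)\<^sup>2"
    using norm_diff_projection_sq[OF False, of x]
    by (metis diff_ge_0_iff_ge zero_le_power2)
  then have "(cmod (cinner x y))\<^sup>2 \<le> (norm x * norm y)\<^sup>2"
    using False by (simp add: pos_divide_le_eq power_mult_distrib)
  then show ?thesis by (simp add: abs_le_square_iff[symmetric])
qed simp

lemma Re_cinner_le: "Re (cinner x y) \<le> norm x * norm y"
  using cauchy_schwarz[of x y] complex_Re_le_cmod order_trans by blast

lemma bounded_bilinear_cinner: "bounded_bilinear cinner"
proof
  show "\<exists>K. \<forall>a b. norm (cinner a b) \<le> norm a * norm b * K"
    using cauchy_schwarz by (intro exI[of _ 1]) auto
qed (auto simp: cinner_simps)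

lemmas tendsto_cinner = bounded_bilinear.tendsto[OF bounded_bilinear_cinner]
lemmas continuous_on_cinner = bounded_bilinear.continuous_on[OF bounded_bilinear_cinner]
lemmas bounded_linear_cinner_left = bounded_bilinear.bounded_linear_left[OF bounded_bilinear_cinner]
lemmas bounded_linear_cinner_right =
  bounded_bilinear.bounded_linear_right[OF bounded_bilinear_cinner]

lemma bounded_linear_scaleC: "bounded_linear (\<lambda>x. c *\<^sub>C (x::'a::complex_hilbert_space))"
proof (rule bounded_linear_intro[where K = "cmod c"])
  show "c *\<^sub>C r *\<^sub>R x = r *\<^sub>R c *\<^sub>C x" for r and x :: 'a
    by (metis mult.commute scaleC_of_real scaleC_scaleC)
qed (auto simp: scaleC_add_right)

lemma cinner_ext:
  assumes "\<And>z. cinner x z = cinner y z"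
  shows "x = y"
proof -
  have "cinner (x - y) (x - y) = 0" using assms[of "x - y"] by (simp add: cinner_diff_left)
  then show ?thesis by (simp add: cinner_self)
qed

lemma norm_le_by_cinner:
  assumes "\<And>z. cmod (cinner x z) \<le> c * norm z" "0 \<le> c"
  shows "norm x \<le> c"
proof (cases "x = 0")
  case False
  have "norm x * norm x \<le> c * norm x"
    using assms(1)[of x] by (simp add: cinner_self norm_power norm_mult power2_eq_square)
  then show ?thesis using False by simp
qed (use assms in simp)

lemma csubspaceD:
  assumes "csubspace Q"
  shows csubspace_zero: "0 \<in> Q"
    and csubspace_add: "x \<in> Q \<Longrightarrow> y \<in> Q \<Longrightarrow> x + y \<in> Q"
    and csubspace_scaleC: "x \<in> Q \<Longrightarrow> c *\<^sub>C x \<in> Q"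
    and csubspace_scaleR: "x \<in> Q \<Longrightarrow> r *\<^sub>R x \<in> Q"
    and csubspace_diff: "x \<in> Q \<Longrightarrow> y \<in> Q \<Longrightarrow> x - y \<in> Q"
proof -
  show "0 \<in> Q" and add: "x \<in> Q \<Longrightarrow> y \<in> Q \<Longrightarrow> x + y \<in> Q" and sc: "x \<in> Q \<Longrightarrow> c *\<^sub>C x \<in> Q"
    for x y c using assms unfolding csubspace_def by auto
  show "x \<in> Q \<Longrightarrow> r *\<^sub>R x \<in> Q" for x r using sc[of x "complex_of_real r"] by (simp add: scaleC_of_real)
  then have minus: "x \<in> Q \<Longrightarrow> - x \<in> Q" for x by (metis scaleR_minus1_left)
  show "x \<in> Q \<Longrightarrow> y \<in> Q \<Longrightarrow> x - y \<in> Q" for x y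
    using add[of x "- y"] minus[of y] by simp
qed

text \<open>A minimizing sequence for the distance to \<open>Q\<close> is a Cauchy sequence by the parallelogram law.  Its limit
  \<open>q\<close> leaves an orthogonal residual, because removing from \<open>x - q\<close> its component along some \<open>y\<close> in \<open>Q\<close>
  cannot make it shorter.\<close>

theorem orthogonal_projection_exists:
  fixes Q :: "'x::complex_hilbert_space set"
  assumes Q: "csubspace Q" "closed Q"
  shows "\<exists>q\<in>Q. \<forall>y\<in>Q. cinner (x - q) y = 0"
proof -
  have ne: "Q \<noteq> {}" using csubspace_zero[OF Q(1)] by auto
  define d where "d = infdist x Q"
  have dle: "d \<le> norm (x - q)" if "q \<in> Q" for q
    using infdist_le[OF that, of x] by (simp add: d_def dist_norm)
  have "\<exists>q\<in>Q. norm (x - q) < d + inverse (real (Suc n))" for n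
  proof -
    have "infdist x Q < d + inverse (real (Suc n))" by (simp add: d_def)
    then show ?thesis
      unfolding infdist_notempty[OF ne]
      by (subst (asm) cINF_less_iff) (auto simp: dist_norm ne intro: bdd_belowI2[where m = 0])
  qed
  then obtain f where f: "\<And>n. f n \<in> Q" "\<And>n. norm (x - f n) < d + inverse (real (Suc n))"
    by metis
  have d0: "0 \<le> d" by (simp add: d_def infdist_nonneg)
  have lim: "(\<lambda>n. norm (x - f n)) \<longlonglongrightarrow> d"
  proof (rule tendsto_sandwich[of "\<lambda>n. d" _ _ "\<lambda>n. d + inverse (real (Suc n))"])
    show "(\<lambda>n. d + inverse (real (Suc n))) \<longlonglongrightarrow> d"
      using tendsto_add[OF tendsto_const LIMSEQ_inverse_real_of_nat, of d] by simp
    show "\<forall>\<^sub>F n in sequentially. norm (x - f n) \<le> d + inverse (real (Suc n))"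
      using less_imp_le[OF f(2)] by (intro always_eventually allI)
  qed (use dle f(1) in \<open>auto intro!: always_eventually\<close>)
  have par: "(norm (f m - f n))\<^sup>2 \<le> 2 * (norm (x - f m))\<^sup>2 + 2 * (norm (x - f n))\<^sup>2 - 4 * d\<^sup>2" for m n
  proof -
    define h where "h = (1/2) *\<^sub>R (f m + f n)"
    have "h \<in> Q" unfolding h_def using f Q csubspace_add csubspace_scaleR by blast
    from dle[OF this] have "d\<^sup>2 \<le> (norm (x - h))\<^sup>2" using d0 by (simp add: power_mono)
    moreover have "(x - f m) + (x - f n) = 2 *\<^sub>R (x - h)"
      by (simp add: h_def algebra_simps scaleR_2)
    then have "(norm ((x - f m) + (x - f n)))\<^sup>2 = 4 * (norm (x - h))\<^sup>2"
      by (simp add: power_mult_distrib)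
    moreover have "(norm ((x - f m) - (x - f n)))\<^sup>2 = (norm (f m - f n))\<^sup>2"
      by (simp add: norm_minus_commute)
    ultimately show ?thesis
      using norm_add_sq[of "x - f m" "x - f n"] norm_diff_sq[of "x - f m" "x - f n"] by linarith
  qed
  have "Cauchy f"
  proof (rule metric_CauchyI)
    fix e :: real assume "0 < e"
    have "(\<lambda>n. (norm (x - f n))\<^sup>2) \<longlonglongrightarrow> d\<^sup>2" by (intro tendsto_intros lim)
    then have "\<forall>\<^sub>F n in sequentially. dist ((norm (x - f n))\<^sup>2) (d\<^sup>2) < e\<^sup>2 / 4"
      using \<open>0 < e\<close> by (intro tendstoD) auto
    then obtain N where N: "\<And>n. n \<ge> N \<Longrightarrow> \<bar>(norm (x - f n))\<^sup>2 - d\<^sup>2\<bar> < e\<^sup>2 / 4"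
      by (auto simp: eventually_sequentially dist_real_def)
    have "dist (f m) (f n) < e" if "m \<ge> N" "n \<ge> N" for m n
    proof -
      have "(norm (f m - f n))\<^sup>2 < e\<^sup>2" using par[of m n] N[OF that(1)] N[OF that(2)] by linarith
      then show ?thesis using \<open>0 < e\<close> by (simp add: dist_norm power_less_imp_less_base)
    qed
    then show "\<exists>M. \<forall>m\<ge>M. \<forall>n\<ge>M. dist (f m) (f n) < e" by blast
  qed
  then obtain q where q: "f \<longlonglongrightarrow> q" using Cauchy_convergent convergent_def by blast
  have qQ: "q \<in> Q" using Q(2) f(1) q closed_sequentially by blast
  have "(\<lambda>n. norm (x - f n)) \<longlonglongrightarrow> norm (x - q)" by (intro tendsto_intros q)
  then have nq: "norm (x - q) = d" using lim LIMSEQ_unique by blast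
  have "cinner (x - q) y = 0" if "y \<in> Q" for y
  proof (cases "y = 0")
    case False
    define c where "c = cinner (x - q) y / (norm y)\<^sup>2"
    have "q + c *\<^sub>C y \<in> Q" using qQ that Q(1) csubspace_add csubspace_scaleC by blast
    from dle[OF this] have "d \<le> norm ((x - q) - c *\<^sub>C y)" by (simp add: algebra_simps)
    then have "d\<^sup>2 \<le> (norm ((x - q) - c *\<^sub>C y))\<^sup>2" using d0 by (simp add: power_mono)
    with norm_diff_projection_sq[OF False, of "x - q"] nq
    have "(cmod (cinner (x - q) y))\<^sup>2 / (norm y)\<^sup>2 \<le> 0" by (simp add: c_def)
    then show ?thesis using False by (simp add: divide_le_0_iff)
  qed simp
  with qQ show ?thesis by blast
qed

lemma proper_csubspace_orthogonal:
  assumes "csubspace Q" "closed Q" "\<And>x. (\<And>y. y \<in> Q \<Longrightarrow> cinner x y = 0) \<Longrightarrow> x = 0"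
  shows "Q = UNIV"
proof -
  have "x \<in> Q" for x
  proof -
    obtain q where "q \<in> Q" "\<forall>y\<in>Q. cinner (x - q) y = 0"
      using orthogonal_projection_exists[OF assms(1,2)] by blast
    then show ?thesis using assms(3)[of "x - q"] by auto
  qed
  then show ?thesis by auto
qed

lemma csubspace_closure:
  assumes "csubspace Q"
  shows "csubspace (closure Q)"
  unfolding csubspace_def
proof (intro conjI ballI allI)
  show "0 \<in> closure Q" using csubspace_zero[OF assms] closure_subset by blast
next
  fix x y assume "x \<in> closure Q" "y \<in> closure Q"
  then obtain f g where "\<forall>n. f n \<in> Q" "f \<longlonglongrightarrow> x" "\<forall>n. g n \<in> Q" "g \<longlonglongrightarrow> y"
    unfolding closure_sequential by blast
  then show "x + y \<in> closure Q" unfolding closure_sequential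
    by (intro exI[of _ "\<lambda>n. f n + g n"]) (auto intro: tendsto_add csubspace_add[OF assms])
next
  fix x c assume "x \<in> closure Q"
  then obtain f where "\<forall>n. f n \<in> Q" "f \<longlonglongrightarrow> x" unfolding closure_sequential by blast
  then show "c *\<^sub>C x \<in> closure Q" unfolding closure_sequential
    by (intro exI[of _ "\<lambda>n. c *\<^sub>C f n"])
       (auto intro: bounded_linear.tendsto[OF bounded_linear_scaleC] csubspace_scaleC[OF assms])
qed

text \<open>The representing vector is a multiple of any vector of \<open>Q\<close> orthogonal to the kernel.  The version for
  antilinear functionals on a subspace is the one that applies to the elements of \<open>X\<^sub>-\<^sub>1\<close>, seen as
  functionals on the graph of \<open>A\<^sup>*\<close>.\<close>

theorem riesz_on_csubspace:
  fixes Q :: "'x::complex_hilbert_space set" and f :: "'x \<Rightarrow> complex"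
  assumes Q: "csubspace Q" "closed Q"
    and add: "\<And>x y. x \<in> Q \<Longrightarrow> y \<in> Q \<Longrightarrow> f (x + y) = f x + f y"
    and scale: "\<And>c x. x \<in> Q \<Longrightarrow> f (c *\<^sub>C x) = cnj c * f x"
    and bound: "\<And>x. x \<in> Q \<Longrightarrow> cmod (f x) \<le> C * norm x"
  shows "\<exists>g\<in>Q. \<forall>x\<in>Q. f x = cinner g x"
proof (cases "\<forall>x\<in>Q. f x = 0")
  case True
  then show ?thesis by (intro bexI[of _ 0]) (auto simp: csubspace_zero[OF Q(1)])
next
  case False
  then obtain x0 where x0: "x0 \<in> Q" "f x0 \<noteq> 0" by blast
  have f0: "f 0 = 0" using scale[of 0 0] csubspace_zero[OF Q(1)] by simp
  have fdiff: "f (x - y) = f x - f y" if "x \<in> Q" "y \<in> Q" for x y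
    using add[of "x - y" y] that csubspace_diff[OF Q(1)] by simp
  define N where "N = {x \<in> Q. f x = 0}"
  have N: "csubspace N" unfolding csubspace_def N_def
    using csubspaceD[OF Q(1)] add scale f0 by auto
  have "closed N" unfolding closed_sequential_limits
  proof (intro allI impI, elim conjE)
    fix g l assume g: "\<forall>n. g n \<in> N" "g \<longlonglongrightarrow> l"
    then have l: "l \<in> Q" using closed_sequentially[OF Q(2), of g l] by (auto simp: N_def)
    have "cmod (f l) \<le> C * norm (l - g n)" for n
      using bound[of "l - g n"] fdiff[of l "g n"] g l csubspace_diff[OF Q(1)] by (auto simp: N_def)
    moreover have "(\<lambda>n. C * norm (l - g n)) \<longlonglongrightarrow> C * norm (l - l)" by (intro tendsto_intros g)
    ultimately have "cmod (f l) \<le> C * norm (l - l)" by (meson LIMSEQ_le_const)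
    with l show "l \<in> N" by (simp add: N_def)
  qed
  then obtain q where q: "q \<in> N" "\<forall>y\<in>N. cinner (x0 - q) y = 0"
    using orthogonal_projection_exists[OF N] by blast
  define z where "z = x0 - q"
  have zQ: "z \<in> Q" using x0 q csubspace_diff[OF Q(1)] by (auto simp: z_def N_def)
  have fz: "f z = f x0" using x0 q fdiff by (auto simp: z_def N_def)
  have zz: "cinner z z \<noteq> 0" using fz x0 f0 by (auto simp: cinner_self)
  have "f x = cinner ((f z / cinner z z) *\<^sub>C z) x" if x: "x \<in> Q" for x
  proof -
    define w where "w = x - cnj (f x / f z) *\<^sub>C z"
    have "f (cnj (f x / f z) *\<^sub>C z) = f x" using scale[OF zQ] fz x0 by simp
    then have "w \<in> N" using x zQ csubspaceD[OF Q(1)] fdiff by (simp add: N_def w_def)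
    then have "cinner z w = 0" using q by (simp add: z_def)
    then have "cinner z x = (f x / f z) * cinner z z" by (simp add: w_def cinner_simps)
    then show ?thesis using zz fz x0 by (simp add: cinner_simps)
  qed
  then show ?thesis using csubspace_scaleC[OF Q(1) zQ] by blast
qed

text \<open>Graphs of operators are subspaces of a product, where the projection and Riesz theorems apply to them.\<close>

instantiation prod :: (complex_hilbert_space, complex_hilbert_space) complex_hilbert_space
begin

definition scaleC_prod :: "complex \<Rightarrow> 'a \<times> 'b \<Rightarrow> 'a \<times> 'b" where
  "scaleC_prod c p = (c *\<^sub>C fst p, c *\<^sub>C snd p)"

definition cinner_prod :: "'a \<times> 'b \<Rightarrow> 'a \<times> 'b \<Rightarrow> complex" where
  "cinner_prod p q = cinner (fst p) (fst q) + cinner (snd p) (snd q)"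

instance
proof
  fix x y z :: "'a \<times> 'b" and c d :: complex and r :: real
  show "c *\<^sub>C (x + y) = c *\<^sub>C x + c *\<^sub>C y" by (simp add: scaleC_prod_def scaleC_add_right)
  show "(c + d) *\<^sub>C x = c *\<^sub>C x + d *\<^sub>C x" by (simp add: scaleC_prod_def scaleC_add_left)
  show "c *\<^sub>C d *\<^sub>C x = (c * d) *\<^sub>C x" by (simp add: scaleC_prod_def scaleC_scaleC)
  show "complex_of_real r *\<^sub>C x = r *\<^sub>R x" by (simp add: scaleC_prod_def scaleC_of_real scaleR_prod_def)
  show "cinner (x + y) z = cinner x z + cinner y z" by (simp add: cinner_prod_def cinner_add_left)
  show "cinner (c *\<^sub>C x) y = c * cinner x y"
    by (simp add: cinner_prod_def scaleC_prod_def cinner_scaleC_left distrib_left)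
  show "cinner y x = cnj (cinner x y)"
    unfolding cinner_prod_def complex_cnj_add by (simp only: cinner_commute[symmetric])
  show "cinner x x = complex_of_real ((norm x)\<^sup>2)"
    unfolding cinner_prod_def cinner_self norm_prod_def
    by (simp flip: of_real_power of_real_add)
qed

end

lemma scaleC_Pair [simp]: "c *\<^sub>C (a, b) = (c *\<^sub>C a, c *\<^sub>C b)"
  by (simp add: scaleC_prod_def)

lemma cinner_Pair [simp]: "cinner (a, b) (c, d) = cinner a c + cinner b d"
  by (simp add: cinner_prod_def)

section \<open>Bounded operators\<close>

text \<open>By the Baire theorem one of the closed sets on which the family is bounded by \<open>n\<close> contains a ball; taking
  differences moves this ball to the origin.\<close>

theorem uniform_boundedness:
  fixes T :: "'i \<Rightarrow> 'a::banach \<Rightarrow> 'b::real_normed_vector"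
  assumes lin: "\<And>i. i \<in> I \<Longrightarrow> bounded_linear (T i)"
    and pt: "\<And>x. \<exists>c. \<forall>i\<in>I. norm (T i x) \<le> c"
  shows "\<exists>C>0. \<forall>i\<in>I. \<forall>x. norm (T i x) \<le> C * norm x"
proof -
  define F where "F n = {x. \<forall>i\<in>I. norm (T i x) \<le> real n}" for n :: nat
  have cl: "closed (F n)" for n
  proof -
    have "F n = (\<Inter>i\<in>I. {x. norm (T i x) \<le> real n})" by (auto simp: F_def)
    moreover have "closed {x. norm (T i x) \<le> real n}" if "i \<in> I" for i
      using lin[OF that] by (intro closed_Collect_le continuous_intros)
        (auto intro: linear_continuous_on)
    ultimately show ?thesis by auto
  qed
  have "\<exists>n. interior (F n) \<noteq> {}"
  proof (rule ccontr)
    assume "\<not> ?thesis"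
    then have "\<And>n. interior (F n) = {}" by blast
    then have "euclidean interior_of (\<Union>(range F)) = {}"
      by (intro Baire_category_alt) (auto simp: completely_metrizable_space_euclidean cl)
    moreover have "\<Union>(range F) = UNIV"
    proof -
      have "x \<in> \<Union>(range F)" for x
      proof -
        obtain c where "\<forall>i\<in>I. norm (T i x) \<le> c" using pt by blast
        moreover obtain n :: nat where "c \<le> real n" using real_arch_simple by blast
        ultimately show ?thesis unfolding F_def by (force intro: order_trans)
      qed
      then show ?thesis by auto
    qed
    ultimately show False by simp
  qed
  then obtain n x0 where "x0 \<in> interior (F n)" by blast
  then obtain e where e: "e > 0" "cball x0 e \<subseteq> F n"
    by (meson mem_interior_cball)
  have b: "norm (T i x) \<le> (2 * real n / e) * norm x" if i: "i \<in> I" for i x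
  proof (cases "x = 0")
    case True
    then show ?thesis using lin[OF i] by (simp add: linear_simps)
  next
    case False
    define h where "h = (e / norm x) *\<^sub>R x"
    have "x0 + h \<in> F n" "x0 \<in> F n"
      using e False by (auto simp: h_def dist_norm subset_iff)
    then have "norm (T i (x0 + h)) \<le> real n" "norm (T i x0) \<le> real n" using i by (auto simp: F_def)
    moreover have "T i h = T i (x0 + h) - T i x0" using lin[OF i] by (simp add: linear_simps)
    ultimately have "norm (T i h) \<le> 2 * real n"
      using norm_triangle_ineq4[of "T i (x0 + h)" "T i x0"] by simp
    moreover have "T i h = (e / norm x) *\<^sub>R T i x" using lin[OF i] by (simp add: h_def linear_simps)
    ultimately show ?thesis using e False by (simp add: field_simps)
  qed
  have "norm (T i x) \<le> (2 * real n / e + 1) * norm x" if "i \<in> I" for i x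
    using b[OF that, of x] norm_ge_zero[of x] unfolding distrib_right by linarith
  moreover have "2 * real n / e + 1 > 0" using e by (simp add: add_nonneg_pos)
  ultimately show ?thesis by blast
qed

lemma bounded_clinear_intro:
  assumes "\<And>x y. f (x + y) = f x + f y" "\<And>c x. f (c *\<^sub>C x) = c *\<^sub>C f x"
    "\<And>x. norm (f x) \<le> C * norm x"
  shows "bounded_clinear f"
  unfolding bounded_clinear_def clinear_on_def
proof (intro conjI ballI allI assms)
  show "bounded_linear f"
  proof (rule bounded_linear_intro[where K = C])
    show "f (r *\<^sub>R x) = r *\<^sub>R f x" for r x
      using assms(2)[of "complex_of_real r" x] by (simp add: scaleC_of_real)
    show "norm (f x) \<le> norm x * C" for x using assms(3)[of x] by (simp add: mult.commute)
  qed (fact assms)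
qed

lemma bounded_clinear_bounded_linear: "bounded_clinear f \<Longrightarrow> bounded_linear f"
  by (simp add: bounded_clinear_def)

lemma bounded_clinear_simps:
  assumes "bounded_clinear f"
  shows "f (x + y) = f x + f y" "f (x - y) = f x - f y" "f (- x) = - f x" "f 0 = 0"
    "f (c *\<^sub>C x) = c *\<^sub>C f x" "f (r *\<^sub>R x) = r *\<^sub>R f x"
  using assms by (auto simp: bounded_clinear_def clinear_on_def linear_simps)

lemma bounded_clinear_bound:
  assumes "bounded_clinear f"
  obtains C where "C > 0" "\<And>x. norm (f x) \<le> C * norm x"
  using bounded_linear.pos_bounded[OF bounded_clinear_bounded_linear[OF assms]]
  by (metis mult.commute)

lemma bounded_clinear_id: "bounded_clinear (\<lambda>x. x)"
  by (rule bounded_clinear_intro[where C = 1]) auto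

lemma bounded_clinear_compose:
  assumes "bounded_clinear f" "bounded_clinear g"
  shows "bounded_clinear (\<lambda>x. f (g x))"
  using assms bounded_linear_compose[of f g]
  by (auto simp: bounded_clinear_def clinear_on_def)

lemma bounded_clinear_add:
  assumes "bounded_clinear f" "bounded_clinear g"
  shows "bounded_clinear (\<lambda>x. f x + g x)"
  using assms bounded_linear_add[of f g]
  by (auto simp: bounded_clinear_def clinear_on_def scaleC_add_right)

lemma bounded_clinear_scaleC:
  assumes "bounded_clinear f"
  shows "bounded_clinear (\<lambda>x. c *\<^sub>C f x)"
  using assms bounded_linear_compose[OF bounded_linear_scaleC, of f c]
  by (auto simp: bounded_clinear_def clinear_on_def scaleC_add_right scaleC_scaleC mult.commute)

lemma bounded_clinear_scaleR:
  assumes "bounded_clinear f"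
  shows "bounded_clinear (\<lambda>x. r *\<^sub>R f x)"
  using bounded_clinear_scaleC[OF assms, of "complex_of_real r"] by (simp add: scaleC_of_real)

lemma bounded_clinear_minus:
  assumes "bounded_clinear f"
  shows "bounded_clinear (\<lambda>x. - f x)"
  using bounded_clinear_scaleR[OF assms, of "-1"] by simp

lemma bounded_clinear_diff:
  assumes "bounded_clinear f" "bounded_clinear g"
  shows "bounded_clinear (\<lambda>x. f x - g x)"
  using bounded_clinear_add[OF assms(1) bounded_clinear_minus[OF assms(2)]] by simp

lemma bounded_clinear_zero: "bounded_clinear (\<lambda>x. 0)"
  by (rule bounded_clinear_intro[where C = 0]) auto

lemma bounded_clinear_sum:
  assumes "\<And>i. i \<in> I \<Longrightarrow> bounded_clinear (f i)"
  shows "bounded_clinear (\<lambda>x. \<Sum>i\<in>I. f i x)"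
proof (cases "finite I")
  case True
  then show ?thesis using assms
    by (induction I) (auto intro: bounded_clinear_add bounded_clinear_zero)
qed (simp add: bounded_clinear_zero)

lemma bounded_clinear_funpow:
  fixes f :: "'a::complex_hilbert_space \<Rightarrow> 'a"
  assumes "bounded_clinear f"
  shows "bounded_clinear (f ^^ n)"
proof (induction n)
  case 0
  show ?case unfolding funpow.simps(1) id_def by (rule bounded_clinear_id)
next
  case (Suc n)
  then show ?case using bounded_clinear_compose[OF assms Suc] by (simp add: o_def)
qed

lemmas bounded_clinear_intros = bounded_clinear_id bounded_clinear_add bounded_clinear_scaleC
  bounded_clinear_scaleR bounded_clinear_minus bounded_clinear_diff bounded_clinear_zero

text \<open>The bounded adjoint for operators between two different spaces; \<^const>\<open>adj\<close> with domain
  \<^const>\<open>UNIV\<close> is its restriction to operators on one space.\<close>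

definition hadj :: "('a::complex_hilbert_space \<Rightarrow> 'b::complex_hilbert_space) \<Rightarrow> 'b \<Rightarrow> 'a" where
  "hadj T y = (THE z. \<forall>x. cinner (T x) y = cinner x z)"

lemma cinner_ext_right: "(\<And>z. cinner z x = cinner z y) \<Longrightarrow> x = y"
  by (rule cinner_ext) (metis cinner_commute)

lemma hadj:
  assumes "bounded_clinear T"
  shows "cinner (T x) y = cinner x (hadj T y)"
proof -
  obtain C where C: "C > 0" "\<And>x. norm (T x) \<le> C * norm x"
    using bounded_clinear_bound[OF assms] by blast
  have "\<exists>g\<in>UNIV. \<forall>x\<in>UNIV. cinner y (T x) = cinner g x"
  proof (rule riesz_on_csubspace[where C = "norm y * C"])
    fix x
    have "cmod (cinner y (T x)) \<le> norm y * norm (T x)" by (rule cauchy_schwarz)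
    also have "\<dots> \<le> norm y * (C * norm x)" by (intro mult_left_mono C) auto
    finally show "cmod (cinner y (T x)) \<le> norm y * C * norm x" by (simp add: mult.assoc)
  qed (auto simp: csubspace_def bounded_clinear_simps[OF assms] cinner_simps)
  then obtain g where "\<And>x. cinner y (T x) = cinner g x" by blast
  then have g: "\<forall>x. cinner (T x) y = cinner x g" by (metis cinner_commute)
  then have "hadj T y = g" unfolding hadj_def
    by (rule the_equality) (rule cinner_ext_right, use g in auto)
  with g show ?thesis by simp
qed

lemma hadj_left:
  assumes "bounded_clinear T"
  shows "cinner y (T x) = cinner (hadj T y) x"
  by (metis assms cinner_commute hadj)

lemma hadj_eqI:
  assumes "bounded_clinear T" "\<And>x. cinner (T x) y = cinner x z"
  shows "hadj T y = z"
  by (rule cinner_ext_right) (metis assms hadj)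

lemma hadj_bound:
  assumes "bounded_clinear T" "\<And>x. norm (T x) \<le> C * norm x" "0 \<le> C"
  shows "norm (hadj T y) \<le> C * norm y"
proof (rule norm_le_by_cinner)
  fix z
  have "cmod (cinner (hadj T y) z) \<le> norm y * norm (T z)"
    unfolding hadj_left[OF assms(1), symmetric] by (rule cauchy_schwarz)
  also have "\<dots> \<le> norm y * (C * norm z)" by (intro mult_left_mono assms) auto
  finally show "cmod (cinner (hadj T y) z) \<le> C * norm y * norm z" by (simp add: mult_ac)
qed (use assms in simp)

lemma bounded_clinear_hadj:
  assumes "bounded_clinear T"
  shows "bounded_clinear (hadj T)"
proof -
  obtain C where C: "C > 0" "\<And>x. norm (T x) \<le> C * norm x"
    using bounded_clinear_bound[OF assms] by blast
  show ?thesis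
  proof (rule bounded_clinear_intro)
    show "hadj T (x + y) = hadj T x + hadj T y" for x y
      by (rule hadj_eqI[OF assms]) (simp add: cinner_simps hadj[OF assms])
    show "hadj T (c *\<^sub>C x) = c *\<^sub>C hadj T x" for c x
      by (rule hadj_eqI[OF assms]) (simp add: cinner_simps hadj[OF assms])
    show "norm (hadj T x) \<le> C * norm x" for x
      using hadj_bound[OF assms C(2)] C(1) by simp
  qed
qed

definition bounded_inverse ::
  "('a::complex_hilbert_space \<Rightarrow> 'a) \<Rightarrow> ('a \<Rightarrow> 'a) \<Rightarrow> bool" where
  "bounded_inverse T R \<longleftrightarrow> bounded_clinear R \<and> (\<forall>x. R (T x) = x) \<and> (\<forall>x. T (R x) = x)"

lemma bounded_inverseI:
  assumes T: "bounded_clinear T" and inv: "\<And>x. R (T x) = x" "\<And>x. T (R x) = x"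
    and bound: "\<And>x. norm x \<le> C * norm (T x)"
  shows "bounded_inverse T R"
  unfolding bounded_inverse_def
proof (intro conjI allI inv)
  have inj: "x = y" if "T x = T y" for x y using inv(1) that by metis
  show "bounded_clinear R"
  proof (rule bounded_clinear_intro)
    show "R (x + y) = R x + R y" for x y by (rule inj) (simp add: inv bounded_clinear_simps[OF T])
    show "R (c *\<^sub>C x) = c *\<^sub>C R x" for c x by (rule inj) (simp add: inv bounded_clinear_simps[OF T])
    show "norm (R x) \<le> C * norm x" for x using bound[of "R x"] by (simp add: inv)
  qed
qed

text \<open>The Lax--Milgram lemma.  Coercivity bounds \<open>T\<close> from below, so its range is closed, and a vector orthogonal
  to the range is in particular orthogonal to its own image, hence \<open>0\<close>.\<close>

theorem coercive_bounded_inverse: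
  fixes T :: "'a::complex_hilbert_space \<Rightarrow> 'a"
  assumes T: "bounded_clinear T" and c: "c > 0"
    and coercive: "\<And>x. c * (norm x)\<^sup>2 \<le> Re (cinner (T x) x)"
  shows "\<exists>R. bounded_inverse T R"
proof -
  have low: "c * norm x \<le> norm (T x)" for x
  proof (cases "x = 0")
    case False
    have "c * norm x * norm x \<le> norm (T x) * norm x"
      using coercive[of x] Re_cinner_le[of "T x" x] by (simp add: power2_eq_square mult.assoc)
    then show ?thesis using False by simp
  qed (simp add: bounded_clinear_simps[OF T])
  have surj: "range T = UNIV"
  proof (rule proper_csubspace_orthogonal)
    have "0 \<in> range T" by (metis bounded_clinear_simps(4)[OF T] rangeI)
    then show "csubspace (range T)" unfolding csubspace_def
      by (auto simp: bounded_clinear_simps(1,5)[OF T, symmetric])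
    have "complete (range T)"
      using complete_isometric_image[OF c subspace_UNIV bounded_clinear_bounded_linear[OF T]] low
      by (simp add: complete_UNIV)
    then show "closed (range T)" by (rule complete_imp_closed)
    fix x assume "\<And>y. y \<in> range T \<Longrightarrow> cinner x y = 0"
    then have "cinner (T x) x = 0" by (metis cinner_commute complex_cnj_zero rangeI)
    then have "c * (norm x)\<^sup>2 \<le> 0" using coercive[of x] by simp
    then show "x = 0" using c by (simp add: mult_le_0_iff)
  qed
  have inj: "inj T"
  proof (rule injI)
    fix x y assume "T x = T y"
    then have "c * norm (x - y) \<le> 0" using low[of "x - y"] by (simp add: bounded_clinear_simps[OF T])
    then show "x = y" using c by (simp add: mult_le_0_iff)
  qed
  have "bounded_inverse T (inv T)"
  proof (rule bounded_inverseI[OF T, where C = "1 / c"])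
    show "norm x \<le> 1 / c * norm (T x)" for x using low[of x] c by (simp add: field_simps)
  qed (use inj surj in \<open>auto simp: surj_f_inv_f\<close>)
  then show ?thesis by blast
qed

lemma orthogonal_projection_operator:
  assumes "csubspace Q" "closed Q"
  obtains Po where "bounded_clinear Po" "\<And>x. Po x \<in> Q" "\<And>x. x \<in> Q \<Longrightarrow> Po x = x"
    "\<And>x y. cinner (Po x) y = cinner x (Po y)"
proof -
  obtain P where P: "\<And>x. P x \<in> Q" "\<And>x y. y \<in> Q \<Longrightarrow> cinner (x - P x) y = 0"
    using orthogonal_projection_exists[OF assms] by metis
  have uniq: "P x = q" if q: "q \<in> Q" "\<And>y. y \<in> Q \<Longrightarrow> cinner (x - q) y = 0" for x q
  proof -
    have d: "P x - q \<in> Q" by (rule csubspace_diff[OF assms(1) P(1) q(1)])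
    have "cinner (P x - q) (P x - q) = cinner (x - q) (P x - q) - cinner (x - P x) (P x - q)"
      by (simp add: cinner_diff_left)
    also have "\<dots> = 0" using P q d by simp
    finally show ?thesis by (simp add: cinner_self)
  qed
  have sym: "cinner (P x) y = cinner x (P y)" for x y
  proof -
    have "cinner (P x) y = cinner (P x) (P y)"
      using P(2)[of "P x" y] P(1)[of x] cinner_commute[of "y - P y" "P x"]
      by (simp add: cinner_diff_right)
    moreover have "cinner x (P y) = cinner (P x) (P y)"
      using P(2)[of "P y" x] P(1)[of y] by (simp add: cinner_diff_left)
    ultimately show ?thesis by simp
  qed
  have "bounded_clinear P"
  proof (rule bounded_clinear_intro[where C = 1])
    show "P (x + y) = P x + P y" for x y by (rule cinner_ext) (simp add: sym cinner_simps)
    show "P (c *\<^sub>C x) = c *\<^sub>C P x" for c x by (rule cinner_ext) (simp add: sym cinner_simps)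
    show "norm (P x) \<le> 1 * norm x" for x
    proof (cases "P x = 0")
      case False
      have "(norm (P x))\<^sup>2 = Re (cinner x (P x))"
        using P(2)[OF P(1), of x x] by (simp add: norm_sq_cinner cinner_diff_left)
      also have "\<dots> \<le> norm x * norm (P x)" by (rule Re_cinner_le)
      finally show ?thesis using False by (simp add: power2_eq_square)
    qed simp
  qed
  then show thesis using that[of P] P(1) uniq sym by auto
qed

lemma closure_eq_UNIV_if_separating:
  assumes "csubspace Q" "\<And>x. (\<And>y. y \<in> Q \<Longrightarrow> cinner x y = 0) \<Longrightarrow> x = 0"
  shows "closure Q = UNIV"
  using proper_csubspace_orthogonal[OF csubspace_closure[OF assms(1)] closed_closure] assms(2)
  by (meson closure_subset subsetD)

lemma separating_if_dense:
  assumes "closure Q = UNIV" "\<And>y. y \<in> Q \<Longrightarrow> cinner y x = 0"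
  shows "x = 0"
proof -
  obtain f where f: "\<forall>n. f n \<in> Q" "f \<longlonglongrightarrow> x" using assms(1) closure_sequential[of x Q] by blast
  have "(\<lambda>n. cinner (f n) x) \<longlonglongrightarrow> cinner x x" by (intro tendsto_cinner f tendsto_const)
  then have "cinner x x = 0" using f assms(2) by (simp add: LIMSEQ_const_iff)
  then show ?thesis by (simp add: cinner_self)
qed

text \<open>The residual of the projection of \<open>(0, x)\<close> onto the graph of \<open>A\<close> has the form \<open>(- v, \<psi>)\<close>, and its
  orthogonality to the graph says that \<open>\<psi>\<close> is in \<open>D(A\<^sup>*)\<close> with \<open>A\<^sup>* \<psi> = v\<close>.  If \<open>x\<close> is orthogonal to \<open>\<psi>\<close>,
  the residual vanishes, and then \<open>(0, x)\<close> is in the graph.\<close>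

theorem adj_dom_separating:
  fixes A :: "'x::complex_hilbert_space \<Rightarrow> 'x"
  assumes D: "csubspace D" and A: "clinear_on D A" and cl: "closed ((\<lambda>x. (x, A x)) ` D)"
    and orth: "\<And>\<psi>. \<psi> \<in> adj_dom D A \<Longrightarrow> cinner x \<psi> = 0"
  shows "x = 0"
proof -
  let ?G = "(\<lambda>x. (x, A x)) ` D"
  have A0: "A 0 = 0"
    using A csubspace_zero[OF D] unfolding clinear_on_def by (metis add_0 add_cancel_left_left)
  have G: "csubspace ?G" unfolding csubspace_def
  proof (intro conjI ballI allI)
    show "0 \<in> ?G" using csubspace_zero[OF D] A0 by (auto simp: zero_prod_def image_iff)
    show "p + q \<in> ?G" if "p \<in> ?G" "q \<in> ?G" for p q
      using that A csubspace_add[OF D] by (auto simp: clinear_on_def image_iff)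
    show "c *\<^sub>C p \<in> ?G" if "p \<in> ?G" for p c
      using that A csubspace_scaleC[OF D] by (auto simp: clinear_on_def image_iff)
  qed
  obtain v where v: "v \<in> D" "\<forall>q\<in>?G. cinner ((0, x) - (v, A v)) q = 0"
    using orthogonal_projection_exists[OF G cl, of "(0, x)"] by blast
  have o: "cinner (x - A v) (A z) = cinner v z" if "z \<in> D" for z
    using v(2) that by (auto simp: cinner_simps)
  then have "cinner (A z) (x - A v) = cinner z v" if "z \<in> D" for z
    using that by (metis cinner_commute)
  then have "x - A v \<in> adj_dom D A" unfolding adj_dom_def by blast
  then have 1: "cinner x (x - A v) = 0" by (rule orth)
  have 2: "cinner (x - A v) (A v) = cinner v v" using o v(1) by blast
  have 3: "cinner (x - A v) x = 0" using 1 by (metis cinner_commute complex_cnj_zero)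
  from 3 have "cinner (x - A v) (x - A v) = - cinner v v"
    using 2 by (subst cinner_diff_right) simp
  then have "complex_of_real ((norm (x - A v))\<^sup>2 + (norm v)\<^sup>2) = 0"
    unfolding cinner_self by (simp flip: of_real_power of_real_add of_real_minus)
  then have "(norm (x - A v))\<^sup>2 + (norm v)\<^sup>2 = 0" using of_real_eq_0_iff by blast
  then have "v = 0" "x = A v" by (auto simp: sum_power2_eq_zero_iff)
  then show ?thesis using A0 by simp
qed

lemma csubspace_adj_dom: "csubspace (adj_dom D A)"
  unfolding csubspace_def adj_dom_def
proof (intro conjI ballI allI)
  show "0 \<in> {\<psi>. \<exists>\<eta>. \<forall>\<phi>\<in>D. cinner (A \<phi>) \<psi> = cinner \<phi> \<eta>}"
    by (auto intro: exI[of _ 0])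
next
  fix x y assume "x \<in> {\<psi>. \<exists>\<eta>. \<forall>\<phi>\<in>D. cinner (A \<phi>) \<psi> = cinner \<phi> \<eta>}"
    "y \<in> {\<psi>. \<exists>\<eta>. \<forall>\<phi>\<in>D. cinner (A \<phi>) \<psi> = cinner \<phi> \<eta>}"
  then obtain a b where "\<forall>\<phi>\<in>D. cinner (A \<phi>) x = cinner \<phi> a" "\<forall>\<phi>\<in>D. cinner (A \<phi>) y = cinner \<phi> b"
    by blast
  then show "x + y \<in> {\<psi>. \<exists>\<eta>. \<forall>\<phi>\<in>D. cinner (A \<phi>) \<psi> = cinner \<phi> \<eta>}"
    by (auto intro!: exI[of _ "a + b"] simp: cinner_simps)
next
  fix c x assume "x \<in> {\<psi>. \<exists>\<eta>. \<forall>\<phi>\<in>D. cinner (A \<phi>) \<psi> = cinner \<phi> \<eta>}"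
  then obtain a where "\<forall>\<phi>\<in>D. cinner (A \<phi>) x = cinner \<phi> a" by blast
  then show "c *\<^sub>C x \<in> {\<psi>. \<exists>\<eta>. \<forall>\<phi>\<in>D. cinner (A \<phi>) \<psi> = cinner \<phi> \<eta>}"
    by (auto intro!: exI[of _ "c *\<^sub>C a"] simp: cinner_simps)
qed

text \<open>The functionals \<open>x \<mapsto> \<langle>T x, \<psi>\<rangle>\<close> with \<open>\<psi>\<close> in the unit ball of \<open>D(T\<^sup>*)\<close> are continuous and pointwise bounded
  by \<open>norm (T x)\<close>, so they are uniformly bounded; as \<open>D(T\<^sup>*)\<close> is dense, this bounds \<open>T\<close>.\<close>

theorem closed_graph:
  fixes T :: "'x::complex_hilbert_space \<Rightarrow> 'x"
  assumes T: "clinear_on UNIV T" and cl: "closed (range (\<lambda>x. (x, T x)))"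
  shows "bounded_clinear T"
proof -
  have Tlin: "T (x + y) = T x + T y" "T (c *\<^sub>C x) = c *\<^sub>C T x" for x y c
    using T by (auto simp: clinear_on_def)
  define E where "E = adj_dom UNIV T"
  have E: "csubspace E" unfolding E_def by (rule csubspace_adj_dom)
  have "csubspace UNIV" by (simp add: csubspace_def)
  then have dense: "closure E = UNIV" unfolding E_def
    using adj_dom_separating[OF _ T cl] closure_eq_UNIV_if_separating[OF csubspace_adj_dom] by metis
  have "\<exists>C>0. \<forall>\<psi>\<in>{\<psi> \<in> E. norm \<psi> \<le> 1}. \<forall>x. norm (cinner (T x) \<psi>) \<le> C * norm x"
  proof (rule uniform_boundedness)
    fix \<psi> assume "\<psi> \<in> {\<psi> \<in> E. norm \<psi> \<le> 1}"
    then obtain \<eta> where "(\<lambda>x. cinner (T x) \<psi>) = (\<lambda>x. cinner x \<eta>)"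
      by (auto simp: E_def adj_dom_def)
    then show "bounded_linear (\<lambda>x. cinner (T x) \<psi>)"
      using bounded_linear_cinner_left[of \<eta>] by metis
  next
    fix x
    have "norm (cinner (T x) \<psi>) \<le> norm (T x)" if "norm \<psi> \<le> 1" for \<psi>
      using cauchy_schwarz[of "T x" \<psi>] that mult_left_mono[of "norm \<psi>" 1 "norm (T x)"] by simp
    then show "\<exists>c. \<forall>\<psi>\<in>{\<psi> \<in> E. norm \<psi> \<le> 1}. norm (cinner (T x) \<psi>) \<le> c" by blast
  qed
  then obtain C where C: "C > 0"
    "\<And>\<psi> x. \<psi> \<in> E \<Longrightarrow> norm \<psi> \<le> 1 \<Longrightarrow> cmod (cinner (T x) \<psi>) \<le> C * norm x" by auto
  have C': "cmod (cinner (T x) \<psi>) \<le> C * norm x * norm \<psi>" if "\<psi> \<in> E" for x \<psi>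
  proof (cases "\<psi> = 0")
    case False
    have "cmod (cinner (T x) ((1 / norm \<psi>) *\<^sub>R \<psi>)) \<le> C * norm x"
      using False that csubspace_scaleR[OF E] by (intro C) auto
    then show ?thesis using False by (simp add: cinner_simps field_simps)
  qed simp
  have "norm (T x) \<le> C * norm x" for x
  proof (rule norm_le_by_cinner)
    fix z
    obtain f where f: "\<forall>n. f n \<in> E" "f \<longlonglongrightarrow> z" using dense closure_sequential[of z E] by blast
    show "cmod (cinner (T x) z) \<le> C * norm x * norm z"
    proof (rule LIMSEQ_le)
      show "(\<lambda>n. cmod (cinner (T x) (f n))) \<longlonglongrightarrow> cmod (cinner (T x) z)"
        by (intro tendsto_norm tendsto_cinner tendsto_const f)
      show "(\<lambda>n. C * norm x * norm (f n)) \<longlonglongrightarrow> C * norm x * norm z"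
        by (intro tendsto_mult tendsto_norm tendsto_const f)
    qed (use f C' in auto)
  qed (use C in simp)
  then show ?thesis using Tlin by (intro bounded_clinear_intro)
qed

text \<open>Closedness of both summands makes the graph of the projection closed.\<close>

theorem oblique_projection:
  fixes Q1 Q2 :: "'x::complex_hilbert_space set"
  assumes Q1: "csubspace Q1" "closed Q1" and Q2: "csubspace Q2" "closed Q2"
    and int: "Q1 \<inter> Q2 = {0}" and sum: "\<forall>x. \<exists>x1\<in>Q1. \<exists>x2\<in>Q2. x = x1 + x2"
  obtains P where "bounded_clinear P" "\<And>x. P x \<in> Q1" "\<And>x. x - P x \<in> Q2"
    "\<And>x y. y \<in> Q1 \<Longrightarrow> x - y \<in> Q2 \<Longrightarrow> P x = y"
proof -
  have "\<forall>x. \<exists>y. y \<in> Q1 \<and> x - y \<in> Q2" using sum by (metis add_diff_cancel_left')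
  then obtain P where P: "\<And>x. P x \<in> Q1" "\<And>x. x - P x \<in> Q2" by metis
  have uniq: "P x = y" if "y \<in> Q1" "x - y \<in> Q2" for x y
  proof -
    have "P x - y \<in> Q1" by (rule csubspace_diff[OF Q1(1) P(1) that(1)])
    moreover have "(x - y) - (x - P x) \<in> Q2" by (rule csubspace_diff[OF Q2(1) that(2) P(2)])
    then have "P x - y \<in> Q2" by simp
    ultimately have "P x - y = 0" using int by blast
    then show ?thesis by simp
  qed
  have "clinear_on UNIV P" unfolding clinear_on_def
  proof (intro conjI ballI allI)
    fix x y c
    have "(x - P x) + (y - P y) \<in> Q2" by (rule csubspace_add[OF Q2(1) P(2) P(2)])
    then show "P (x + y) = P x + P y"
      by (intro uniq csubspace_add[OF Q1(1)] P) (simp add: algebra_simps)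
    have "c *\<^sub>C (x - P x) \<in> Q2" by (rule csubspace_scaleC[OF Q2(1) P(2)])
    then show "P (c *\<^sub>C x) = c *\<^sub>C P x"
      by (intro uniq csubspace_scaleC[OF Q1(1)] P) (simp add: scaleC_diff_right)
  qed
  moreover have "closed (range (\<lambda>x. (x, P x)))" unfolding closed_sequential_limits
  proof (intro allI impI, elim conjE)
    fix f l assume f: "\<forall>n. f n \<in> range (\<lambda>x. (x, P x))" "f \<longlonglongrightarrow> l"
    have f1: "(\<lambda>n. fst (f n)) \<longlonglongrightarrow> fst l" and f2: "(\<lambda>n. snd (f n)) \<longlonglongrightarrow> snd l"
      using f(2) by (auto intro: tendsto_intros)
    have Pf: "snd (f n) = P (fst (f n))" for n using f(1)[rule_format, of n] by auto
    have "snd l \<in> Q1" using closed_sequentially[OF Q1(2) _ f2] Pf P by simp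
    moreover have "fst l - snd l \<in> Q2"
      using closed_sequentially[OF Q2(2) _ tendsto_diff[OF f1 f2]] Pf P by simp
    ultimately have "P (fst l) = snd l" by (rule uniq)
    then show "l \<in> range (\<lambda>x. (x, P x))" by (metis prod.collapse rangeI)
  qed
  ultimately have "bounded_clinear P" by (rule closed_graph)
  then show thesis using that P uniq by blast
qed

section \<open>Strongly continuous semigroups\<close>

lemma has_vector_derivative_iff_quotient:
  fixes f :: "real \<Rightarrow> 'a::real_normed_vector"
  shows "(f has_vector_derivative d) (at x within s) \<longleftrightarrow>
    ((\<lambda>y. (1 / (y - x)) *\<^sub>R (f y - f x)) \<longlongrightarrow> d) (at x within s)"
proof -
  have "norm ((f y - f x) - (y - x) *\<^sub>R d) / norm (y - x) = norm ((1 / (y - x)) *\<^sub>R (f y - f x) - d)"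
    if "y \<noteq> x" for y
  proof -
    have "(1 / (y - x)) *\<^sub>R (f y - f x) - d = (1 / (y - x)) *\<^sub>R ((f y - f x) - (y - x) *\<^sub>R d)"
      using that by (simp add: scaleR_diff_right)
    then show ?thesis by (simp add: divide_inverse_commute)
  qed
  then have "((\<lambda>y. norm ((f y - f x) - (y - x) *\<^sub>R d) / norm (y - x)) \<longlongrightarrow> 0) (at x within s) \<longleftrightarrow>
    ((\<lambda>y. norm ((1 / (y - x)) *\<^sub>R (f y - f x) - d)) \<longlongrightarrow> 0) (at x within s)"
    by (intro Lim_cong_within) auto
  then show ?thesis
    unfolding has_vector_derivative_def has_derivative_iff_norm tendsto_norm_zero_iff
      LIM_zero_iff by (simp add: bounded_linear_scaleR_left)
qed

lemma right_mean_value_limit: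
  fixes f :: "real \<Rightarrow> 'a::banach"
  assumes "continuous_on {0..} f" "0 \<le> t"
  shows "((\<lambda>h. (1 / h) *\<^sub>R integral {t..t+h} f) \<longlongrightarrow> f t) (at_right 0)"
proof (rule tendstoI)
  fix e :: real assume e: "e > 0"
  obtain d where d: "d > 0" "\<And>s. s \<ge> 0 \<Longrightarrow> dist s t < d \<Longrightarrow> dist (f s) (f t) < e / 2"
    using assms e half_gt_zero[OF e] unfolding continuous_on_iff by (metis atLeast_iff)
  have "dist ((1 / h) *\<^sub>R integral {t..t+h} f) (f t) < e" if h: "0 < h" "h < d" for h
  proof -
    have c: "continuous_on {t..t+h} f" using assms by (auto intro: continuous_on_subset)
    have "integral {t..t+h} (\<lambda>s. f s - f t) = integral {t..t+h} f - h *\<^sub>R f t"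
      using integral_diff[OF integrable_continuous_real[OF c] integrable_const_ivl[of "f t" t "t+h"]] h
      by simp
    moreover have "norm (integral {t..t+h} (\<lambda>s. f s - f t)) \<le> (e / 2) * (t + h - t)"
      using h d assms
      by (intro integral_bound continuous_intros c) (auto simp: dist_norm intro!: less_imp_le)
    ultimately have "norm (integral {t..t+h} f - h *\<^sub>R f t) \<le> (e / 2) * h" by simp
    moreover have "(1 / h) *\<^sub>R integral {t..t+h} f - f t
        = (1 / h) *\<^sub>R (integral {t..t+h} f - h *\<^sub>R f t)"
      using h by (simp add: scaleR_diff_right)
    ultimately have "norm ((1 / h) *\<^sub>R integral {t..t+h} f - f t) \<le> e / 2"
      using h by (simp only: norm_scaleR) (simp add: field_simps)
    then show ?thesis using e by (simp add: dist_norm)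
  qed
  then show "\<forall>\<^sub>F h in at_right 0. dist ((1 / h) *\<^sub>R integral {t..t+h} f) (f t) < e"
    using d(1) unfolding eventually_at_right_field by (intro exI[of _ d]) auto
qed

locale c0_generator =
  fixes D :: "'x::complex_hilbert_space set" and A S
  assumes generates: "generates D A S"
begin

lemma S_clinear: "0 \<le> t \<Longrightarrow> bounded_clinear (S t)"
  and S_zero: "S 0 x = x"
  and S_add: "0 \<le> s \<Longrightarrow> 0 \<le> t \<Longrightarrow> S (s + t) x = S s (S t x)"
  and S_right: "((\<lambda>t. S t x) \<longlongrightarrow> x) (at_right 0)"
  and generator_iff: "(x \<in> D \<and> A x = y) \<longleftrightarrow> ((\<lambda>h. (1 / h) *\<^sub>R (S h x - x)) \<longlongrightarrow> y) (at_right 0)"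
  using generates unfolding generates_def C0_semigroup_def by blast+

lemmas S_simps = bounded_clinear_simps[OF S_clinear]

lemma generator_limit: "x \<in> D \<Longrightarrow> ((\<lambda>h. (1 / h) *\<^sub>R (S h x - x)) \<longlongrightarrow> A x) (at_right 0)"
  using generator_iff by blast

lemma generatorI:
  assumes "((\<lambda>h. (1 / h) *\<^sub>R (S h x - x)) \<longlongrightarrow> y) (at_right 0)"
  shows "x \<in> D" "A x = y"
  using generator_iff assms by blast+

text \<open>Otherwise there are \<open>t\<^sub>n \<longlonglongrightarrow> 0\<close> for which the operators \<open>S(t\<^sub>n)\<close> are unbounded in norm, although all
  sequences \<open>S(t\<^sub>n) x\<close> converge, in contradiction to the uniform boundedness principle.\<close>

lemma S_bound_near_zero: "\<exists>d>0. \<exists>M. \<forall>t\<in>{0..d}. \<forall>x. norm (S t x) \<le> M * norm x"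
proof (rule ccontr)
  assume n: "\<not> ?thesis"
  have "\<exists>t x. 0 \<le> t \<and> t \<le> inverse (real (Suc n)) \<and> \<not> norm (S t x) \<le> real n * norm x" for n
    using n by (metis atLeastAtMost_iff inverse_positive_iff_positive of_nat_0_less_iff zero_less_Suc)
  then obtain t z where tz: "\<And>n. 0 \<le> t n" "\<And>n. t n \<le> inverse (real (Suc n))"
    "\<And>n. \<not> norm (S (t n) (z n)) \<le> real n * norm (z n)" by metis
  have t0: "t \<longlonglongrightarrow> 0"
    using tz by (intro tendsto_sandwich[OF _ _ tendsto_const LIMSEQ_inverse_real_of_nat]) auto
  have "\<exists>C>0. \<forall>n\<in>UNIV. \<forall>x. norm (S (t n) x) \<le> C * norm x"
  proof (rule uniform_boundedness)
    fix x
    obtain d where d: "d > 0" "\<And>h. 0 < h \<Longrightarrow> h < d \<Longrightarrow> dist (S h x) x < 1"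
      using tendstoD[OF S_right[of x], of 1] unfolding eventually_at_right_field by auto
    have b: "norm (S h x) \<le> norm x + 1" if h: "0 \<le> h" "h < d" for h
    proof (cases "h = 0")
      case False
      then show ?thesis using d(2)[of h] h norm_triangle_ineq2[of "S h x" x] by (simp add: dist_norm)
    qed (simp add: S_zero)
    obtain N where N: "\<And>n. n \<ge> N \<Longrightarrow> t n < d"
      using tendstoD[OF t0 d(1)] tz(1) by (auto simp: eventually_sequentially dist_real_def)
    have "norm (S (t n) x) \<le> (norm x + 1) + (\<Sum>i<N. norm (S (t i) x))" for n
    proof (cases "n < N")
      case True
      then have "norm (S (t n) x) \<le> (\<Sum>i<N. norm (S (t i) x))"
        by (intro member_le_sum) auto
      then show ?thesis using norm_ge_zero[of x] by linarith
    next
      case False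
      then have "norm (S (t n) x) \<le> norm x + 1" using b tz(1) N by simp
      moreover have "0 \<le> (\<Sum>i<N. norm (S (t i) x))" by (intro sum_nonneg) auto
      ultimately show ?thesis by linarith
    qed
    then show "\<exists>c. \<forall>n\<in>UNIV. norm (S (t n) x) \<le> c" by blast
  qed (use S_clinear tz in \<open>auto simp: bounded_clinear_bounded_linear\<close>)
  then obtain C where C: "\<And>n x. norm (S (t n) x) \<le> C * norm x" by auto
  obtain n :: nat where "C \<le> real n" using real_arch_simple by blast
  then have "norm (S (t n) (z n)) \<le> real n * norm (z n)"
    using C[of n "z n"] mult_right_mono[of C "real n" "norm (z n)"] by simp
  then show False using tz(3) by blast
qed

lemma S_bound: "\<exists>M\<ge>1. \<forall>t\<in>{0..T}. \<forall>x. norm (S t x) \<le> M * norm x"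
proof -
  obtain d M0 where d: "d > 0" and M0: "\<And>t x. 0 \<le> t \<Longrightarrow> t \<le> d \<Longrightarrow> norm (S t x) \<le> M0 * norm x"
    using S_bound_near_zero by (metis atLeastAtMost_iff)
  define M where "M = max M0 1"
  have M: "1 \<le> M" "\<And>t x. 0 \<le> t \<Longrightarrow> t \<le> d \<Longrightarrow> norm (S t x) \<le> M * norm x"
  proof -
    show "norm (S t x) \<le> M * norm x" if "0 \<le> t" "t \<le> d" for t x
      using M0[OF that, of x] mult_right_mono[of M0 M "norm x"] by (simp add: M_def)
  qed (simp add: M_def)
  have "\<forall>t x. 0 \<le> t \<longrightarrow> t \<le> real n * d \<longrightarrow> norm (S t x) \<le> M ^ n * norm x" for n
  proof (induction n)
    case (Suc n)
    show ?case
    proof (intro allI impI)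
      fix t x assume t: "0 \<le> t" "t \<le> real (Suc n) * d"
      define s where "s = min t d"
      have s: "0 \<le> s" "s \<le> d" "0 \<le> t - s" "t - s \<le> real n * d"
        using t d by (auto simp: s_def min_def field_simps)
      have "S t x = S s (S (t - s) x)" using S_add[OF s(1,3), of x] by simp
      then have "norm (S t x) \<le> M * norm (S (t - s) x)" using M s by simp
      also have "\<dots> \<le> M * (M ^ n * norm x)" using Suc s M by (intro mult_left_mono) auto
      finally show "norm (S t x) \<le> M ^ Suc n * norm x" by (simp add: mult.assoc)
    qed
  qed (auto simp: S_zero dest: antisym)
  moreover obtain n :: nat where "T / d \<le> real n" using real_arch_simple by blast
  then have "T \<le> real n * d" using d by (simp add: field_simps)
  ultimately have "\<forall>t\<in>{0..T}. \<forall>x. norm (S t x) \<le> M ^ n * norm x" by auto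
  then show ?thesis using M(1) by (intro exI[of _ "M ^ n"]) auto
qed

text \<open>Joint continuity in time and state, in the form of a rule for limits along arbitrary filters; the local
  bound on the semigroup controls the change of state, the semigroup law the change of time.\<close>

lemma S_tendsto:
  assumes f: "(f \<longlongrightarrow> l) F" and g: "(g \<longlongrightarrow> \<tau>) F" and pos: "\<forall>\<^sub>F x in F. 0 \<le> g x" "0 \<le> \<tau>"
  shows "((\<lambda>x. S (g x) (f x)) \<longlongrightarrow> S \<tau> l) F"
proof -
  obtain M where M: "M \<ge> 1" "\<And>t x. 0 \<le> t \<Longrightarrow> t \<le> \<tau> + 1 \<Longrightarrow> norm (S t x) \<le> M * norm x"
    using S_bound[of "\<tau> + 1"] by auto
  define m where "m h = S \<bar>h\<bar> l - l" for h
  have "(m \<longlongrightarrow> 0) (nhds 0)"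
  proof (rule tendstoI)
    fix e :: real assume "e > 0"
    from tendstoD[OF S_right[of l] this] obtain d where
      d: "d > 0" "\<And>h. 0 < h \<Longrightarrow> h < d \<Longrightarrow> dist (S h l) l < e"
      unfolding eventually_at_right_field by auto
    have "dist (m h) 0 < e" if "dist h 0 < d" for h
      using d(2)[of "\<bar>h\<bar>"] that \<open>e > 0\<close> by (cases "h = 0") (auto simp: m_def dist_norm S_zero)
    then show "\<forall>\<^sub>F h in nhds 0. dist (m h) 0 < e" unfolding eventually_nhds_metric using d(1) by blast
  qed
  moreover have "((\<lambda>x. g x - \<tau>) \<longlongrightarrow> 0) F" using g by (simp add: LIM_zero_iff)
  ultimately have m0: "((\<lambda>x. m (g x - \<tau>)) \<longlongrightarrow> 0) F" by (rule filterlim_compose)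
  have diff: "norm (S s l - S t l) \<le> M * norm (m (s - t))"
    if "0 \<le> s" "s \<le> \<tau> + 1" "0 \<le> t" "t \<le> \<tau> + 1" for s t
  proof -
    have *: "norm (S s l - S t l) \<le> M * norm (m (s - t))"
      if "0 \<le> t" "t \<le> s" "s \<le> \<tau> + 1" for s t
    proof -
      have "S s l - S t l = S t (m (s - t))"
        using S_add[of t "s - t" l] that by (simp add: m_def S_simps)
      then show ?thesis using M(2)[of t] that by simp
    qed
    show ?thesis
    proof (cases "t \<le> s")
      case False
      then show ?thesis using *[of s t] that by (simp add: norm_minus_commute m_def abs_minus_commute)
    qed (use * that in auto)
  qed
  have ev: "\<forall>\<^sub>F x in F. norm (S (g x) (f x) - S \<tau> l) \<le> M * norm (f x - l) + M * norm (m (g x - \<tau>))"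
  proof -
    have "\<forall>\<^sub>F x in F. dist (g x) \<tau> < 1" using g by (rule tendstoD) simp
    with pos(1) show ?thesis
    proof eventually_elim
      case (elim x)
      then have gx: "0 \<le> g x" "g x \<le> \<tau> + 1" by (auto simp: dist_real_def)
      have "S (g x) (f x) - S \<tau> l = S (g x) (f x - l) + (S (g x) l - S \<tau> l)"
        using gx by (simp add: S_simps)
      then have "norm (S (g x) (f x) - S \<tau> l) \<le> norm (S (g x) (f x - l)) + norm (S (g x) l - S \<tau> l)"
        by (metis norm_triangle_ineq)
      then show ?case using M(2)[OF gx, of "f x - l"] diff[of "g x" \<tau>] gx pos(2) by simp
    qed
  qed
  have "((\<lambda>x. M * norm (f x - l) + M * norm (m (g x - \<tau>))) \<longlongrightarrow> M * norm (l - l) + M * norm (0::'x)) F"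
    by (intro tendsto_intros f m0)
  then have "((\<lambda>x. M * norm (f x - l) + M * norm (m (g x - \<tau>))) \<longlongrightarrow> 0) F" by simp
  then have "((\<lambda>x. S (g x) (f x) - S \<tau> l) \<longlongrightarrow> 0) F" by (rule Lim_null_comparison[OF ev])
  then show ?thesis by (simp add: LIM_zero_iff)
qed

lemma S_continuous:
  assumes "continuous_on I f" "continuous_on I g" "\<And>x. x \<in> I \<Longrightarrow> 0 \<le> g x"
  shows "continuous_on I (\<lambda>x. S (g x) (f x))"
  unfolding continuous_on_def
proof
  fix x assume x: "x \<in> I"
  show "((\<lambda>x. S (g x) (f x)) \<longlongrightarrow> S (g x) (f x)) (at x within I)"
  proof (rule S_tendsto)
    show "\<forall>\<^sub>F y in at x within I. 0 \<le> g y"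
      using assms(3) by (auto simp: eventually_at_filter)
  qed (use assms x in \<open>auto simp: continuous_on_def\<close>)
qed

lemma S_orbit_continuous: "continuous_on {0..} (\<lambda>s. S s x)"
  by (rule S_continuous) (auto intro: continuous_intros)

lemma S_orbit_continuous': "0 \<le> a \<Longrightarrow> continuous_on {a..b} (\<lambda>s. S s x)"
  using continuous_on_subset[OF S_orbit_continuous, of "{a..b}"] by auto

lemma S_orbit_integrable: "0 \<le> a \<Longrightarrow> (\<lambda>s. S s x) integrable_on {a..b}"
  by (intro integrable_continuous_real S_orbit_continuous')

text \<open>Shifting the integral leaves only the two ends of the interval, which are averages of the orbit.\<close>

lemma orbit_integral_quotient:
  fixes x
  assumes t: "0 \<le> t"
  defines "I \<equiv> integral {0..t} (\<lambda>s. S s x)"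
  shows "((\<lambda>h. (1 / h) *\<^sub>R (S h I - I)) \<longlongrightarrow> S t x - x) (at_right 0)"
proof -
  have eq: "(1 / h) *\<^sub>R (S h I - I) =
      (1 / h) *\<^sub>R integral {t..t+h} (\<lambda>s. S s x) - (1 / h) *\<^sub>R integral {0..0+h} (\<lambda>s. S s x)"
    if h: "0 < h" for h
  proof -
    have "S h I = integral {0..t} (S h \<circ> (\<lambda>s. S s x))"
      unfolding I_def using h S_orbit_integrable
      by (intro integral_linear[symmetric] bounded_clinear_bounded_linear S_clinear) auto
    also have "\<dots> = integral {0..t} (\<lambda>s. S (s + h) x)"
      using h by (intro integral_cong) (simp add: S_add[symmetric] add.commute)
    also have "\<dots> = integral {h..t+h} (\<lambda>s. S s x)"
    proof -
      have "((\<lambda>s. S s x) has_integral integral {h..t+h} (\<lambda>s. S s x)) {h..t+h}"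
        using h by (intro integrable_integral S_orbit_integrable) simp
      from has_integral_shift_real_ivl[OF this, of h] show ?thesis by (simp add: integral_unique)
    qed
    finally have 1: "S h I = integral {h..t+h} (\<lambda>s. S s x)" .
    have 2: "integral {0..h} (\<lambda>s. S s x) + integral {h..t+h} (\<lambda>s. S s x) = integral {0..t+h} (\<lambda>s. S s x)"
      using h t by (intro Henstock_Kurzweil_Integration.integral_combine S_orbit_integrable) auto
    have 3: "integral {0..t} (\<lambda>s. S s x) + integral {t..t+h} (\<lambda>s. S s x) = integral {0..t+h} (\<lambda>s. S s x)"
      using h t by (intro Henstock_Kurzweil_Integration.integral_combine S_orbit_integrable) auto
    have "S h I - I = integral {t..t+h} (\<lambda>s. S s x) - integral {0..0+h} (\<lambda>s. S s x)"
      using 1 2 3 by (simp add: I_def algebra_simps)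
    then show ?thesis by (simp add: scaleR_diff_right)
  qed
  have "((\<lambda>h. (1 / h) *\<^sub>R integral {t..t+h} (\<lambda>s. S s x) - (1 / h) *\<^sub>R integral {0..0+h} (\<lambda>s. S s x))
      \<longlongrightarrow> S t x - S 0 x) (at_right 0)"
    using t by (intro tendsto_diff right_mean_value_limit S_orbit_continuous) auto
  then have "((\<lambda>h. (1 / h) *\<^sub>R integral {t..t+h} (\<lambda>s. S s x) - (1 / h) *\<^sub>R integral {0..0+h} (\<lambda>s. S s x))
      \<longlongrightarrow> S t x - x) (at_right 0)" by (simp add: S_zero)
  then show ?thesis
    by (rule Lim_transform_eventually) (auto simp: eventually_at_right_field eq intro!: exI[of _ 1])
qed

lemma orbit_integral_in_domain:
  assumes "0 \<le> t"
  shows "integral {0..t} (\<lambda>s. S s x) \<in> D" "A (integral {0..t} (\<lambda>s. S s x)) = S t x - x"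
  using generatorI[OF orbit_integral_quotient[OF assms]] by auto

lemma A_add: "x \<in> D \<Longrightarrow> y \<in> D \<Longrightarrow> x + y \<in> D \<and> A (x + y) = A x + A y"
proof -
  assume xy: "x \<in> D" "y \<in> D"
  have "((\<lambda>h. (1 / h) *\<^sub>R (S h x - x) + (1 / h) *\<^sub>R (S h y - y)) \<longlongrightarrow> A x + A y) (at_right 0)"
    by (intro tendsto_add generator_limit xy)
  then have "((\<lambda>h. (1 / h) *\<^sub>R (S h (x + y) - (x + y))) \<longlongrightarrow> A x + A y) (at_right 0)"
    by (rule Lim_transform_eventually)
       (auto simp: eventually_at_right_field S_simps algebra_simps intro!: exI[of _ 1])
  then show ?thesis using generatorI by blast
qed

lemma A_scaleC: "x \<in> D \<Longrightarrow> c *\<^sub>C x \<in> D \<and> A (c *\<^sub>C x) = c *\<^sub>C A x"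
proof -
  assume x: "x \<in> D"
  have "((\<lambda>h. c *\<^sub>C ((1 / h) *\<^sub>R (S h x - x))) \<longlongrightarrow> c *\<^sub>C A x) (at_right 0)"
    by (intro bounded_linear.tendsto[OF bounded_linear_scaleC] generator_limit x)
  then have "((\<lambda>h. (1 / h) *\<^sub>R (S h (c *\<^sub>C x) - (c *\<^sub>C x))) \<longlongrightarrow> c *\<^sub>C A x) (at_right 0)"
    by (rule Lim_transform_eventually)
       (auto simp: eventually_at_right_field S_simps linear_simps[OF bounded_linear_scaleC]
         scaleC_diff_right intro!: exI[of _ 1])
  then show ?thesis using generatorI by blast
qed

lemma csubspace_D: "csubspace D"
proof -
  have "0 \<in> D" by (rule generatorI[of 0 0])
    (rule Lim_transform_eventually[OF tendsto_const],
      auto simp: eventually_at_right_field S_simps intro!: exI[of _ 1])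
  then show ?thesis unfolding csubspace_def using A_add A_scaleC by blast
qed

lemma A_clinear_on: "clinear_on D A"
  unfolding clinear_on_def using A_add A_scaleC by blast

lemma A_S_commute:
  assumes "x \<in> D" "0 \<le> t"
  shows "S t x \<in> D" "A (S t x) = S t (A x)"
proof -
  have "((\<lambda>h. S t ((1 / h) *\<^sub>R (S h x - x))) \<longlongrightarrow> S t (A x)) (at_right 0)"
    using assms by (intro bounded_linear.tendsto[OF bounded_clinear_bounded_linear[OF S_clinear]]
        generator_limit)
  then have "((\<lambda>h. (1 / h) *\<^sub>R (S h (S t x) - S t x)) \<longlongrightarrow> S t (A x)) (at_right 0)"
    by (rule Lim_transform_eventually)
       (use assms in \<open>auto simp: eventually_at_right_field S_simps S_add[symmetric] add.commute
         intro!: exI[of _ 1]\<close>)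
  then show "S t x \<in> D" "A (S t x) = S t (A x)" using generatorI by blast+
qed

text \<open>The generator only provides right derivatives, so the fundamental theorem of calculus does not apply
  directly.  Instead, the difference quotient of the integrated orbit is computed in two ways: once by
  telescoping, and once by letting \<open>S(h)\<close> act on \<open>x\<close> under the integral.\<close>

lemma orbit_increment:
  assumes x: "x \<in> D" and t: "0 \<le> t"
  shows "((\<lambda>s. S s (A x)) has_integral (S t x - x)) {0..t}"
proof -
  define I where "I = integral {0..t} (\<lambda>s. S s x)"
  define J where "J = integral {0..t} (\<lambda>s. S s (A x))"
  obtain M where M: "M \<ge> 1" "\<And>s x. s \<in> {0..t} \<Longrightarrow> norm (S s x) \<le> M * norm x"
    using S_bound[of t] by auto
  have bound: "norm ((1 / h) *\<^sub>R (S h I - I) - J) \<le> M * norm ((1 / h) *\<^sub>R (S h x - x) - A x) * (t - 0)"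
    if h: "0 < h" for h
  proof -
    let ?w = "(1 / h) *\<^sub>R (S h x - x) - A x"
    have "S h I = integral {0..t} (S h \<circ> (\<lambda>s. S s x))"
      unfolding I_def using h S_orbit_integrable
      by (intro integral_linear[symmetric] bounded_clinear_bounded_linear S_clinear) auto
    also have "\<dots> = integral {0..t} (\<lambda>s. S s (S h x))"
      using h by (intro integral_cong) (simp add: S_add[symmetric] add.commute)
    finally have 1: "((\<lambda>s. S s (S h x)) has_integral S h I) {0..t}"
      by (simp add: S_orbit_integrable integrable_integral)
    have 2: "((\<lambda>s. S s x) has_integral I) {0..t}" "((\<lambda>s. S s (A x)) has_integral J) {0..t}"
      by (simp_all add: I_def J_def S_orbit_integrable integrable_integral)
    have "((\<lambda>s. (1 / h) *\<^sub>R (S s (S h x) - S s x) - S s (A x)) has_integral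
        (1 / h) *\<^sub>R (S h I - I) - J) {0..t}"
      by (intro has_integral_diff has_integral_cmul 1 2)
    then have "((\<lambda>s. S s ?w) has_integral (1 / h) *\<^sub>R (S h I - I) - J) {0..t}"
      by (rule has_integral_eq[rotated]) (simp add: S_simps)
    then have "(1 / h) *\<^sub>R (S h I - I) - J = integral {0..t} (\<lambda>s. S s ?w)"
      by (simp add: integral_unique)
    then show ?thesis using M t by (simp only:) (intro integral_bound S_orbit_continuous', auto)
  qed
  have "((\<lambda>h. M * norm ((1 / h) *\<^sub>R (S h x - x) - A x) * (t - 0)) \<longlongrightarrow> M * norm (A x - A x) * (t - 0))
      (at_right 0)"
    by (intro tendsto_mult tendsto_norm tendsto_diff generator_limit x tendsto_const)
  then have "((\<lambda>h. M * norm ((1 / h) *\<^sub>R (S h x - x) - A x) * (t - 0)) \<longlongrightarrow> 0) (at_right 0)" by simp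
  then have "((\<lambda>h. (1 / h) *\<^sub>R (S h I - I) - J) \<longlongrightarrow> 0) (at_right 0)"
    by (rule Lim_null_comparison[rotated])
       (use bound in \<open>auto simp: eventually_at_right_field intro!: exI[of _ 1]\<close>)
  then have "((\<lambda>h. (1 / h) *\<^sub>R (S h I - I)) \<longlongrightarrow> J) (at_right 0)" by (simp add: LIM_zero_iff)
  then have "J = S t x - x"
    using orbit_integral_quotient[OF t, of x] tendsto_unique[OF trivial_limit_at_right_real]
    unfolding I_def by blast
  then show ?thesis using S_orbit_integrable[of 0 "A x" t] unfolding J_def
    by (metis integrable_integral order_refl)
qed

lemma generator_closed:
  assumes x: "\<And>n. x n \<in> D" "x \<longlonglongrightarrow> l" and A: "(\<lambda>n. A (x n)) \<longlonglongrightarrow> y"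
  shows "l \<in> D" "A l = y"
proof -
  have eq: "S h l - l = integral {0..h} (\<lambda>s. S s y)" if h: "0 \<le> h" for h
  proof -
    obtain M where M: "M \<ge> 1" "\<And>s x. s \<in> {0..h} \<Longrightarrow> norm (S s x) \<le> M * norm x"
      using S_bound[of h] by auto
    have "norm ((S h (x n) - x n) - integral {0..h} (\<lambda>s. S s y)) \<le> M * norm (A (x n) - y) * (h - 0)" for n
    proof -
      have "((\<lambda>s. S s (A (x n)) - S s y) has_integral
          (S h (x n) - x n) - integral {0..h} (\<lambda>s. S s y)) {0..h}"
        by (intro has_integral_diff orbit_increment x h integrable_integral S_orbit_integrable) simp
      then have "((\<lambda>s. S s (A (x n) - y)) has_integral
          (S h (x n) - x n) - integral {0..h} (\<lambda>s. S s y)) {0..h}"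
        by (rule has_integral_eq[rotated]) (simp add: S_simps)
      then have "(S h (x n) - x n) - integral {0..h} (\<lambda>s. S s y) = integral {0..h} (\<lambda>s. S s (A (x n) - y))"
        by (simp add: integral_unique)
      then show ?thesis using M h by (simp only:) (intro integral_bound S_orbit_continuous', auto)
    qed
    moreover have "(\<lambda>n. M * norm (A (x n) - y) * (h - 0)) \<longlonglongrightarrow> M * norm (y - y) * (h - 0)"
      by (intro tendsto_intros A)
    moreover have "(\<lambda>n. norm ((S h (x n) - x n) - integral {0..h} (\<lambda>s. S s y)))
        \<longlonglongrightarrow> norm ((S h l - l) - integral {0..h} (\<lambda>s. S s y))"
      by (intro tendsto_intros x bounded_linear.tendsto[OF bounded_clinear_bounded_linear[OF S_clinear]] h)
    ultimately have "norm ((S h l - l) - integral {0..h} (\<lambda>s. S s y)) \<le> M * norm (y - y) * (h - 0)"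
      by (meson LIMSEQ_le)
    then show ?thesis by simp
  qed
  have "((\<lambda>h. (1 / h) *\<^sub>R integral {0..0+h} (\<lambda>s. S s y)) \<longlongrightarrow> S 0 y) (at_right 0)"
    by (intro right_mean_value_limit S_orbit_continuous) simp
  then have "((\<lambda>h. (1 / h) *\<^sub>R (S h l - l)) \<longlongrightarrow> y) (at_right 0)"
    by (subst (asm) S_zero, elim Lim_transform_eventually)
       (auto simp: eventually_at_right_field eq intro!: exI[of _ 1])
  then show "l \<in> D" "A l = y" using generatorI by blast+
qed

lemma closed_graph_A: "closed ((\<lambda>x. (x, A x)) ` D)"
  unfolding closed_sequential_limits
proof (intro allI impI, elim conjE)
  fix f l assume f: "\<forall>n. f n \<in> (\<lambda>x. (x, A x)) ` D" "f \<longlonglongrightarrow> l"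
  have f1: "(\<lambda>n. fst (f n)) \<longlonglongrightarrow> fst l" and f2: "(\<lambda>n. snd (f n)) \<longlonglongrightarrow> snd l"
    using f(2) by (auto intro: tendsto_intros)
  have Af: "fst (f n) \<in> D" "snd (f n) = A (fst (f n))" for n using f(1)[rule_format, of n] by auto
  have "fst l \<in> D" "A (fst l) = snd l"
    using generator_closed[OF Af(1) f1] f2 Af(2) by auto
  then show "l \<in> (\<lambda>x. (x, A x)) ` D" by (intro image_eqI[of _ _ "fst l"]) (auto simp: prod_eq_iff)
qed

lemma dense_D: "closure D = UNIV"
proof -
  have "x \<in> closure D" for x
  proof (rule closed_sequentially[OF closed_closure])
    have "((\<lambda>h. (1 / h) *\<^sub>R integral {0..0+h} (\<lambda>s. S s x)) \<longlongrightarrow> S 0 x) (at_right 0)"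
      by (intro right_mean_value_limit S_orbit_continuous) simp
    moreover have "filterlim (\<lambda>n. inverse (real (Suc n))) (at_right 0) sequentially"
      unfolding filterlim_at using LIMSEQ_inverse_real_of_nat by auto
    ultimately show "(\<lambda>n. (1 / inverse (real (Suc n))) *\<^sub>R
        integral {0..0+inverse (real (Suc n))} (\<lambda>s. S s x)) \<longlonglongrightarrow> x"
      unfolding S_zero by (rule filterlim_compose)
    show "(1 / inverse (real (Suc n))) *\<^sub>R
        integral {0..0+inverse (real (Suc n))} (\<lambda>s. S s x) \<in> closure D" for n
      using csubspace_scaleR[OF csubspace_D orbit_integral_in_domain(1)] closure_subset[of D]
      by (auto simp del: of_nat_Suc)
  qed
  then show ?thesis by auto
qed

end

context c0_generator
begin

abbreviation Ds where "Ds \<equiv> adj_dom D A"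
abbreviation As where "As \<equiv> adj D A"

lemma S_apply_tendsto: "0 \<le> t \<Longrightarrow> (f \<longlongrightarrow> l) F \<Longrightarrow> ((\<lambda>x. S t (f x)) \<longlongrightarrow> S t l) F"
  by (rule S_tendsto) auto

lemma adj_eqI:
  assumes "\<And>\<phi>. \<phi> \<in> D \<Longrightarrow> cinner (A \<phi>) \<psi> = cinner \<phi> \<eta>"
  shows "\<psi> \<in> Ds" "As \<psi> = \<eta>"
proof -
  show "\<psi> \<in> Ds" using assms unfolding adj_dom_def by blast
  show "As \<psi> = \<eta>" unfolding adj_def
  proof (rule the_equality)
    fix \<eta>' assume \<eta>': "\<forall>\<phi>\<in>D. cinner (A \<phi>) \<psi> = cinner \<phi> \<eta>'"
    have "\<eta>' - \<eta> = 0"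
      by (rule separating_if_dense[OF dense_D]) (use \<eta>' assms in \<open>simp add: cinner_diff_right\<close>)
    then show "\<eta>' = \<eta>" by simp
  qed (use assms in blast)
qed

lemma adj_cinner:
  assumes "\<psi> \<in> Ds" "\<phi> \<in> D"
  shows "cinner (A \<phi>) \<psi> = cinner \<phi> (As \<psi>)"
proof -
  obtain \<eta> where "\<And>\<phi>. \<phi> \<in> D \<Longrightarrow> cinner (A \<phi>) \<psi> = cinner \<phi> \<eta>"
    using assms(1) unfolding adj_dom_def by blast
  then show ?thesis using adj_eqI(2) assms(2) by metis
qed

lemma Ds_separating:
  assumes "\<And>\<psi>. \<psi> \<in> Ds \<Longrightarrow> cinner x \<psi> = cinner y \<psi>"
  shows "x = y"
  using adj_dom_separating[OF csubspace_D A_clinear_on closed_graph_A, of "x - y"] assms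
  by (simp add: cinner_diff_left)

lemma adj_add:
  assumes "\<psi> \<in> Ds" "\<eta> \<in> Ds"
  shows "\<psi> + \<eta> \<in> Ds" "As (\<psi> + \<eta>) = As \<psi> + As \<eta>"
proof -
  have "cinner (A \<phi>) (\<psi> + \<eta>) = cinner \<phi> (As \<psi> + As \<eta>)" if "\<phi> \<in> D" for \<phi>
    using that by (simp add: cinner_add_right adj_cinner assms)
  note * = this
  show "\<psi> + \<eta> \<in> Ds" by (rule adj_eqI(1)[OF *])
  show "As (\<psi> + \<eta>) = As \<psi> + As \<eta>" by (rule adj_eqI(2)[OF *])
qed

lemma adj_scaleC:
  assumes "\<psi> \<in> Ds"
  shows "c *\<^sub>C \<psi> \<in> Ds" "As (c *\<^sub>C \<psi>) = c *\<^sub>C As \<psi>"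
proof -
  have "cinner (A \<phi>) (c *\<^sub>C \<psi>) = cinner \<phi> (c *\<^sub>C As \<psi>)" if "\<phi> \<in> D" for \<phi>
    using that by (simp add: cinner_scaleC_right adj_cinner assms)
  note * = this
  show "c *\<^sub>C \<psi> \<in> Ds" by (rule adj_eqI(1)[OF *])
  show "As (c *\<^sub>C \<psi>) = c *\<^sub>C As \<psi>" by (rule adj_eqI(2)[OF *])
qed

lemma adj_S:
  assumes "\<psi> \<in> Ds" "0 \<le> t"
  shows "hadj (S t) \<psi> \<in> Ds" "As (hadj (S t) \<psi>) = hadj (S t) (As \<psi>)"
proof -
  have "cinner (A \<phi>) (hadj (S t) \<psi>) = cinner \<phi> (hadj (S t) (As \<psi>))" if "\<phi> \<in> D" for \<phi>
    using that adj_cinner[OF assms(1) A_S_commute(1)[OF that assms(2)]]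
    by (simp add: hadj[OF S_clinear[OF assms(2)], symmetric] A_S_commute assms)
  note * = this
  show "hadj (S t) \<psi> \<in> Ds" by (rule adj_eqI(1)[OF *])
  show "As (hadj (S t) \<psi>) = hadj (S t) (As \<psi>)" by (rule adj_eqI(2)[OF *])
qed

lemma csubspace_graph_As: "csubspace ((\<lambda>\<psi>. (\<psi>, As \<psi>)) ` Ds)"
  unfolding csubspace_def
proof (intro conjI ballI allI)
  have "cinner (A \<phi>) 0 = cinner \<phi> 0" for \<phi> by simp
  then have "0 \<in> Ds" "As 0 = 0" using adj_eqI(1)[of 0 0] adj_eqI(2)[of 0 0] by blast+
  then show "0 \<in> (\<lambda>\<psi>. (\<psi>, As \<psi>)) ` Ds" by (intro image_eqI[of _ _ 0]) (auto simp: zero_prod_def)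
qed (auto simp: image_iff adj_add adj_scaleC)

lemma closed_graph_As: "closed ((\<lambda>\<psi>. (\<psi>, As \<psi>)) ` Ds)"
  unfolding closed_sequential_limits
proof (intro allI impI, elim conjE)
  fix f l assume f: "\<forall>n. f n \<in> (\<lambda>\<psi>. (\<psi>, As \<psi>)) ` Ds" "f \<longlonglongrightarrow> l"
  have f1: "(\<lambda>n. fst (f n)) \<longlonglongrightarrow> fst l" and f2: "(\<lambda>n. snd (f n)) \<longlonglongrightarrow> snd l"
    using f(2) by (auto intro: tendsto_intros)
  have Af: "fst (f n) \<in> Ds" "snd (f n) = As (fst (f n))" for n using f(1)[rule_format, of n] by auto
  have "cinner (A \<phi>) (fst l) = cinner \<phi> (snd l)" if "\<phi> \<in> D" for \<phi>
  proof (rule LIMSEQ_unique)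
    show "(\<lambda>n. cinner (A \<phi>) (fst (f n))) \<longlonglongrightarrow> cinner (A \<phi>) (fst l)"
      by (intro tendsto_cinner tendsto_const f1)
    show "(\<lambda>n. cinner (A \<phi>) (fst (f n))) \<longlonglongrightarrow> cinner \<phi> (snd l)"
      unfolding adj_cinner[OF Af(1) that] Af(2)[symmetric] by (intro tendsto_cinner tendsto_const f2)
  qed
  then have "fst l \<in> Ds" "As (fst l) = snd l"
    using adj_eqI(1)[of "fst l" "snd l"] adj_eqI(2)[of "fst l" "snd l"] by blast+
  then show "l \<in> (\<lambda>\<psi>. (\<psi>, As \<psi>)) ` Ds" by (intro image_eqI[of _ _ "fst l"]) (auto simp: prod_eq_iff)
qed

lemma orbit_derivative:
  assumes x: "x \<in> D" and s: "s \<in> {0..T}"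
  shows "((\<lambda>s. S s x) has_vector_derivative S s (A x)) (at s within {0..T})"
proof -
  have 1: "((\<lambda>u. x + integral {0..u} (\<lambda>s. S s (A x))) has_vector_derivative 0 + S s (A x)) (at s within {0..T})"
    by (intro has_vector_derivative_add has_vector_derivative_const integral_has_vector_derivative
        S_orbit_continuous' s) simp
  have 2: "x + integral {0..u} (\<lambda>s. S s (A x)) = S u x" if "u \<in> {0..T}" for u
    using orbit_increment[OF x, of u] that by (simp add: integral_unique)
  from has_vector_derivative_transform[OF s 2[symmetric] 1] show ?thesis by simp
qed

lemma weak_orbit_derivative:
  assumes \<psi>: "\<psi> \<in> Ds" and s: "s \<in> {0..T}"
  shows "((\<lambda>s. cinner (S s x) \<psi>) has_vector_derivative cinner (S s x) (As \<psi>)) (at s within {0..T})"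
proof -
  let ?f = "\<lambda>s. cinner (S s x) (As \<psi>)"
  have cont: "continuous_on {0..T} ?f"
    by (intro continuous_on_cinner S_orbit_continuous' continuous_on_const) simp
  have 1: "((\<lambda>u. cinner x \<psi> + integral {0..u} ?f) has_vector_derivative 0 + ?f s) (at s within {0..T})"
    by (intro has_vector_derivative_add has_vector_derivative_const integral_has_vector_derivative cont s)
  have 2: "cinner x \<psi> + integral {0..u} ?f = cinner (S u x) \<psi>" if "u \<in> {0..T}" for u
  proof -
    have u: "0 \<le> u" using that by simp
    have "integral {0..u} ((\<lambda>v. cinner v (As \<psi>)) \<circ> (\<lambda>s. S s x)) = cinner (integral {0..u} (\<lambda>s. S s x)) (As \<psi>)"
      by (intro integral_linear S_orbit_integrable bounded_linear_cinner_left) simp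
    also have "\<dots> = cinner (S u x - x) \<psi>"
      using adj_cinner[OF \<psi> orbit_integral_in_domain(1)[OF u]] orbit_integral_in_domain(2)[OF u] by simp
    finally show ?thesis by (simp add: o_def cinner_diff_left)
  qed
  from has_vector_derivative_transform[OF s 2[symmetric] 1] show ?thesis by simp
qed

text \<open>The fundamental theorem of calculus for \<open>s \<mapsto> \<langle>S(t - s) q(s), \<psi>\<rangle>\<close>.  Testing with \<open>\<psi>\<close> in \<open>D(A\<^sup>*)\<close> moves
  the generator to the test vector, so that \<open>q\<close> may take arbitrary values in \<open>X\<close>.\<close>

theorem weak_duhamel:
  assumes \<psi>: "\<psi> \<in> Ds" and t: "0 \<le> t"
    and q: "\<And>s. s \<in> {0..t} \<Longrightarrow> (q has_vector_derivative q' s) (at s within {0..t})"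
  shows "((\<lambda>s. cinner (S (t - s) (q' s)) \<psi> - cinner (S (t - s) (q s)) (As \<psi>)) has_integral
    cinner (q t) \<psi> - cinner (S t (q 0)) \<psi>) {0..t}"
proof -
  let ?F = "\<lambda>s. cinner (S (t - s) (q s)) \<psi>"
  have "(?F has_vector_derivative cinner (S (t - s) (q' s)) \<psi> - cinner (S (t - s) (q s)) (As \<psi>))
      (at s within {0..t})" if s: "s \<in> {0..t}" for s
  proof -
    let ?m = "\<lambda>r. cinner (S r (q s)) \<psi>"
    have img: "(\<lambda>r. t - r) ` {0..t} = {0..t}" by (auto simp: image_iff intro: bexI[of _ "t - _"])
    have "((\<lambda>r. t - r) has_vector_derivative -1) (at s within {0..t})"
      by (auto intro!: derivative_eq_intros)
    moreover have "(?m has_vector_derivative cinner (S (t - s) (q s)) (As \<psi>)) (at (t - s) within (\<lambda>r. t - r) ` {0..t})"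
      unfolding img by (rule weak_orbit_derivative[OF \<psi>]) (use s in auto)
    ultimately have 1: "((?m \<circ> (\<lambda>r. t - r)) has_vector_derivative
        (-1) *\<^sub>R cinner (S (t - s) (q s)) (As \<psi>)) (at s within {0..t})"
      by (rule vector_diff_chain_within)
    have "((\<lambda>r. cinner (S (t - r) (q r - q s)) \<psi>) has_vector_derivative cinner (S (t - s) (q' s)) \<psi>)
        (at s within {0..t})"
      unfolding has_vector_derivative_iff_quotient
    proof (rule Lim_transform_eventually)
      show "((\<lambda>r. cinner (S (t - r) ((1 / (r - s)) *\<^sub>R (q r - q s))) \<psi>) \<longlongrightarrow> cinner (S (t - s) (q' s)) \<psi>)
          (at s within {0..t})"
        using q[OF s] s unfolding has_vector_derivative_iff_quotient
        by (intro tendsto_cinner S_tendsto tendsto_intros) (auto simp: eventually_at_filter)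
      show "\<forall>\<^sub>F r in at s within {0..t}. cinner (S (t - r) ((1 / (r - s)) *\<^sub>R (q r - q s))) \<psi> =
          (1 / (r - s)) *\<^sub>R (cinner (S (t - r) (q r - q s)) \<psi> - cinner (S (t - s) (q s - q s)) \<psi>)"
        using s by (auto simp: eventually_at_filter S_simps cinner_simps)
    qed
    from has_vector_derivative_add[OF this 1]
    have 2: "((\<lambda>r. cinner (S (t - r) (q r - q s)) \<psi> + (?m \<circ> (\<lambda>r. t - r)) r) has_vector_derivative
        cinner (S (t - s) (q' s)) \<psi> - cinner (S (t - s) (q s)) (As \<psi>)) (at s within {0..t})"
      by simp
    have "cinner (S (t - r) (q r - q s)) \<psi> + (?m \<circ> (\<lambda>r. t - r)) r = ?F r" if "r \<in> {0..t}" for r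
      using that by (simp add: S_simps cinner_simps)
    then show ?thesis using has_vector_derivative_transform[OF s _ 2, of ?F] by simp
  qed
  from fundamental_theorem_of_calculus[OF t this] show ?thesis by (simp add: S_zero)
qed

end

text \<open>For \<open>x\<close> in \<open>D(A)\<close> the function \<open>s \<mapsto> \<langle>S(t - s) S'(s) x, \<psi>\<rangle>\<close> has derivative \<open>0\<close>.  The lemma identifies
  the semigroup whose existence is part of (AEDC) with the given one.\<close>

theorem semigroup_unique:
  assumes "generates D A S" "generates D A S'" and t: "0 \<le> t"
  shows "S' t x = S t x"
proof -
  interpret S: c0_generator D A S by unfold_locales fact
  interpret S': c0_generator D A S' by unfold_locales fact
  have onD: "S' t x = S t x" if x: "x \<in> D" for x
  proof (rule S.Ds_separating)
    fix \<psi> assume \<psi>: "\<psi> \<in> S.Ds"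
    have "((\<lambda>s. cinner (S (t - s) (S' s (A x))) \<psi> - cinner (S (t - s) (S' s x)) (S.As \<psi>)) has_integral
        cinner (S' t x) \<psi> - cinner (S t (S' 0 x)) \<psi>) {0..t}"
      by (rule S.weak_duhamel[OF \<psi> t]) (rule S'.orbit_derivative[OF x])
    moreover have "cinner (S (t - s) (S' s (A x))) \<psi> - cinner (S (t - s) (S' s x)) (S.As \<psi>) = 0"
      if "s \<in> {0..t}" for s
    proof -
      have "S (t - s) (S' s (A x)) = A (S (t - s) (S' s x))" "S (t - s) (S' s x) \<in> D"
        using that x by (auto simp: S.A_S_commute S'.A_S_commute)
      then show ?thesis by (simp add: S.adj_cinner[OF \<psi>])
    qed
    ultimately have "((\<lambda>s. 0) has_integral cinner (S' t x) \<psi> - cinner (S t (S' 0 x)) \<psi>) {0..t}"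
      by (rule has_integral_eq[rotated]) auto
    then show "cinner (S' t x) \<psi> = cinner (S t x) \<psi>"
      by (simp add: S'.S_zero has_integral_0_eq)
  qed
  obtain f where f: "\<forall>n. f n \<in> D" "f \<longlonglongrightarrow> x" using S.dense_D closure_sequential[of x D] by blast
  have "(\<lambda>n. S t (f n)) \<longlonglongrightarrow> S t x" "(\<lambda>n. S' t (f n)) \<longlonglongrightarrow> S' t x"
    using S.S_apply_tendsto[OF t f(2)] S'.S_apply_tendsto[OF t f(2)] by auto
  then show ?thesis using onD f(1) LIMSEQ_unique by auto
qed

lemma has_integral_exp_decay:
  fixes k :: real
  assumes "0 < k" "a \<le> b"
  shows "((\<lambda>s. exp (- k * s)) has_integral (exp (- k * a) - exp (- k * b)) / k) {a..b}"
proof -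
  have "((\<lambda>s. exp (- k * s)) has_integral (- exp (- k * b) / k) - (- exp (- k * a) / k)) {a..b}"
    using assms by (intro fundamental_theorem_of_calculus)
      (auto intro!: derivative_eq_intros simp: has_real_derivative_iff_has_vector_derivative[symmetric])
  then show ?thesis by (simp add: diff_divide_distrib)
qed

lemma generates_rescale:
  assumes "generates D A S"
  shows "generates D (\<lambda>x. A x - c *\<^sub>R x) (\<lambda>t x. exp (- c * t) *\<^sub>R S t x)"
proof -
  interpret c0_generator D A S by unfold_locales fact
  have e: "((\<lambda>h. exp (- c * h)) \<longlongrightarrow> 1) (at_right 0)"
  proof -
    have "((\<lambda>h. exp (- c * h)) \<longlongrightarrow> exp (- c * 0)) (at_right 0)" by (intro tendsto_intros)
    then show ?thesis by simp
  qed
  have e': "((\<lambda>h. (exp (- c * h) - 1) / h) \<longlongrightarrow> - c) (at_right 0)"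
  proof -
    have "((\<lambda>h. exp (- c * h)) has_vector_derivative - c) (at 0 within {0<..})"
      by (auto intro!: derivative_eq_intros simp: has_real_derivative_iff_has_vector_derivative[symmetric])
    then show ?thesis unfolding has_vector_derivative_iff_quotient by (simp add: divide_inverse_commute)
  qed
  have semigroup: "C0_semigroup (\<lambda>t x. exp (- c * t) *\<^sub>R S t x)"
    unfolding C0_semigroup_def
  proof (intro conjI allI impI)
    show "bounded_clinear (\<lambda>x. exp (- c * t) *\<^sub>R S t x)" if "0 \<le> t" for t
      by (intro bounded_clinear_scaleR S_clinear that)
    show "exp (- c * 0) *\<^sub>R S 0 x = x" for x by (simp add: S_zero)
    show "exp (- c * (s + t)) *\<^sub>R S (s + t) x = exp (- c * s) *\<^sub>R S s (exp (- c * t) *\<^sub>R S t x)"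
      if "0 \<le> s" "0 \<le> t" for s t x
      using that by (simp add: S_add S_simps exp_add[symmetric] algebra_simps)
    have "((\<lambda>t. exp (- c * t) *\<^sub>R S t x) \<longlongrightarrow> 1 *\<^sub>R x) (at_right 0)" for x
      by (intro tendsto_scaleR e S_right)
    then show "((\<lambda>t. exp (- c * t) *\<^sub>R S t x) \<longlongrightarrow> x) (at_right 0)" for x by simp
  qed
  have "(x \<in> D \<and> A x - c *\<^sub>R x = y) \<longleftrightarrow>
      ((\<lambda>h. (1 / h) *\<^sub>R (exp (- c * h) *\<^sub>R S h x - x)) \<longlongrightarrow> y) (at_right 0)" for x y
  proof
    assume xy: "x \<in> D \<and> A x - c *\<^sub>R x = y"
    have "((\<lambda>h. exp (- c * h) *\<^sub>R ((1 / h) *\<^sub>R (S h x - x)) + ((exp (- c * h) - 1) / h) *\<^sub>R x)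
        \<longlongrightarrow> 1 *\<^sub>R A x + (- c) *\<^sub>R x) (at_right 0)"
      using xy by (intro tendsto_add tendsto_scaleR e e' tendsto_const generator_limit) simp
    then have "((\<lambda>h. exp (- c * h) *\<^sub>R ((1 / h) *\<^sub>R (S h x - x)) + ((exp (- c * h) - 1) / h) *\<^sub>R x)
        \<longlongrightarrow> y) (at_right 0)" using xy by simp
    then show "((\<lambda>h. (1 / h) *\<^sub>R (exp (- c * h) *\<^sub>R S h x - x)) \<longlongrightarrow> y) (at_right 0)"
      by (rule Lim_transform_eventually)
         (auto simp: eventually_at_right_field algebra_simps diff_divide_distrib intro!: exI[of _ 1])
  next
    assume lim: "((\<lambda>h. (1 / h) *\<^sub>R (exp (- c * h) *\<^sub>R S h x - x)) \<longlongrightarrow> y) (at_right 0)"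
    have "((\<lambda>h. (1 / exp (- c * h)) *\<^sub>R ((1 / h) *\<^sub>R (exp (- c * h) *\<^sub>R S h x - x) - ((exp (- c * h) - 1) / h) *\<^sub>R x))
        \<longlongrightarrow> (1 / 1) *\<^sub>R (y - (- c) *\<^sub>R x)) (at_right 0)"
      by (intro tendsto_scaleR tendsto_divide tendsto_diff e e' tendsto_const lim) simp
    then have "((\<lambda>h. (1 / exp (- c * h)) *\<^sub>R ((1 / h) *\<^sub>R (exp (- c * h) *\<^sub>R S h x - x) - ((exp (- c * h) - 1) / h) *\<^sub>R x))
        \<longlongrightarrow> y + c *\<^sub>R x) (at_right 0)" by simp
    then have "((\<lambda>h. (1 / h) *\<^sub>R (S h x - x)) \<longlongrightarrow> y + c *\<^sub>R x) (at_right 0)"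
    proof (rule Lim_transform_eventually)
      have "(1 / exp (- c * h)) *\<^sub>R ((1 / h) *\<^sub>R (exp (- c * h) *\<^sub>R S h x - x) - ((exp (- c * h) - 1) / h) *\<^sub>R x)
          = (1 / h) *\<^sub>R (S h x - x)" if "h > 0" for h
      proof -
        have "(1 / h) *\<^sub>R (exp (- c * h) *\<^sub>R S h x - x) - ((exp (- c * h) - 1) / h) *\<^sub>R x
            = exp (- c * h) *\<^sub>R ((1 / h) *\<^sub>R (S h x - x))"
          by (simp add: algebra_simps diff_divide_distrib)
        then show ?thesis by simp
      qed
      then show "\<forall>\<^sub>F h in at_right 0. (1 / exp (- c * h)) *\<^sub>R ((1 / h) *\<^sub>R (exp (- c * h) *\<^sub>R S h x - x)
          - ((exp (- c * h) - 1) / h) *\<^sub>R x) = (1 / h) *\<^sub>R (S h x - x)"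
        by (auto simp: eventually_at_right_field intro!: exI[of _ 1])
    qed
    then show "x \<in> D \<and> A x - c *\<^sub>R x = y" using generatorI by force
  qed
  with semigroup show ?thesis unfolding generates_def by blast
qed

context c0_generator
begin

text \<open>The vector \<open>r\<close> is the Laplace transform of the orbit of \<open>x\<close> at \<open>\<mu>\<close>.  Since a bound on the whole orbit of
  \<open>x\<close> is turned into one on the whole orbit of \<open>r\<close>, the lemma can be iterated: each application of the
  resolvent gains a factor \<open>1 / (\<mu> + \<alpha>)\<close>, and the constant of the semigroup enters only once.\<close>

theorem resolvent_of_decaying_orbit:
  assumes decay: "\<And>t. 0 \<le> t \<Longrightarrow> norm (S t x) \<le> m * exp (- \<alpha> * t)" and pos: "0 < \<mu> + \<alpha>"
  shows "\<exists>r\<in>D. \<mu> *\<^sub>R r - A r = x \<and> (\<forall>t\<ge>0. norm (S t r) \<le> m / (\<mu> + \<alpha>) * exp (- \<alpha> * t))"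
proof -
  define U where "U t x = exp (- \<mu> * t) *\<^sub>R S t x" for t x
  have "generates D (\<lambda>x. A x - \<mu> *\<^sub>R x) U" unfolding U_def by (rule generates_rescale[OF generates])
  then interpret U: c0_generator D "\<lambda>x. A x - \<mu> *\<^sub>R x" U by unfold_locales
  have m: "0 \<le> m" using decay[of 0] norm_ge_zero[of "S 0 x"] by (simp del: norm_ge_zero)
  \<comment> \<open>with \<open>t = 0\<close> this gives convergence of the truncated transforms, with \<open>a = 0\<close> the bound on the limit\<close>
  have tail: "norm (S t (integral {a..b} (\<lambda>s. U s x))) \<le> m / (\<mu> + \<alpha>) * exp (- \<alpha> * t) * exp (- (\<mu> + \<alpha>) * a)"
    if t: "0 \<le> t" and ab: "0 \<le> a" "a \<le> b" for t a b
  proof -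
    let ?g = "\<lambda>s. m * exp (- \<alpha> * t) * exp (- (\<mu> + \<alpha>) * s)"
    have "(?g has_integral m * exp (- \<alpha> * t) *
        ((exp (- (\<mu> + \<alpha>) * a) - exp (- (\<mu> + \<alpha>) * b)) / (\<mu> + \<alpha>))) {a..b}"
      by (intro has_integral_mult_right has_integral_exp_decay pos ab)
    note gi = this
    have g: "?g integrable_on {a..b}"
      "integral {a..b} ?g = m / (\<mu> + \<alpha>) * exp (- \<alpha> * t) * (exp (- (\<mu> + \<alpha>) * a) - exp (- (\<mu> + \<alpha>) * b))"
      using has_integral_integrable[OF gi] integral_unique[OF gi] by (auto simp del: integral_mult_right)
    have lin: "bounded_linear (S t)" by (intro bounded_clinear_bounded_linear S_clinear t)
    have int: "(S t \<circ> (\<lambda>s. U s x)) integrable_on {a..b}"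
      by (intro integrable_linear U.S_orbit_integrable lin ab)
    have "norm (integral {a..b} (S t \<circ> (\<lambda>s. U s x))) \<le> integral {a..b} ?g"
    proof (rule integral_norm_bound_integral[OF int g(1)])
      fix s assume s: "s \<in> {a..b}"
      have "norm ((S t \<circ> (\<lambda>s. U s x)) s) = exp (- \<mu> * s) * norm (S (t + s) x)"
        using s ab t by (simp add: U_def S_simps S_add)
      also have "\<dots> \<le> exp (- \<mu> * s) * (m * exp (- \<alpha> * (t + s)))"
        using s ab t by (intro mult_left_mono decay) auto
      also have "\<dots> = ?g s" by (simp add: algebra_simps flip: exp_add)
      finally show "norm ((S t \<circ> (\<lambda>s. U s x)) s) \<le> ?g s" .
    qed
    also have "\<dots> \<le> m / (\<mu> + \<alpha>) * exp (- \<alpha> * t) * exp (- (\<mu> + \<alpha>) * a)"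
      unfolding g(2) using m pos by (intro mult_left_mono) auto
    also have "integral {a..b} (S t \<circ> (\<lambda>s. U s x)) = S t (integral {a..b} (\<lambda>s. U s x))"
      by (intro integral_linear U.S_orbit_integrable lin ab)
    finally show ?thesis .
  qed
  define z where "z n = integral {0..real n} (\<lambda>s. U s x)" for n :: nat
  have e0: "(\<lambda>n. exp (- (\<mu> + \<alpha>) * real n)) \<longlonglongrightarrow> 0"
  proof -
    have "(\<lambda>n. exp (- (\<mu> + \<alpha>)) ^ n) \<longlonglongrightarrow> 0" using pos by (intro LIMSEQ_power_zero) simp
    then show ?thesis by (simp add: exp_of_nat_mult[symmetric] mult.commute)
  qed
  have "Cauchy z"
  proof (rule metric_CauchyI)
    fix e :: real assume "e > 0"
    have "(\<lambda>n. m / (\<mu> + \<alpha>) * exp (- (\<mu> + \<alpha>) * real n)) \<longlonglongrightarrow> m / (\<mu> + \<alpha>) * 0"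
      by (intro tendsto_mult tendsto_const e0)
    then have "\<forall>\<^sub>F n in sequentially. m / (\<mu> + \<alpha>) * exp (- (\<mu> + \<alpha>) * real n) < e"
      using \<open>e > 0\<close> by (intro order_tendstoD(2)) auto
    then obtain N where N: "\<And>n. n \<ge> N \<Longrightarrow> m / (\<mu> + \<alpha>) * exp (- (\<mu> + \<alpha>) * real n) < e"
      by (auto simp: eventually_sequentially)
    have *: "dist (z k) (z n) < e" if "N \<le> n" "n \<le> k" for k n
    proof -
      have "z n + integral {real n..real k} (\<lambda>s. U s x) = z k" unfolding z_def
        using that by (intro Henstock_Kurzweil_Integration.integral_combine U.S_orbit_integrable) auto
      then have "z k - z n = S 0 (integral {real n..real k} (\<lambda>s. U s x))" by (simp add: S_zero algebra_simps)
      then show ?thesis using tail[of 0 "real n" "real k"] N[of n] that by (simp add: dist_norm)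
    qed
    show "\<exists>M. \<forall>k\<ge>M. \<forall>n\<ge>M. dist (z k) (z n) < e"
      by (intro exI[of _ N]) (metis * dist_commute linear)
  qed
  then obtain r where r: "z \<longlonglongrightarrow> r" using Cauchy_convergent convergent_def by blast
  have Az: "z n \<in> D" "A (z n) - \<mu> *\<^sub>R z n = U (real n) x - x" for n
    using U.orbit_integral_in_domain[of "real n" x] by (auto simp: z_def)
  have "(\<lambda>n. U (real n) x) \<longlonglongrightarrow> 0"
  proof (rule Lim_null_comparison)
    have "norm (U (real n) x) \<le> m * exp (- (\<mu> + \<alpha>) * real n)" for n
    proof -
      have "norm (U (real n) x) = exp (- \<mu> * real n) * norm (S (real n) x)" by (simp add: U_def)
      also have "\<dots> \<le> exp (- \<mu> * real n) * (m * exp (- \<alpha> * real n))" by (intro mult_left_mono decay) auto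
      also have "\<dots> = m * exp (- (\<mu> + \<alpha>) * real n)" by (simp add: algebra_simps flip: exp_add)
      finally show ?thesis .
    qed
    then show "\<forall>\<^sub>F n in sequentially. norm (U (real n) x) \<le> m * exp (- (\<mu> + \<alpha>) * real n)" by simp
    show "(\<lambda>n. m * exp (- (\<mu> + \<alpha>) * real n)) \<longlonglongrightarrow> 0" using tendsto_mult[OF tendsto_const e0, of m] by simp
  qed
  then have "(\<lambda>n. A (z n) - \<mu> *\<^sub>R z n) \<longlonglongrightarrow> 0 - x" unfolding Az by (intro tendsto_diff tendsto_const)
  then have rD: "r \<in> D" "A r - \<mu> *\<^sub>R r = 0 - x" using U.generator_closed[OF Az(1) r] by auto
  have "norm (S t r) \<le> m / (\<mu> + \<alpha>) * exp (- \<alpha> * t)" if t: "0 \<le> t" for t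
  proof (rule LIMSEQ_le_const2)
    show "(\<lambda>n. norm (S t (z n))) \<longlonglongrightarrow> norm (S t r)"
      by (intro tendsto_norm S_apply_tendsto t r)
    show "\<exists>N. \<forall>n\<ge>N. norm (S t (z n)) \<le> m / (\<mu> + \<alpha>) * exp (- \<alpha> * t)"
      using tail[of t 0] t by (auto simp: z_def)
  qed
  moreover have "\<mu> *\<^sub>R r - A r = x" using rD(2) by (simp add: algebra_simps)
  ultimately show ?thesis using rD(1) by blast
qed

end

section \<open>The extrapolation space in coordinates\<close>

context c0_generator
begin

text \<open>The element \<open>a + A b\<close> of \<open>X\<^sub>-\<^sub>1\<close>, for \<open>p = (a, b)\<close> and the extended operator \<open>A : X \<rightarrow> X\<^sub>-\<^sub>1\<close>.\<close>

definition J :: "'x \<times> 'x \<Rightarrow> 'x \<Rightarrow> complex" where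
  "J p = (\<lambda>\<psi>. if \<psi> \<in> Ds then cinner p (\<psi>, As \<psi>) else 0)"

lemma J_apply: "\<psi> \<in> Ds \<Longrightarrow> J p \<psi> = cinner p (\<psi>, As \<psi>)"
  by (simp add: J_def)

lemma J_add: "J (p + q) = (\<lambda>\<psi>. J p \<psi> + J q \<psi>)"
  by (auto simp: J_def cinner_add_left)

lemma J_scaleC: "J (c *\<^sub>C p) = (\<lambda>\<psi>. c * J p \<psi>)"
  by (auto simp: J_def cinner_scaleC_left)

lemma embed_eq_J: "Xm1_embed D A x = J (x, 0)"
  by (auto simp: Xm1_embed_def J_def)

lemma graph_norm_eq: "graph_norm As \<psi> = norm (\<psi>, As \<psi>)"
  by (simp add: graph_norm_def norm_Pair)

lemma graph_norm_nonneg: "0 \<le> graph_norm As \<psi>"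
  unfolding graph_norm_eq by simp

lemma zero_in_Ds: "0 \<in> Ds" and As_zero: "As 0 = 0"
  using adj_eqI(1)[of 0 0] adj_eqI(2)[of 0 0] by auto

lemma Xm1I:
  assumes "\<And>\<psi> \<eta>. \<psi> \<in> Ds \<Longrightarrow> \<eta> \<in> Ds \<Longrightarrow> f (\<psi> + \<eta>) = f \<psi> + f \<eta>"
    "\<And>c \<psi>. \<psi> \<in> Ds \<Longrightarrow> f (c *\<^sub>C \<psi>) = cnj c * f \<psi>"
    "\<And>\<psi>. \<psi> \<in> Ds \<Longrightarrow> cmod (f \<psi>) \<le> C * graph_norm As \<psi>"
    "\<And>\<psi>. \<psi> \<notin> Ds \<Longrightarrow> f \<psi> = 0"
  shows "f \<in> Xm1 D A"
  using assms unfolding Xm1_def by blast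

lemma Xm1D:
  assumes "f \<in> Xm1 D A"
  shows "\<psi> \<in> Ds \<Longrightarrow> \<eta> \<in> Ds \<Longrightarrow> f (\<psi> + \<eta>) = f \<psi> + f \<eta>"
    "\<psi> \<in> Ds \<Longrightarrow> f (c *\<^sub>C \<psi>) = cnj c * f \<psi>"
    "\<exists>C. \<forall>\<psi>\<in>Ds. cmod (f \<psi>) \<le> C * graph_norm As \<psi>"
    "\<psi> \<notin> Ds \<Longrightarrow> f \<psi> = 0"
  using assms unfolding Xm1_def by blast+

lemma J_bound: "\<psi> \<in> Ds \<Longrightarrow> cmod (J p \<psi>) \<le> norm p * graph_norm As \<psi>"
  unfolding graph_norm_eq by (simp only: J_apply cauchy_schwarz)

lemma J_in_Xm1: "J p \<in> Xm1 D A"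
proof (rule Xm1I)
  fix \<psi> \<eta> assume *: "\<psi> \<in> Ds" "\<eta> \<in> Ds"
  have "(\<psi> + \<eta>, As (\<psi> + \<eta>)) = (\<psi>, As \<psi>) + (\<eta>, As \<eta>)" using * by (simp add: adj_add)
  then show "J p (\<psi> + \<eta>) = J p \<psi> + J p \<eta>"
    using * adj_add(1)[OF *] by (simp only: J_apply cinner_add_right)
next
  fix c \<psi> assume *: "\<psi> \<in> Ds"
  have "(c *\<^sub>C \<psi>, As (c *\<^sub>C \<psi>)) = c *\<^sub>C (\<psi>, As \<psi>)" using * by (simp add: adj_scaleC)
  then show "J p (c *\<^sub>C \<psi>) = cnj c * J p \<psi>"
    using * adj_scaleC(1)[OF *] by (simp only: J_apply cinner_scaleC_right)
qed (rule J_bound, auto simp: J_def)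

lemma Xm1_norm_le:
  assumes "\<And>\<psi>. \<psi> \<in> Ds \<Longrightarrow> cmod (f \<psi>) \<le> C * graph_norm As \<psi>" "0 \<le> C"
  shows "Xm1_norm D A f \<le> C"
  unfolding Xm1_norm_def
proof (rule cSUP_least)
  show "{\<psi> \<in> Ds. graph_norm As \<psi> \<le> 1} \<noteq> {}"
    using zero_in_Ds As_zero by (auto simp: graph_norm_def intro!: exI[of _ 0])
next
  fix \<psi> assume "\<psi> \<in> {\<psi> \<in> Ds. graph_norm As \<psi> \<le> 1}"
  then show "cmod (f \<psi>) \<le> C"
    using assms(1)[of \<psi>] mult_left_mono[of "graph_norm As \<psi>" 1 C] assms(2) by auto
qed

lemma Xm1_norm_bound:
  assumes f: "f \<in> Xm1 D A" and \<psi>: "\<psi> \<in> Ds"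
  shows "cmod (f \<psi>) \<le> Xm1_norm D A f * graph_norm As \<psi>"
proof -
  obtain C where C: "\<And>\<psi>. \<psi> \<in> Ds \<Longrightarrow> cmod (f \<psi>) \<le> C * graph_norm As \<psi>" using Xm1D(3)[OF f] by blast
  have up: "cmod (f \<eta>) \<le> Xm1_norm D A f" if "\<eta> \<in> Ds" "graph_norm As \<eta> \<le> 1" for \<eta>
    unfolding Xm1_norm_def
  proof (rule cSUP_upper)
    show "bdd_above ((\<lambda>\<psi>. cmod (f \<psi>)) ` {\<psi> \<in> Ds. graph_norm As \<psi> \<le> 1})"
    proof (rule bdd_aboveI2[where M = "\<bar>C\<bar>"])
      fix \<psi> assume \<psi>: "\<psi> \<in> {\<psi> \<in> Ds. graph_norm As \<psi> \<le> 1}"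
      have "C * graph_norm As \<psi> \<le> \<bar>C\<bar> * 1"
        using \<psi> graph_norm_nonneg[of \<psi>] by (intro mult_mono) auto
      then show "cmod (f \<psi>) \<le> \<bar>C\<bar>" using C[of \<psi>] \<psi> by simp
    qed
  qed (use that in simp)
  show ?thesis
  proof (cases "graph_norm As \<psi> = 0")
    case True
    then show ?thesis using C[OF \<psi>] by simp
  next
    case False
    define r where "r = graph_norm As \<psi>"
    have r: "r > 0" using False graph_norm_nonneg[of \<psi>] by (simp add: r_def)
    let ?\<eta> = "complex_of_real (1 / r) *\<^sub>C \<psi>"
    have "graph_norm As ?\<eta> = (1 / r) * r"
      unfolding graph_norm_eq adj_scaleC(2)[OF \<psi>] scaleC_Pair[symmetric] norm_scaleC
      using r by (simp add: r_def graph_norm_eq norm_divide)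
    then have "cmod (f ?\<eta>) \<le> Xm1_norm D A f" using r by (intro up adj_scaleC \<psi>) auto
    then have "cmod (f \<psi>) / r \<le> Xm1_norm D A f"
      using r by (simp add: Xm1D(2)[OF f \<psi>] norm_mult norm_divide)
    then show ?thesis using r by (simp add: r_def field_simps)
  qed
qed

lemma J_norm: "Xm1_norm D A (J p) \<le> norm p"
  by (rule Xm1_norm_le) (auto simp: J_bound)

abbreviation graph_As where "graph_As \<equiv> (\<lambda>\<psi>. (\<psi>, As \<psi>)) ` Ds"

text \<open>The Riesz theorem on the graph of \<open>A\<^sup>*\<close>, whose norm is the graph norm.\<close>

lemma Xm1_representation:
  assumes f: "f \<in> Xm1 D A"
  obtains g where "g \<in> graph_As" "f = J g" "norm g \<le> Xm1_norm D A f"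
proof -
  have "\<exists>g\<in>graph_As. \<forall>p\<in>graph_As. f (fst p) = cinner g p"
  proof (rule riesz_on_csubspace[OF csubspace_graph_As closed_graph_As])
    show "f (fst (p + q)) = f (fst p) + f (fst q)" if "p \<in> graph_As" "q \<in> graph_As" for p q
      using that Xm1D(1)[OF f] by auto
    show "f (fst (c *\<^sub>C p)) = cnj c * f (fst p)" if "p \<in> graph_As" for p c
      using that Xm1D(2)[OF f] by auto
    show "cmod (f (fst p)) \<le> Xm1_norm D A f * norm p" if "p \<in> graph_As" for p
      using that Xm1_norm_bound[OF f] by (auto simp: graph_norm_eq)
  qed
  then obtain g where g: "g \<in> graph_As" "\<And>p. p \<in> graph_As \<Longrightarrow> f (fst p) = cinner g p" by blast
  have "f = J g"
  proof
    fix \<psi> show "f \<psi> = J g \<psi>"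
      using g(2)[of "(\<psi>, As \<psi>)"] Xm1D(4)[OF f, of \<psi>] by (cases "\<psi> \<in> Ds") (auto simp: J_def)
  qed
  moreover have "norm g \<le> Xm1_norm D A f"
  proof (cases "g = 0")
    case True
    have "0 \<le> cmod (f 0)" by simp
    have "bdd_above ((\<lambda>\<psi>. cmod (f \<psi>)) ` {\<psi> \<in> Ds. graph_norm As \<psi> \<le> 1})"
      using \<open>f = J g\<close> True by (intro bdd_aboveI2[where M = 0]) (auto simp: J_def)
    then have "cmod (f 0) \<le> Xm1_norm D A f" unfolding Xm1_norm_def
      using zero_in_Ds As_zero by (intro cSUP_upper) (auto simp: graph_norm_def)
    then show ?thesis using True \<open>0 \<le> cmod (f 0)\<close> by (metis norm_zero order_trans)
  next
    case False
    obtain \<psi> where \<psi>: "\<psi> \<in> Ds" "g = (\<psi>, As \<psi>)" using g(1) by auto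
    have "(norm g)\<^sup>2 = cmod (f \<psi>)" using g(2)[OF g(1)] \<psi>(2) cinner_self[of g] by (simp add: norm_power)
    also have "\<dots> \<le> Xm1_norm D A f * norm g"
      using Xm1_norm_bound[OF f \<psi>(1)] \<psi>(2) by (simp add: graph_norm_eq)
    finally show ?thesis using False by (simp add: power2_eq_square)
  qed
  ultimately show thesis using that g(1) by blast
qed

lemma Xm1_norm_nonneg:
  assumes "f \<in> Xm1 D A"
  shows "0 \<le> Xm1_norm D A f"
  using Xm1_representation[OF assms] norm_ge_zero order_trans by metis

text \<open>Coordinates are unique within the graph of \<open>A\<^sup>*\<close>; this is what makes their choice linear.\<close>

lemma J_inj:
  assumes "g \<in> graph_As" "h \<in> graph_As" "J g = J h"
  shows "g = h"
proof -
  have "g - h \<in> graph_As" using csubspace_diff[OF csubspace_graph_As assms(1,2)] .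
  then obtain \<psi> where \<psi>: "\<psi> \<in> Ds" "g - h = (\<psi>, As \<psi>)" by auto
  have "cinner (g - h) (g - h) = cinner (g - h) (\<psi>, As \<psi>)" using \<psi>(2) by (rule arg_cong)
  then have "cinner (g - h) (g - h) = J g \<psi> - J h \<psi>"
    using \<psi>(1) by (simp only: J_apply cinner_diff_left)
  then show ?thesis using assms(3) by (simp add: cinner_self)
qed

theorem control_operator_coordinates:
  assumes B: "bounded_into_Xm1 D A B"
  obtains b where "bounded_clinear b" "\<And>u. B u = J (b u)"
proof -
  have BX: "B u \<in> Xm1 D A" and Badd: "B (u + v) = (\<lambda>\<psi>. B u \<psi> + B v \<psi>)"
    and Bsc: "B (c *\<^sub>C u) = (\<lambda>\<psi>. c * B u \<psi>)" for u v c
    using B unfolding bounded_into_Xm1_def by blast+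
  obtain C where C: "\<And>u. Xm1_norm D A (B u) \<le> C * norm u" using B unfolding bounded_into_Xm1_def by blast
  have "\<exists>g. g \<in> graph_As \<and> B u = J g \<and> norm g \<le> Xm1_norm D A (B u)" for u
    using Xm1_representation[OF BX[of u]] by metis
  then obtain b where b: "\<And>u. b u \<in> graph_As" "\<And>u. B u = J (b u)"
    "\<And>u. norm (b u) \<le> Xm1_norm D A (B u)" by metis
  have "bounded_clinear b"
  proof (rule bounded_clinear_intro)
    show "b (u + v) = b u + b v" for u v
      using Badd[of u v] by (intro J_inj csubspace_add[OF csubspace_graph_As] b) (simp add: b(2) J_add)
    show "b (c *\<^sub>C u) = c *\<^sub>C b u" for c u
      using Bsc[of c u] by (intro J_inj csubspace_scaleC[OF csubspace_graph_As] b) (simp add: b(2) J_scaleC)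
    show "norm (b u) \<le> C * norm u" for u using b(3)[of u] C[of u] by linarith
  qed
  then show thesis using that b(2) by blast
qed

text \<open>The extended semigroup commutes with \<open>A : X \<rightarrow> X\<^sub>-\<^sub>1\<close>, so it acts on both coordinates separately.\<close>

definition S2 :: "real \<Rightarrow> 'x \<times> 'x \<Rightarrow> 'x \<times> 'x" where
  "S2 t p = (S t (fst p), S t (snd p))"

lemma J_A: "b \<in> D \<Longrightarrow> J (0, b) = J (A b, 0)"
  by (auto simp: J_def adj_cinner)

lemma J_S2:
  assumes "0 \<le> t" "\<psi> \<in> Ds"
  shows "J (S2 t p) \<psi> = J p (hadj (S t) \<psi>)"
  using assms by (cases p) (simp add: J_apply S2_def adj_S hadj[OF S_clinear])

text \<open>On \<open>X\<close> the extension is prescribed, and \<open>A b\<close> is in \<open>X\<close> for \<open>b\<close> in \<open>D(A)\<close>.  The general case follows because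
  \<open>D(A)\<close> is dense in \<open>X\<close> and \<open>b \<mapsto> A b\<close> is continuous from \<open>X\<close> to \<open>X\<^sub>-\<^sub>1\<close>.\<close>

lemma extension_unique:
  assumes ext: "extends_to_Xm1 D A (S t) S'" and t: "0 \<le> t"
  shows "S' (J p) = J (S2 t p)"
proof -
  obtain a b where p: "p = (a, b)" by (cases p)
  have add: "S' (\<lambda>\<psi>. f \<psi> + g \<psi>) = (\<lambda>\<psi>. S' f \<psi> + S' g \<psi>)" if "f \<in> Xm1 D A" "g \<in> Xm1 D A" for f g
    using ext that unfolding extends_to_Xm1_def by blast
  have mem: "S' f \<in> Xm1 D A" if "f \<in> Xm1 D A" for f using ext that unfolding extends_to_Xm1_def by blast
  have embed: "S' (J (x, 0)) = J (S t x, 0)" for x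
    using ext unfolding extends_to_Xm1_def embed_eq_J by blast
  obtain C0 where C0: "\<And>f. f \<in> Xm1 D A \<Longrightarrow> Xm1_norm D A (S' f) \<le> C0 * Xm1_norm D A f"
    using ext unfolding extends_to_Xm1_def by blast
  define C where "C = \<bar>C0\<bar>"
  have C: "Xm1_norm D A (S' (J q)) \<le> C * norm q" for q
  proof -
    have "C0 * Xm1_norm D A (J q) \<le> C * norm q"
      unfolding C_def using J_norm[of q] Xm1_norm_nonneg[OF J_in_Xm1, of q] by (intro mult_mono) auto
    then show ?thesis using C0[OF J_in_Xm1[of q]] by linarith
  qed
  have onD: "S' (J (0, d)) = J (0, S t d)" if "d \<in> D" for d
    using that t by (simp add: J_A embed A_S_commute)
  have second: "S' (J (0, b)) = J (0, S t b)"
  proof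
    fix \<psi> show "S' (J (0, b)) \<psi> = J (0, S t b) \<psi>"
    proof (cases "\<psi> \<in> Ds")
      case True
      obtain f where f: "\<forall>n. f n \<in> D" "f \<longlonglongrightarrow> b" using dense_D closure_sequential[of b D] by blast
      have "cmod (S' (J (0, b)) \<psi> - J (0, S t (f n)) \<psi>) \<le> C * norm (b - f n) * graph_norm As \<psi>" for n
      proof -
        have "J (0, b) = (\<lambda>\<psi>. J (0, f n) \<psi> + J (0, b - f n) \<psi>)" using J_add[of "(0, f n)" "(0, b - f n)"] by simp
        then have "S' (J (0, b)) = (\<lambda>\<psi>. J (0, S t (f n)) \<psi> + S' (J (0, b - f n)) \<psi>)"
          using add[OF J_in_Xm1 J_in_Xm1, of "(0, f n)" "(0, b - f n)"] onD f(1) by simp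
        then have "cmod (S' (J (0, b)) \<psi> - J (0, S t (f n)) \<psi>) = cmod (S' (J (0, b - f n)) \<psi>)" by simp
        also have "\<dots> \<le> Xm1_norm D A (S' (J (0, b - f n))) * graph_norm As \<psi>"
          by (rule Xm1_norm_bound[OF mem[OF J_in_Xm1] True])
        also have "\<dots> \<le> (C * norm (0::'x, b - f n)) * graph_norm As \<psi>"
          by (intro mult_right_mono C graph_norm_nonneg)
        finally show ?thesis by (simp add: norm_Pair)
      qed
      moreover have "(\<lambda>n. C * norm (b - f n) * graph_norm As \<psi>) \<longlonglongrightarrow> C * norm (b - b) * graph_norm As \<psi>"
        by (intro tendsto_intros f)
      moreover have "(\<lambda>n. cmod (S' (J (0, b)) \<psi> - J (0, S t (f n)) \<psi>)) \<longlonglongrightarrow> cmod (S' (J (0, b)) \<psi> - J (0, S t b) \<psi>)"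
        unfolding J_apply[OF True] using t
        by (intro tendsto_norm tendsto_diff tendsto_const tendsto_cinner tendsto_Pair S_apply_tendsto f) auto
      ultimately have "cmod (S' (J (0, b)) \<psi> - J (0, S t b) \<psi>) \<le> C * norm (b - b) * graph_norm As \<psi>"
        by (meson LIMSEQ_le)
      then show ?thesis by simp
    next
      case False
      then show ?thesis using Xm1D(4)[OF mem[OF J_in_Xm1]] by (simp add: J_def)
    qed
  qed
  have "J p = (\<lambda>\<psi>. J (a, 0) \<psi> + J (0, b) \<psi>)" using J_add[of "(a, 0)" "(0, b)"] p by simp
  then have "S' (J p) = (\<lambda>\<psi>. S' (J (a, 0)) \<psi> + S' (J (0, b)) \<psi>)"
    using add[OF J_in_Xm1 J_in_Xm1, of "(a, 0)" "(0, b)"] by simp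
  also have "\<dots> = J (S t a, S t b)" unfolding embed second using J_add[of "(S t a, 0)" "(0, S t b)"] by simp
  finally show ?thesis by (simp add: p S2_def)
qed

text \<open>The dual of the restriction of \<open>S\<^sup>*(t)\<close> to \<open>D(A\<^sup>*)\<close>.\<close>

definition S_ext :: "real \<Rightarrow> ('x \<Rightarrow> complex) \<Rightarrow> 'x \<Rightarrow> complex" where
  "S_ext t f = (\<lambda>\<psi>. if \<psi> \<in> Ds then f (hadj (S t) \<psi>) else 0)"

lemma S_ext_J: "0 \<le> t \<Longrightarrow> S_ext t (J p) = J (S2 t p)"
  unfolding S_ext_def using J_S2[of t _ p] by (auto simp: J_def)

lemma S_ext_extends:
  assumes t: "0 \<le> t"
  shows "extends_to_Xm1 D A (S t) (S_ext t)"
proof -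
  obtain M where M: "M \<ge> 1" "\<And>x. norm (S t x) \<le> M * norm x" using S_bound[of t] t by auto
  have hb: "norm (hadj (S t) x) \<le> M * norm x" for x
    by (rule hadj_bound[OF S_clinear[OF t] M(2)]) (use M in simp)
  have gb: "graph_norm As (hadj (S t) \<psi>) \<le> M * graph_norm As \<psi>" if "\<psi> \<in> Ds" for \<psi>
  proof -
    have "(norm (hadj (S t) \<psi>))\<^sup>2 + (norm (hadj (S t) (As \<psi>)))\<^sup>2 \<le> (M * norm \<psi>)\<^sup>2 + (M * norm (As \<psi>))\<^sup>2"
      by (intro add_mono power_mono hb) auto
    also have "\<dots> = M\<^sup>2 * ((norm \<psi>)\<^sup>2 + (norm (As \<psi>))\<^sup>2)" by (simp add: power_mult_distrib distrib_left)
    finally have "graph_norm As (hadj (S t) \<psi>) \<le> sqrt (M\<^sup>2 * ((norm \<psi>)\<^sup>2 + (norm (As \<psi>))\<^sup>2))"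
      unfolding graph_norm_def adj_S(2)[OF that t] by simp
    then show ?thesis using M by (simp add: graph_norm_def real_sqrt_mult)
  qed
  have bound: "cmod (S_ext t f \<psi>) \<le> M * Xm1_norm D A f * graph_norm As \<psi>" if f: "f \<in> Xm1 D A" and \<psi>: "\<psi> \<in> Ds" for f \<psi>
  proof -
    note n = Xm1_norm_nonneg[OF f]
    have "cmod (S_ext t f \<psi>) \<le> Xm1_norm D A f * graph_norm As (hadj (S t) \<psi>)"
      using Xm1_norm_bound[OF f adj_S(1)[OF \<psi> t]] \<psi> by (simp add: S_ext_def)
    also have "\<dots> \<le> Xm1_norm D A f * (M * graph_norm As \<psi>)" by (intro mult_left_mono gb \<psi> n)
    finally show ?thesis by (simp add: mult_ac)
  qed
  note hadj_simps = bounded_clinear_simps[OF bounded_clinear_hadj[OF S_clinear[OF t]]]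
  have mem: "S_ext t f \<in> Xm1 D A" if f: "f \<in> Xm1 D A" for f
  proof (rule Xm1I)
    show "cmod (S_ext t f \<psi>) \<le> (M * Xm1_norm D A f) * graph_norm As \<psi>" if "\<psi> \<in> Ds" for \<psi>
      by (rule bound[OF f that])
    show "S_ext t f \<psi> = 0" if "\<psi> \<notin> Ds" for \<psi> using that by (simp add: S_ext_def)
  qed (auto simp: S_ext_def adj_add adj_scaleC hadj_simps Xm1D[OF f] adj_S t)
  show ?thesis unfolding extends_to_Xm1_def
  proof (intro conjI ballI allI mem)
    show "\<exists>C. \<forall>f\<in>Xm1 D A. Xm1_norm D A (S_ext t f) \<le> C * Xm1_norm D A f"
    proof (intro exI ballI Xm1_norm_le)
      fix f assume f: "f \<in> Xm1 D A"
      show "cmod (S_ext t f \<psi>) \<le> M * Xm1_norm D A f * graph_norm As \<psi>" if "\<psi> \<in> Ds" for \<psi>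
        by (rule bound[OF f that])
      show "0 \<le> M * Xm1_norm D A f" using Xm1_norm_nonneg[OF f] M by simp
    qed
    show "S_ext t (Xm1_embed D A x) = Xm1_embed D A (S t x)" for x
      using t by (simp add: embed_eq_J S_ext_J S2_def S_simps)
  qed (auto simp: S_ext_def fun_eq_iff)
qed

lemma Xm1_scaleR_add:
  assumes "f \<in> Xm1 D A" "g \<in> Xm1 D A"
  shows "(\<lambda>\<psi>. r *\<^sub>R f \<psi> + g \<psi>) \<in> Xm1 D A"
proof -
  obtain p q where pq: "f = J p" "g = J q" using Xm1_representation assms by metis
  have "(\<lambda>\<psi>. r *\<^sub>R f \<psi> + g \<psi>) = J (complex_of_real r *\<^sub>C p + q)"
    unfolding J_add J_scaleC pq by (simp add: scaleR_conv_of_real)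
  then show ?thesis using J_in_Xm1 by simp
qed

lemma Xm1_sum:
  assumes "finite I" "\<And>i. i \<in> I \<Longrightarrow> f i \<in> Xm1 D A" "g \<in> Xm1 D A"
  shows "(\<lambda>\<psi>. (\<Sum>i\<in>I. r i *\<^sub>R f i \<psi>) - g \<psi>) \<in> Xm1 D A"
  using assms(1,2)
proof (induction I)
  case empty
  have "J 0 \<in> Xm1 D A" by (rule J_in_Xm1)
  then have "(\<lambda>\<psi>. (-1) *\<^sub>R g \<psi> + J 0 \<psi>) \<in> Xm1 D A" by (rule Xm1_scaleR_add[OF assms(3)])
  moreover have "(\<lambda>\<psi>. (-1) *\<^sub>R g \<psi> + J 0 \<psi>) = (\<lambda>\<psi>. - g \<psi>)"
    by (auto simp: J_def fun_eq_iff)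
  ultimately show ?case by simp
next
  case (insert i I)
  have "(\<lambda>\<psi>. r i *\<^sub>R f i \<psi> + ((\<Sum>i\<in>I. r i *\<^sub>R f i \<psi>) - g \<psi>)) \<in> Xm1 D A"
    by (rule Xm1_scaleR_add) (use insert in auto)
  then show ?case using insert by (simp add: add_diff_eq)
qed

lemma has_integral_Xm1_imp_weak:
  assumes int: "has_integral_Xm1 D A f a b I" and \<psi>: "\<psi> \<in> Ds"
  shows "((\<lambda>s. f s \<psi>) has_integral I \<psi>) {a..b}"
  unfolding has_integral_real
proof (intro allI impI)
  fix e :: real assume "e > 0"
  define G where "G = graph_norm As \<psi> + 1"
  have G: "G > 0" "graph_norm As \<psi> \<le> G" using graph_norm_nonneg[of \<psi>] by (auto simp: G_def)
  have IX: "I \<in> Xm1 D A" and fX: "\<And>s. s \<in> {a..b} \<Longrightarrow> f s \<in> Xm1 D A"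
    using int unfolding has_integral_Xm1_def by blast+
  have "\<exists>\<gamma>. gauge \<gamma> \<and> (\<forall>p. p tagged_division_of {a..b} \<and> \<gamma> fine p \<longrightarrow>
      Xm1_norm D A (\<lambda>\<psi>. (\<Sum>(s, k)\<in>p. measure lborel k *\<^sub>R f s \<psi>) - I \<psi>) < e / G)"
    using int divide_pos_pos[OF \<open>e > 0\<close> G(1)] unfolding has_integral_Xm1_def by (elim conjE allE impE)
  then obtain \<gamma> where \<gamma>: "gauge \<gamma>" "\<And>p. p tagged_division_of {a..b} \<Longrightarrow> \<gamma> fine p \<Longrightarrow>
      Xm1_norm D A (\<lambda>\<psi>. (\<Sum>(s, k)\<in>p. measure lborel k *\<^sub>R f s \<psi>) - I \<psi>) < e / G"
    by (elim exE conjE) auto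
  have "norm ((\<Sum>(s, k)\<in>p. measure lborel k *\<^sub>R f s \<psi>) - I \<psi>) < e"
    if p: "p tagged_division_of {a..b}" "\<gamma> fine p" for p
  proof -
    let ?h = "\<lambda>\<psi>. (\<Sum>(s, k)\<in>p. measure lborel k *\<^sub>R f s \<psi>) - I \<psi>"
    have "(\<lambda>\<psi>. (\<Sum>i\<in>p. measure lborel (snd i) *\<^sub>R f (fst i) \<psi>) - I \<psi>) \<in> Xm1 D A"
      using p(1) tag_in_interval[OF p(1)[folded box_real]] by (intro Xm1_sum IX fX) auto
    then have h: "?h \<in> Xm1 D A" by (simp add: case_prod_beta)
    have "norm (?h \<psi>) \<le> Xm1_norm D A ?h * graph_norm As \<psi>" by (rule Xm1_norm_bound[OF h \<psi>])
    moreover have "Xm1_norm D A ?h * graph_norm As \<psi> \<le> Xm1_norm D A ?h * G"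
      by (intro mult_left_mono G(2) Xm1_norm_nonneg[OF h])
    moreover have "Xm1_norm D A ?h * G < e" using \<gamma>(2)[OF p] G(1) by (simp add: pos_less_divide_eq)
    ultimately show ?thesis by linarith
  qed
  note * = this
  show "\<exists>\<gamma>. gauge \<gamma> \<and> (\<forall>\<D>. \<D> tagged_division_of {a..b} \<and> \<gamma> fine \<D> \<longrightarrow>
      norm ((\<Sum>(x, k)\<in>\<D>. measure lborel k *\<^sub>R f x \<psi>) - I \<psi>) < e)"
    by (intro exI[of _ \<gamma>] conjI \<gamma>(1) allI impI) (elim conjE, rule *)
qed

text \<open>The map \<^const>\<open>J\<close> is a linear contraction, so it carries the Riemann sums of \<open>g\<close> and their convergence
  over to \<open>X\<^sub>-\<^sub>1\<close>.\<close>

lemma has_integral_Xm1_J: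
  assumes int: "(g has_integral I) {a..b}"
  shows "has_integral_Xm1 D A (\<lambda>s. J (g s)) a b (J I)"
  unfolding has_integral_Xm1_def
proof (intro conjI ballI allI impI J_in_Xm1)
  fix e :: real assume "e > 0"
  then have "\<exists>\<gamma>. gauge \<gamma> \<and> (\<forall>p. p tagged_division_of {a..b} \<and> \<gamma> fine p \<longrightarrow>
      norm ((\<Sum>(s, k)\<in>p. measure lborel k *\<^sub>R g s) - I) < e)"
    using int unfolding has_integral_real by (elim allE impE)
  then obtain \<gamma> where \<gamma>: "gauge \<gamma>" "\<And>p. p tagged_division_of {a..b} \<Longrightarrow> \<gamma> fine p \<Longrightarrow>
      norm ((\<Sum>(s, k)\<in>p. measure lborel k *\<^sub>R g s) - I) < e"
    by (elim exE conjE) auto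
  have "Xm1_norm D A (\<lambda>\<psi>. (\<Sum>(s, k)\<in>p. measure lborel k *\<^sub>R J (g s) \<psi>) - J I \<psi>) < e"
    if p: "p tagged_division_of {a..b}" "\<gamma> fine p" for p
  proof -
    have "(\<lambda>\<psi>. (\<Sum>(s, k)\<in>p. measure lborel k *\<^sub>R J (g s) \<psi>) - J I \<psi>) = J ((\<Sum>(s, k)\<in>p. measure lborel k *\<^sub>R g s) - I)"
      by (rule ext) (simp add: J_def cinner_diff_left case_prod_beta cinner_scaleR_left
          linear_sum[OF bounded_linear.linear[OF bounded_linear_cinner_left]])
    then show ?thesis using \<gamma>(2)[OF p] J_norm by (metis order_le_less_trans)
  qed
  note * = this
  show "\<exists>\<gamma>. gauge \<gamma> \<and> (\<forall>p. p tagged_division_of {a..b} \<and> \<gamma> fine p \<longrightarrow>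
      Xm1_norm D A (\<lambda>\<psi>. (\<Sum>(s, k)\<in>p. measure lborel k *\<^sub>R J (g s) \<psi>) - J I \<psi>) < e)"
    by (intro exI[of _ \<gamma>] conjI \<gamma>(1) allI impI) (elim conjE, rule *)
qed

text \<open>The variation of constants formula for the input \<open>F(y) = B K y\<close>, given by its coordinates, tested with
  the elements of \<open>D(A\<^sup>*)\<close>.\<close>

definition weak_solution :: "('x \<Rightarrow> 'x \<times> 'x) \<Rightarrow> 'x \<Rightarrow> (real \<Rightarrow> 'x) \<Rightarrow> bool" where
  "weak_solution F y0 y \<longleftrightarrow> continuous_on {0..} y \<and> y 0 = y0 \<and>
     (\<forall>t\<ge>0. \<forall>\<psi>\<in>Ds. ((\<lambda>s. J (S2 (t - s) (F (y s))) \<psi>) has_integral cinner (y t - S t y0) \<psi>) {0..t})"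

lemma S2_continuous:
  assumes "continuous_on {0..} y" "bounded_clinear F"
  shows "continuous_on {0..t} (\<lambda>s. S2 (t - s) (F (y s)))"
proof -
  have "continuous_on {0..t} y" by (rule continuous_on_subset[OF assms(1)]) simp
  then have F: "continuous_on {0..t} (\<lambda>s. F (y s))"
    by (rule bounded_linear.continuous_on[OF bounded_clinear_bounded_linear[OF assms(2)]])
  have r: "continuous_on {0..t} (\<lambda>s. t - s)" by (intro continuous_intros)
  show ?thesis unfolding S2_def
    by (rule continuous_on_Pair[OF S_continuous[OF continuous_on_fst[OF F] r]
          S_continuous[OF continuous_on_snd[OF F] r]]) auto
qed

text \<open>An identity in \<open>X\<^sub>-\<^sub>1\<close> may be tested with each \<open>\<psi>\<close> in \<open>D(A\<^sup>*)\<close>.  Conversely, the integrand has coordinates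
  that are continuous in \<open>X \<times> X\<close>; its integral exists there, and testing shows that it has the
  prescribed value.\<close>

theorem closed_loop_solution_iff_weak:
  assumes B: "\<And>u. B u = J (b u)" and b: "bounded_clinear b" and K: "bounded_clinear K"
  shows "closed_loop_solution D A S B K y0 y \<longleftrightarrow> weak_solution (\<lambda>x. b (K x)) y0 y"
proof
  assume sol: "closed_loop_solution D A S B K y0 y"
  then obtain S' where S': "\<And>t. 0 \<le> t \<Longrightarrow> extends_to_Xm1 D A (S t) (S' t)"
    "\<And>t. 0 \<le> t \<Longrightarrow> has_integral_Xm1 D A (\<lambda>s. S' (t - s) (B (K (y s)))) 0 t (Xm1_embed D A (y t - S t y0))"
    unfolding closed_loop_solution_def by blast
  have "((\<lambda>s. J (S2 (t - s) (b (K (y s)))) \<psi>) has_integral cinner (y t - S t y0) \<psi>) {0..t}"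
    if t: "0 \<le> t" and \<psi>: "\<psi> \<in> Ds" for t \<psi>
  proof -
    have "((\<lambda>s. S' (t - s) (B (K (y s))) \<psi>) has_integral cinner (y t - S t y0) \<psi>) {0..t}"
      using has_integral_Xm1_imp_weak[OF S'(2)[OF t] \<psi>] \<psi> by (simp add: Xm1_embed_def)
    then show ?thesis
      by (rule has_integral_eq[rotated]) (simp add: B extension_unique[OF S'(1)])
  qed
  with sol show "weak_solution (\<lambda>x. b (K x)) y0 y"
    unfolding weak_solution_def closed_loop_solution_def by blast
next
  assume sol: "weak_solution (\<lambda>x. b (K x)) y0 y"
  have cont: "continuous_on {0..} y" using sol unfolding weak_solution_def by blast
  have "has_integral_Xm1 D A (\<lambda>s. S_ext (t - s) (B (K (y s)))) 0 t (Xm1_embed D A (y t - S t y0))"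
    if t: "0 \<le> t" for t
  proof -
    let ?g = "\<lambda>s. S2 (t - s) (b (K (y s)))"
    have int: "(?g has_integral integral {0..t} ?g) {0..t}"
      by (intro integrable_integral integrable_continuous_real S2_continuous[OF cont]
          bounded_clinear_compose[OF b K])
    have "J (integral {0..t} ?g) = J (y t - S t y0, 0)"
    proof
      fix \<psi> show "J (integral {0..t} ?g) \<psi> = J (y t - S t y0, 0) \<psi>"
      proof (cases "\<psi> \<in> Ds")
        case True
        have "((\<lambda>s. J (?g s) \<psi>) has_integral J (integral {0..t} ?g) \<psi>) {0..t}"
          using has_integral_linear[OF int bounded_linear_cinner_left[of "(\<psi>, As \<psi>)"]] True
          by (simp add: J_apply o_def)
        moreover have "((\<lambda>s. J (?g s) \<psi>) has_integral cinner (y t - S t y0) \<psi>) {0..t}"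
          using sol t True unfolding weak_solution_def by blast
        ultimately show ?thesis using True by (simp add: J_apply has_integral_unique)
      qed (simp add: J_def)
    qed
    moreover have "has_integral_Xm1 D A (\<lambda>s. J (?g s)) 0 t (J (integral {0..t} ?g))"
      by (rule has_integral_Xm1_J[OF int])
    moreover have "has_integral_Xm1 D A (\<lambda>s. S_ext (t - s) (B (K (y s)))) 0 t I \<longleftrightarrow>
        has_integral_Xm1 D A (\<lambda>s. J (?g s)) 0 t I" for I
    proof -
      have eq: "S_ext (t - s) (B (K (y s))) = J (?g s)" if "s \<in> {0..t}" for s
        using that by (simp add: B S_ext_J)
      have "(\<Sum>(s, k)\<in>p. measure lborel k *\<^sub>R S_ext (t - s) (B (K (y s))) \<psi>) =
          (\<Sum>(s, k)\<in>p. measure lborel k *\<^sub>R J (?g s) \<psi>)" if p: "p tagged_division_of {0..t}" for p \<psi>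
        using tag_in_interval[OF p[folded box_real]] eq by (intro sum.cong) auto
      then show ?thesis unfolding has_integral_Xm1_def using eq by (simp cong: conj_cong)
    qed
    ultimately show ?thesis by (simp add: embed_eq_J)
  qed
  moreover have "\<forall>t\<ge>0. extends_to_Xm1 D A (S t) (S_ext t)" by (simp add: S_ext_extends)
  ultimately show "closed_loop_solution D A S B K y0 y"
    using sol unfolding weak_solution_def closed_loop_solution_def by blast
qed

end

section \<open>Bounded feedback laws stabilize\<close>

lemma has_integral_remainder:
  fixes h :: "real \<Rightarrow> 'a::banach"
  assumes "(h has_integral i) {a..b}" "(h has_integral j) {a..c}" "a \<le> c" "c \<le> b"
  shows "(h has_integral (i - j)) {c..b}"
proof -
  have "h integrable_on {c..b}"
    by (rule integrable_subinterval_real[OF has_integral_integrable[OF assms(1)]]) (use assms in auto)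
  then obtain k where k: "(h has_integral k) {c..b}" by blast
  from has_integral_combine[OF assms(3,4,2) k] have "i = j + k" using assms(1) has_integral_unique by blast
  then show ?thesis using k by simp
qed

context c0_generator
begin

lemma weak_solution_continuous: "weak_solution F y0 y \<Longrightarrow> continuous_on {0..} y"
  and weak_solution_zero: "weak_solution F y0 y \<Longrightarrow> y 0 = y0"
  and weak_solution_integral: "weak_solution F y0 y \<Longrightarrow> 0 \<le> t \<Longrightarrow> \<psi> \<in> Ds \<Longrightarrow>
    ((\<lambda>s. J (S2 (t - s) (F (y s))) \<psi>) has_integral cinner (y t - S t y0) \<psi>) {0..t}"
  unfolding weak_solution_def by blast+

lemma S2_add: "0 \<le> s \<Longrightarrow> 0 \<le> t \<Longrightarrow> S2 (s + t) p = S2 s (S2 t p)"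
  by (simp add: S2_def S_add)

lemma S2_simps:
  assumes "0 \<le> t"
  shows "S2 t (p + q) = S2 t p + S2 t q" "S2 t (c *\<^sub>C p) = c *\<^sub>C S2 t p" "S2 t (p - q) = S2 t p - S2 t q"
  using assms by (cases p; cases q; simp add: S2_def S_simps)+

text \<open>The integral up to \<open>t + \<tau>\<close> splits at \<open>\<tau>\<close>; its first part is the formula at time \<open>\<tau>\<close>, tested with
  \<open>S\<^sup>*(t) \<psi>\<close>.\<close>

lemma weak_solution_shift:
  assumes sol: "weak_solution F y0 y" and \<tau>: "0 \<le> \<tau>"
  shows "weak_solution F (y \<tau>) (\<lambda>t. y (t + \<tau>))"
  unfolding weak_solution_def
proof (intro conjI allI impI ballI)
  show "continuous_on {0..} (\<lambda>t. y (t + \<tau>))"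
    by (rule continuous_on_compose2[OF weak_solution_continuous[OF sol]])
       (use \<tau> in \<open>auto intro!: continuous_intros\<close>)
next
  fix t :: real and \<psi> assume t: "0 \<le> t" and \<psi>: "\<psi> \<in> Ds"
  define h where "h r = J (S2 (t + \<tau> - r) (F (y r))) \<psi>" for r
  have 1: "(h has_integral cinner (y (t + \<tau>) - S (t + \<tau>) y0) \<psi>) {0..t+\<tau>}"
    unfolding h_def using weak_solution_integral[OF sol _ \<psi>, of "t + \<tau>"] t \<tau> by simp
  have "((\<lambda>r. J (S2 (\<tau> - r) (F (y r))) (hadj (S t) \<psi>)) has_integral
      cinner (y \<tau> - S \<tau> y0) (hadj (S t) \<psi>)) {0..\<tau>}"
    by (rule weak_solution_integral[OF sol \<tau> adj_S(1)[OF \<psi> t]])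
  moreover have "J (S2 (\<tau> - r) (F (y r))) (hadj (S t) \<psi>) = h r" if "r \<in> {0..\<tau>}" for r
    unfolding h_def using that t \<psi> S2_add[of t "\<tau> - r"] by (simp add: J_S2[symmetric] algebra_simps)
  ultimately have "(h has_integral cinner (y \<tau> - S \<tau> y0) (hadj (S t) \<psi>)) {0..\<tau>}"
    by (rule has_integral_eq[rotated]) auto
  moreover have "cinner (y \<tau> - S \<tau> y0) (hadj (S t) \<psi>) = cinner (S t (y \<tau>) - S (t + \<tau>) y0) \<psi>"
    using t \<tau> by (simp add: hadj[OF S_clinear, symmetric] S_simps S_add)
  ultimately have 2: "(h has_integral cinner (S t (y \<tau>) - S (t + \<tau>) y0) \<psi>) {0..\<tau>}" by simp
  have "(h has_integral cinner (y (t + \<tau>) - S t (y \<tau>)) \<psi>) {\<tau>..t+\<tau>}"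
    using has_integral_remainder[OF 1 2 \<tau>] t by (simp add: cinner_diff_left)
  from has_integral_shift_real_ivl[OF this, of \<tau>]
  show "((\<lambda>s. J (S2 (t - s) (F (y (s + \<tau>)))) \<psi>) has_integral cinner (y (t + \<tau>) - S t (y \<tau>)) \<psi>) {0..t}"
    unfolding h_def by simp
qed simp

lemma weak_solution_add:
  assumes F: "bounded_clinear F" and "weak_solution F x y" "weak_solution F x' y'"
  shows "weak_solution F (x + x') (\<lambda>t. y t + y' t)"
  unfolding weak_solution_def
proof (intro conjI allI impI ballI)
  show "continuous_on {0..} (\<lambda>t. y t + y' t)"
    by (intro continuous_on_add weak_solution_continuous[OF assms(2)] weak_solution_continuous[OF assms(3)])
next
  fix t :: real and \<psi> assume t: "0 \<le> t" and \<psi>: "\<psi> \<in> Ds"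
  have "((\<lambda>s. J (S2 (t - s) (F (y s))) \<psi> + J (S2 (t - s) (F (y' s))) \<psi>) has_integral
      cinner (y t - S t x) \<psi> + cinner (y' t - S t x') \<psi>) {0..t}"
    by (intro has_integral_add weak_solution_integral[OF assms(2) t \<psi>] weak_solution_integral[OF assms(3) t \<psi>])
  moreover have "cinner (y t - S t x) \<psi> + cinner (y' t - S t x') \<psi> = cinner (y t + y' t - S t (x + x')) \<psi>"
    using t by (simp add: S_simps cinner_simps)
  ultimately have "((\<lambda>s. J (S2 (t - s) (F (y s))) \<psi> + J (S2 (t - s) (F (y' s))) \<psi>) has_integral
      cinner (y t + y' t - S t (x + x')) \<psi>) {0..t}" by simp
  then show "((\<lambda>s. J (S2 (t - s) (F (y s + y' s))) \<psi>) has_integral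
      cinner (y t + y' t - S t (x + x')) \<psi>) {0..t}"
    by (rule has_integral_eq[rotated]) (simp add: bounded_clinear_simps[OF F] S2_simps J_add)
qed (simp add: weak_solution_zero[OF assms(2)] weak_solution_zero[OF assms(3)])

lemma weak_solution_scaleC:
  assumes F: "bounded_clinear F" and "weak_solution F x y"
  shows "weak_solution F (c *\<^sub>C x) (\<lambda>t. c *\<^sub>C y t)"
  unfolding weak_solution_def
proof (intro conjI allI impI ballI)
  show "continuous_on {0..} (\<lambda>t. c *\<^sub>C y t)"
    by (rule bounded_linear.continuous_on[OF bounded_linear_scaleC weak_solution_continuous[OF assms(2)]])
next
  fix t :: real and \<psi> assume t: "0 \<le> t" and \<psi>: "\<psi> \<in> Ds"
  have "((\<lambda>s. c * J (S2 (t - s) (F (y s))) \<psi>) has_integral c * cinner (y t - S t x) \<psi>) {0..t}"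
    by (intro has_integral_mult_right weak_solution_integral[OF assms(2) t \<psi>])
  moreover have "c * cinner (y t - S t x) \<psi> = cinner (c *\<^sub>C y t - S t (c *\<^sub>C x)) \<psi>"
    using t by (simp add: S_simps cinner_simps right_diff_distrib)
  ultimately have "((\<lambda>s. c * J (S2 (t - s) (F (y s))) \<psi>) has_integral
      cinner (c *\<^sub>C y t - S t (c *\<^sub>C x)) \<psi>) {0..t}" by simp
  then show "((\<lambda>s. J (S2 (t - s) (F (c *\<^sub>C y s))) \<psi>) has_integral
      cinner (c *\<^sub>C y t - S t (c *\<^sub>C x)) \<psi>) {0..t}"
    by (rule has_integral_eq[rotated]) (simp add: bounded_clinear_simps[OF F] S2_simps J_scaleC)
qed (simp add: weak_solution_zero[OF assms(2)])

text \<open>The part of the state that is due to the input is an integral over \<open>[0, h]\<close> whose integrand is jointly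
  continuous in the two times \<open>h - s\<close> and \<open>s\<close>; divided by \<open>h\<close> it tends to its value at \<open>0\<close>.\<close>

lemma weak_solution_right_derivative:
  assumes F: "bounded_clinear F" and sol: "weak_solution F x y" and \<psi>: "\<psi> \<in> Ds"
  shows "((\<lambda>h. cinner ((1 / h) *\<^sub>R (y h - x)) \<psi>) \<longlongrightarrow> cinner x (As \<psi>) + J (F x) \<psi>) (at_right 0)"
proof -
  let ?I = "\<lambda>h. cinner (y h - S h x) \<psi>"
  have y0: "y 0 = x" and cont: "continuous_on {0..} y"
    using sol weak_solution_zero weak_solution_continuous by auto
  have "((\<lambda>h. (1 / h) *\<^sub>R ?I h) \<longlongrightarrow> J (F x) \<psi>) (at_right 0)"
  proof (rule tendstoI)
    fix e :: real assume e: "e > 0"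
    \<comment> \<open>pairs of nonnegative times that tend to \<open>0\<close> independently\<close>
    define P where "P = inf (nhds (0::real, 0::real)) (principal ({0..} \<times> {0..}))"
    have snd0: "(snd \<longlongrightarrow> (0::real)) P" and fst0: "(fst \<longlongrightarrow> (0::real)) P"
    proof -
      have "(snd \<longlongrightarrow> snd (0::real, 0::real)) (nhds (0::real, 0::real))" by (rule tendsto_snd[OF filterlim_ident])
      moreover have "(fst \<longlongrightarrow> fst (0::real, 0::real)) (nhds (0::real, 0::real))" by (rule tendsto_fst[OF filterlim_ident])
      ultimately show "(snd \<longlongrightarrow> (0::real)) P" "(fst \<longlongrightarrow> (0::real)) P"
        unfolding P_def by (auto intro: filterlim_mono[OF _ order_refl inf_le1])
    qed
    have pos: "\<forall>\<^sub>F p in P. 0 \<le> fst p" "\<forall>\<^sub>F p in P. 0 \<le> snd p"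
      unfolding P_def eventually_inf_principal by (rule always_eventually; auto)+
    have "((\<lambda>p. y (snd p)) \<longlongrightarrow> y 0) P"
      by (rule continuous_on_tendsto_compose[OF cont snd0]) (use pos in auto)
    then have lF: "((\<lambda>p. F (y (snd p))) \<longlongrightarrow> F x) P"
      unfolding y0 by (rule bounded_linear.tendsto[OF bounded_clinear_bounded_linear[OF F]])
    have "((\<lambda>p. S2 (fst p) (F (y (snd p)))) \<longlongrightarrow> (S 0 (fst (F x)), S 0 (snd (F x)))) P"
      unfolding S2_def using pos(1)
      by (intro tendsto_Pair S_tendsto fst0 tendsto_fst[OF lF] tendsto_snd[OF lF]) auto
    then have "((\<lambda>p. J (S2 (fst p) (F (y (snd p)))) \<psi>) \<longlongrightarrow> J (F x) \<psi>) P"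
      unfolding J_apply[OF \<psi>] S_zero by (intro tendsto_cinner tendsto_const) simp
    then have "\<forall>\<^sub>F p in P. dist (J (S2 (fst p) (F (y (snd p)))) \<psi>) (J (F x) \<psi>) < e / 2"
      using e by (intro tendstoD) auto
    then obtain d where d: "d > 0" "\<And>p. dist p (0, 0) < d \<Longrightarrow> p \<in> {0..} \<times> {0..} \<Longrightarrow>
        dist (J (S2 (fst p) (F (y (snd p)))) \<psi>) (J (F x) \<psi>) < e / 2"
      unfolding P_def eventually_inf_principal eventually_nhds_metric by blast
    have "dist ((1 / h) *\<^sub>R ?I h) (J (F x) \<psi>) < e" if h: "0 < h" "h < d" for h
    proof -
      have "((\<lambda>s. J (S2 (h - s) (F (y s))) \<psi>) has_integral ?I h) {0..h}"
        using weak_solution_integral[OF sol _ \<psi>] h by simp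
      moreover have "((\<lambda>s. J (F x) \<psi>) has_integral h *\<^sub>R J (F x) \<psi>) {0..h}"
        using has_integral_const_real[of "J (F x) \<psi>" 0 h] h by simp
      ultimately have "((\<lambda>s. J (S2 (h - s) (F (y s))) \<psi> - J (F x) \<psi>) has_integral ?I h - h *\<^sub>R J (F x) \<psi>) {0..h}"
        by (rule has_integral_diff)
      then have "norm (?I h - h *\<^sub>R J (F x) \<psi>) \<le> (e / 2) * measure lborel {0..h}"
      proof (rule has_integral_bound_real[rotated 2])
        fix s assume s: "s \<in> {0..h} - {}"
        have "dist (h - s, s) (0, 0) \<le> norm (h - s) + norm s"
          unfolding dist_norm using norm_Pair_le[of "h - s" s] by simp
        then have "dist (h - s, s) (0, 0) < d" using s h by simp
        from d(2)[OF this] s show "norm (J (S2 (h - s) (F (y s))) \<psi> - J (F x) \<psi>) \<le> e / 2"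
          by (simp add: dist_norm)
      qed (use e in auto)
      moreover have "(1 / h) *\<^sub>R ?I h - J (F x) \<psi> = (1 / h) *\<^sub>R (?I h - h *\<^sub>R J (F x) \<psi>)"
        using h by (simp only: scaleR_diff_right scaleR_scaleR) simp
      then have "norm ((1 / h) *\<^sub>R ?I h - J (F x) \<psi>) = norm (?I h - h *\<^sub>R J (F x) \<psi>) / h"
        using h by (simp only: norm_scaleR) simp
      ultimately have "norm ((1 / h) *\<^sub>R ?I h - J (F x) \<psi>) \<le> e / 2"
        using h by (simp add: pos_divide_le_eq)
      then show ?thesis using e by (simp add: dist_norm)
    qed
    then show "\<forall>\<^sub>F h in at_right 0. dist ((1 / h) *\<^sub>R ?I h) (J (F x) \<psi>) < e"
      using d(1) unfolding eventually_at_right_field by (intro exI[of _ d]) auto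
  qed
  moreover have "((\<lambda>h. (1 / h) *\<^sub>R (cinner (S h x) \<psi> - cinner x \<psi>)) \<longlongrightarrow> cinner x (As \<psi>)) (at_right 0)"
    using weak_orbit_derivative[OF \<psi>, of 0 1 x]
    by (simp add: has_vector_derivative_iff_quotient at_within_Icc_at_right S_zero)
  ultimately have "((\<lambda>h. (1 / h) *\<^sub>R (cinner (S h x) \<psi> - cinner x \<psi>) + (1 / h) *\<^sub>R ?I h)
      \<longlongrightarrow> cinner x (As \<psi>) + J (F x) \<psi>) (at_right 0)"
    by (intro tendsto_add)
  moreover have "(1 / h) *\<^sub>R (cinner (S h x) \<psi> - cinner x \<psi>) + (1 / h) *\<^sub>R ?I h = cinner ((1 / h) *\<^sub>R (y h - x)) \<psi>" for h
    unfolding scaleR_add_right[symmetric] cinner_scaleR_left cinner_diff_left by simp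
  ultimately show ?thesis by simp
qed

end

lemma square_integrable_exp_decay:
  fixes f :: "real \<Rightarrow> 'a::real_normed_vector"
  assumes "\<And>t. 0 < t \<Longrightarrow> norm (f t) \<le> c * exp (- \<alpha> * t)" "0 < \<alpha>" "0 \<le> c"
  shows "(\<integral>\<^sup>+ t\<in>{0<..}. ennreal ((norm (f t))\<^sup>2) \<partial>lborel) \<le> ennreal (c\<^sup>2 / (2 * \<alpha>))"
proof -
  have "(\<integral>\<^sup>+ t\<in>{0<..}. ennreal ((norm (f t))\<^sup>2) \<partial>lborel)
      \<le> (\<integral>\<^sup>+ t. ennreal (c\<^sup>2 * exp (- (2 * \<alpha>) * t)) * indicator {0..} t \<partial>lborel)"
  proof (rule nn_integral_mono)
    fix t :: real
    have "(norm (f t))\<^sup>2 \<le> c\<^sup>2 * exp (- (2 * \<alpha>) * t)" if "0 < t"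
    proof -
      have "(norm (f t))\<^sup>2 \<le> (c * exp (- \<alpha> * t))\<^sup>2" using assms(1)[OF that] by (intro power_mono) auto
      also have "\<dots> = c\<^sup>2 * exp (- (2 * \<alpha>) * t)"
        by (simp add: power_mult_distrib power2_eq_square flip: exp_add)
      finally show ?thesis .
    qed
    then show "ennreal ((norm (f t))\<^sup>2) * indicator {0<..} t \<le> ennreal (c\<^sup>2 * exp (- (2 * \<alpha>) * t)) * indicator {0..} t"
      by (auto simp: indicator_def intro!: ennreal_leI)
  qed
  also have "\<dots> = ennreal (0 - (- c\<^sup>2 / (2 * \<alpha>) * exp (- (2 * \<alpha>) * 0)))"
  proof (rule nn_integral_FTC_atLeast[where F = "\<lambda>t. - c\<^sup>2 / (2 * \<alpha>) * exp (- (2 * \<alpha>) * t)"])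
    show "((\<lambda>t. - c\<^sup>2 / (2 * \<alpha>) * exp (- (2 * \<alpha>) * t)) has_real_derivative c\<^sup>2 * exp (- (2 * \<alpha>) * t)) (at t)" for t
      using assms(2) by (auto intro!: derivative_eq_intros)
    have "filterlim (\<lambda>t. - (2 * \<alpha>) * t) at_bot at_top"
      using assms(2) by (intro filterlim_tendsto_neg_mult_at_bot[OF tendsto_const _ filterlim_ident]) auto
    from filterlim_compose[OF exp_at_bot this]
    have "((\<lambda>t. - c\<^sup>2 / (2 * \<alpha>) * exp (- (2 * \<alpha>) * t)) \<longlongrightarrow> - c\<^sup>2 / (2 * \<alpha>) * 0) at_top"
      by (intro tendsto_mult tendsto_const)
    then show "((\<lambda>t. - c\<^sup>2 / (2 * \<alpha>) * exp (- (2 * \<alpha>) * t)) \<longlongrightarrow> 0) at_top" by simp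
  qed auto
  finally show ?thesis by simp
qed

context c0_generator
begin

text \<open>Uniqueness of the closed loop solution yields linearity in the initial state and the semigroup law, hence a
  semigroup \<open>T\<close>.  Its generator \<open>M\<close> is defined on the largest possible domain by the limit of the
  difference quotients, and the right derivative of the weak formula shows \<open>M = A + B K\<close>.\<close>

theorem stabilizable_if_bounded_feedback:
  fixes B :: "'u::complex_hilbert_space \<Rightarrow> 'x \<Rightarrow> complex"
  assumes B: "bounded_into_Xm1 D A B" and stab: "stabilizable_bounded_feedback D A S B"
  shows "stabilizable D A B"
proof -
  obtain b where b: "bounded_clinear b" "\<And>u. B u = J (b u)"
    using control_operator_coordinates[OF B] by blast
  obtain \<alpha> C and K :: "'x \<Rightarrow> 'u" where \<alpha>: "\<alpha> > 0" and C: "C > 0" and K: "bounded_clinear K"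
    and ex: "\<And>y0. \<exists>y. closed_loop_solution D A S B K y0 y \<and>
           (\<forall>z. closed_loop_solution D A S B K y0 z \<longrightarrow> (\<forall>t\<ge>0. z t = y t)) \<and>
           (\<forall>t>0. norm (y t) \<le> C * exp (- \<alpha> * t) * norm y0)"
    using stab unfolding stabilizable_bounded_feedback_def by blast
  define F where "F x = b (K x)" for x
  have F: "bounded_clinear F" unfolding F_def by (rule bounded_clinear_compose[OF b(1) K])
  have "\<exists>y. weak_solution F y0 y \<and> (\<forall>z. weak_solution F y0 z \<longrightarrow> (\<forall>t\<ge>0. z t = y t)) \<and>
      (\<forall>t>0. norm (y t) \<le> C * exp (- \<alpha> * t) * norm y0)" for y0
    using ex[of y0] unfolding closed_loop_solution_iff_weak[OF b(2,1) K] F_def .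
  then obtain Y where Y: "\<And>x. weak_solution F x (Y x)"
    "\<And>x z t. weak_solution F x z \<Longrightarrow> 0 \<le> t \<Longrightarrow> z t = Y x t"
    "\<And>x t. 0 < t \<Longrightarrow> norm (Y x t) \<le> C * exp (- \<alpha> * t) * norm x" by metis
  define T where "T t x = Y x t" for t x
  define C1 where "C1 = max C 1"
  have C1: "1 \<le> C1" by (simp add: C1_def)
  have T0: "T 0 x = x" for x using weak_solution_zero[OF Y(1)] by (simp add: T_def)
  have Tbound: "norm (T t x) \<le> C1 * exp (- \<alpha> * t) * norm x" if "0 \<le> t" for t x
  proof (cases "t = 0")
    case True
    then show ?thesis using mult_right_mono[OF C1, of "norm x"] by (simp add: T0)
  next
    case False
    then have "norm (T t x) \<le> C * exp (- \<alpha> * t) * norm x" using that Y(3) by (simp add: T_def)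
    also have "\<dots> \<le> C1 * exp (- \<alpha> * t) * norm x" by (intro mult_right_mono) (auto simp: C1_def)
    finally show ?thesis .
  qed
  have "C0_semigroup T" unfolding C0_semigroup_def
  proof (intro conjI allI impI T0)
    show "bounded_clinear (T t)" if t: "0 \<le> t" for t
    proof (rule bounded_clinear_intro[where C = "C1 * exp (- \<alpha> * t)"])
      show "T t (x + y) = T t x + T t y" for x y
        using Y(2)[OF weak_solution_add[OF F Y(1)[of x] Y(1)[of y]] t] by (simp add: T_def)
      show "T t (c *\<^sub>C x) = c *\<^sub>C T t x" for c x
        using Y(2)[OF weak_solution_scaleC[OF F Y(1)[of x]] t, of c] by (simp add: T_def)
    qed (rule Tbound[OF t])
    show "T (s + t) x = T s (T t x)" if "0 \<le> s" "0 \<le> t" for s t x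
      using Y(2)[OF weak_solution_shift[OF Y(1)[of x] that(2)] that(1)] by (simp add: T_def)
    show "((\<lambda>t. T t x) \<longlongrightarrow> x) (at_right 0)" for x
    proof -
      have "(Y x \<longlongrightarrow> Y x 0) (at 0 within {0..})"
        using weak_solution_continuous[OF Y(1)[of x]] by (auto simp: continuous_on_def)
      then have "(Y x \<longlongrightarrow> Y x 0) (at_right 0)" by (rule tendsto_within_subset) auto
      then show ?thesis using T0[of x] by (simp add: T_def)
    qed
  qed
  define DM where "DM = {x. \<exists>l. ((\<lambda>h. (1 / h) *\<^sub>R (T h x - x)) \<longlongrightarrow> l) (at_right 0)}"
  define M where "M x = Lim (at_right 0) (\<lambda>h. (1 / h) *\<^sub>R (T h x - x))" for x
  have Mlim: "((\<lambda>h. (1 / h) *\<^sub>R (T h x - x)) \<longlongrightarrow> M x) (at_right 0)" if "x \<in> DM" for x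
    using that unfolding DM_def M_def by (auto simp: tendsto_Lim[OF trivial_limit_at_right_real])
  have gen: "generates DM M T" unfolding generates_def
  proof (intro conjI allI \<open>C0_semigroup T\<close>)
    show "(x \<in> DM \<and> M x = y) \<longleftrightarrow> ((\<lambda>h. (1 / h) *\<^sub>R (T h x - x)) \<longlongrightarrow> y) (at_right 0)" for x y
    proof
      assume "((\<lambda>h. (1 / h) *\<^sub>R (T h x - x)) \<longlongrightarrow> y) (at_right 0)"
      then show "x \<in> DM \<and> M x = y"
        unfolding DM_def M_def by (auto simp: tendsto_Lim[OF trivial_limit_at_right_real])
    qed (use Mlim in auto)
  qed
  obtain k where k: "k > 0" "\<And>x. norm (K x) \<le> k * norm x" using bounded_clinear_bound[OF K] by blast
  have "alpha_stabilizable D A B \<alpha>" unfolding alpha_stabilizable_def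
  proof (rule exI[of _ T], rule exI[of _ DM], rule exI[of _ M], rule exI[of _ K], intro conjI gen ballI)
    show "clinear_on DM K" using K by (simp add: bounded_clinear_def clinear_on_def)
    show "\<exists>C. \<forall>x\<in>DM. norm (K x) \<le> C * graph_norm M x"
    proof (intro exI ballI)
      fix x
      have "norm x \<le> graph_norm M x" unfolding graph_norm_def by (rule real_le_rsqrt) simp
      then show "norm (K x) \<le> k * graph_norm M x"
        using k(2)[of x] mult_left_mono[of "norm x" "graph_norm M x" k] k(1) by linarith
    qed
    show "\<exists>C1\<ge>1. \<forall>t>0. onorm (T t) \<le> C1 * exp (- \<alpha> * t)"
    proof (intro exI[of _ C1] conjI C1 allI impI)
      fix t :: real assume "0 < t"
      then show "onorm (T t) \<le> C1 * exp (- \<alpha> * t)" using C1 by (intro onorm_bound Tbound) auto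
    qed
    show "Xm1_embed D A (M x) = (\<lambda>\<psi>. A_ext D A x \<psi> + B (K x) \<psi>)" if x: "x \<in> DM" for x
    proof
      fix \<psi>
      show "Xm1_embed D A (M x) \<psi> = A_ext D A x \<psi> + B (K x) \<psi>"
      proof (cases "\<psi> \<in> Ds")
        case True
        have "((\<lambda>h. cinner ((1 / h) *\<^sub>R (T h x - x)) \<psi>) \<longlongrightarrow> cinner (M x) \<psi>) (at_right 0)"
          by (intro tendsto_cinner Mlim x tendsto_const)
        moreover have "((\<lambda>h. cinner ((1 / h) *\<^sub>R (T h x - x)) \<psi>) \<longlongrightarrow> cinner x (As \<psi>) + J (F x) \<psi>) (at_right 0)"
          unfolding T_def by (rule weak_solution_right_derivative[OF F Y(1) True])
        ultimately have "cinner (M x) \<psi> = cinner x (As \<psi>) + J (F x) \<psi>"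
          using tendsto_unique[OF trivial_limit_at_right_real] by blast
        then show ?thesis using True by (simp add: Xm1_embed_def A_ext_def b F_def)
      qed (simp add: Xm1_embed_def A_ext_def b J_def)
    qed
    define C2 where "C2 = sqrt ((k * C1)\<^sup>2 / (2 * \<alpha>))"
    show "\<exists>C2\<ge>0. \<forall>x\<in>DM. (\<integral>\<^sup>+ t\<in>{0<..}. ennreal ((norm (K (T t x)))\<^sup>2) \<partial>lborel) \<le> ennreal ((C2 * norm x)\<^sup>2)"
    proof (intro exI[of _ C2] conjI ballI)
      show "0 \<le> C2" using \<alpha> by (simp add: C2_def)
      fix x
      have "norm (K (T t x)) \<le> (k * C1 * norm x) * exp (- \<alpha> * t)" if "0 < t" for t
      proof -
        have "norm (K (T t x)) \<le> k * norm (T t x)" by (rule k)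
        also have "\<dots> \<le> k * (C1 * exp (- \<alpha> * t) * norm x)" using that k by (intro mult_left_mono Tbound) auto
        finally show ?thesis by (simp add: mult_ac)
      qed
      then have "(\<integral>\<^sup>+ t\<in>{0<..}. ennreal ((norm (K (T t x)))\<^sup>2) \<partial>lborel)
          \<le> ennreal ((k * C1 * norm x)\<^sup>2 / (2 * \<alpha>))"
        using \<alpha> k C1 by (intro square_integrable_exp_decay) auto
      also have "(k * C1 * norm x)\<^sup>2 / (2 * \<alpha>) = (C2 * norm x)\<^sup>2"
        using \<alpha> by (simp add: C2_def power_mult_distrib)
      finally show "(\<integral>\<^sup>+ t\<in>{0<..}. ennreal ((norm (K (T t x)))\<^sup>2) \<partial>lborel) \<le> ennreal ((C2 * norm x)\<^sup>2)" .
    qed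
  qed
  then show ?thesis using \<alpha> unfolding stabilizable_def by blast
qed

end

section \<open>Powers of a bounded operator\<close>

lemma funpow_bound:
  fixes N :: "'x::complex_hilbert_space \<Rightarrow> 'x"
  assumes "\<And>x. norm (N x) \<le> k * norm x" "0 \<le> k"
  shows "norm ((N ^^ n) x) \<le> k ^ n * norm x"
proof (induction n)
  case (Suc n)
  have "norm (N ((N ^^ n) x)) \<le> k * (k ^ n * norm x)"
    using assms(1)[of "(N ^^ n) x"] mult_left_mono[OF Suc assms(2)] by linarith
  then show ?case by (simp add: mult.assoc)
qed simp

lemma bounded_inverse_scaleC:
  assumes "bounded_inverse T R" "c \<noteq> 0" "\<And>x. T' x = c *\<^sub>C T x" "bounded_clinear T"
  shows "bounded_inverse T' (\<lambda>x. R ((1 / c) *\<^sub>C x))"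
proof -
  have R: "bounded_clinear R" "\<And>x. R (T x) = x" "\<And>x. T (R x) = x"
    using assms(1) unfolding bounded_inverse_def by auto
  have "bounded_clinear (\<lambda>x. R ((1 / c) *\<^sub>C x))"
    by (rule bounded_clinear_compose[OF R(1) bounded_clinear_scaleC[OF bounded_clinear_id]])
  then show ?thesis unfolding bounded_inverse_def
    using assms(2) by (simp add: assms(3) scaleC_scaleC R bounded_clinear_simps[OF assms(4)])
qed

text \<open>\<open>T - E = T (1 - R E)\<close>, and \<open>1 - R E\<close> is coercive because \<open>R E\<close> is a strict contraction.\<close>

lemma bounded_inverse_perturb:
  assumes R: "bounded_inverse T R" and T: "bounded_clinear T" and E: "bounded_clinear E"
    and e: "\<And>x. norm (E x) \<le> e * norm x" and k: "\<And>x. norm (R x) \<le> k * norm x"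
    and small: "k * e < 1" and k0: "0 \<le> k"
  shows "\<exists>R'. bounded_inverse (\<lambda>x. T x - E x) R'"
proof -
  have R': "bounded_clinear R" "\<And>x. R (T x) = x" "\<And>x. T (R x) = x"
    using R unfolding bounded_inverse_def by auto
  define V where "V x = x - R (E x)" for x
  have V: "bounded_clinear V" unfolding V_def
    by (rule bounded_clinear_diff[OF bounded_clinear_id bounded_clinear_compose[OF R'(1) E]])
  have "\<exists>V'. bounded_inverse V V'"
  proof (rule coercive_bounded_inverse[OF V, of "1 - k * e"])
    show "0 < 1 - k * e" using small by simp
    show "(1 - k * e) * (norm x)\<^sup>2 \<le> Re (cinner (V x) x)" for x
    proof -
      have "norm (R (E x)) \<le> k * (e * norm x)" using k[of "E x"] mult_left_mono[OF e k0, of x] by linarith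
      then have "norm (R (E x)) * norm x \<le> k * (e * norm x) * norm x" by (intro mult_right_mono) auto
      then have "Re (cinner (R (E x)) x) \<le> k * e * (norm x)\<^sup>2"
        using Re_cinner_le[of "R (E x)" x] by (simp add: power2_eq_square mult_ac)
      then show ?thesis by (simp add: V_def cinner_diff_left norm_sq_cinner left_diff_distrib)
    qed
  qed
  then obtain V' where V': "bounded_clinear V'" "\<And>x. V' (V x) = x" "\<And>x. V (V' x) = x"
    unfolding bounded_inverse_def by auto
  have eq: "T x - E x = T (V x)" for x by (simp add: V_def bounded_clinear_simps[OF T] R')
  have "bounded_inverse (\<lambda>x. T x - E x) (\<lambda>x. V' (R x))"
    unfolding bounded_inverse_def eq
    using V'(2,3) R'(2,3) bounded_clinear_compose[OF V'(1) R'(1)] by simp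
  then show ?thesis by blast
qed

text \<open>The vectors \<open>C\<^sup>n x\<close> are the Taylor coefficients at \<open>0\<close> of \<open>\<zeta> \<mapsto> (1 - \<zeta> C)\<^sup>-\<^sup>1 x\<close>.  Tested with \<open>\<psi>\<close> this is a
  scalar function, holomorphic near the closed disc of radius \<open>r\<close>, so Cauchy's inequality bounds
  \<open>r\<^sup>n \<langle>C\<^sup>n x, \<psi>\<rangle>\<close> uniformly in \<open>n\<close>.  The uniform boundedness principle, applied first in \<open>\<psi>\<close> and then in
  \<open>x\<close>, removes the dependence on \<open>x\<close> and \<open>\<psi>\<close>.\<close>

theorem power_bound_of_resolvent:
  fixes C :: "'x::complex_hilbert_space \<Rightarrow> 'x"
  assumes C: "bounded_clinear C" and r: "r > 0"
    and inv: "\<And>\<zeta>. cmod \<zeta> \<le> r \<Longrightarrow> \<exists>R. bounded_inverse (\<lambda>x. x - \<zeta> *\<^sub>C C x) R"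
  shows "\<exists>M>0. \<forall>n x. r ^ n * norm ((C ^^ n) x) \<le> M * norm x"
proof -
  obtain c where c: "c > 0" "\<And>x. norm (C x) \<le> c * norm x" using bounded_clinear_bound[OF C] by blast
  define \<Omega> where "\<Omega> = {\<zeta>. \<exists>R. bounded_inverse (\<lambda>x. x - \<zeta> *\<^sub>C C x) R}"
  define R where "R \<zeta> = (SOME R. bounded_inverse (\<lambda>x. x - \<zeta> *\<^sub>C C x) R)" for \<zeta>
  have P: "bounded_clinear (\<lambda>x. x - \<zeta> *\<^sub>C C x)" for \<zeta> by (intro bounded_clinear_intros C)
  have Rinv: "bounded_inverse (\<lambda>x. x - \<zeta> *\<^sub>C C x) (R \<zeta>)" if "\<zeta> \<in> \<Omega>" for \<zeta>
    using that someI_ex[of "bounded_inverse (\<lambda>x. x - \<zeta> *\<^sub>C C x)"] by (simp add: \<Omega>_def R_def)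
  then have R: "bounded_clinear (R \<zeta>)" "R \<zeta> (x - \<zeta> *\<^sub>C C x) = x" "R \<zeta> x - \<zeta> *\<^sub>C C (R \<zeta> x) = x"
    if "\<zeta> \<in> \<Omega>" for \<zeta> x
    using that unfolding bounded_inverse_def by blast+
  have "open \<Omega>" unfolding open_dist
  proof
    fix \<zeta>0 assume z0: "\<zeta>0 \<in> \<Omega>"
    obtain k where k: "k > 0" "\<And>x. norm (R \<zeta>0 x) \<le> k * norm x" using bounded_clinear_bound[OF R(1)[OF z0]] by blast
    have "\<zeta> \<in> \<Omega>" if d: "dist \<zeta> \<zeta>0 < 1 / (k * c)" for \<zeta>
    proof -
      have "\<exists>R'. bounded_inverse (\<lambda>x. (x - \<zeta>0 *\<^sub>C C x) - (\<zeta> - \<zeta>0) *\<^sub>C C x) R'"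
      proof (rule bounded_inverse_perturb[OF Rinv[OF z0] P _ _ k(2)])
        show "bounded_clinear (\<lambda>x. (\<zeta> - \<zeta>0) *\<^sub>C C x)" by (intro bounded_clinear_intros C)
        show "norm ((\<zeta> - \<zeta>0) *\<^sub>C C x) \<le> (cmod (\<zeta> - \<zeta>0) * c) * norm x" for x
          using mult_left_mono[OF c(2)[of x], of "cmod (\<zeta> - \<zeta>0)"] by (simp add: mult.assoc)
        show "k * (cmod (\<zeta> - \<zeta>0) * c) < 1" using d k(1) c(1) by (simp add: dist_norm field_simps)
      qed (use k in simp)
      then show ?thesis unfolding \<Omega>_def by (simp add: scaleC_diff_left)
    qed
    then show "\<exists>e>0. \<forall>\<zeta>. dist \<zeta> \<zeta>0 < e \<longrightarrow> \<zeta> \<in> \<Omega>" using k(1) c(1) by (intro exI[of _ "1 / (k * c)"]) auto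
  qed
  have resolvent_eq: "R \<zeta> x - R \<zeta>0 x = (\<zeta> - \<zeta>0) *\<^sub>C R \<zeta> (C (R \<zeta>0 x))" if z: "\<zeta> \<in> \<Omega>" "\<zeta>0 \<in> \<Omega>" for \<zeta> \<zeta>0 x
  proof -
    let ?v = "R \<zeta>0 x"
    have "x - (?v - \<zeta> *\<^sub>C C ?v) = (\<zeta> - \<zeta>0) *\<^sub>C C ?v"
      using R(3)[OF z(2), of x] by (simp add: scaleC_diff_left algebra_simps)
    then have "R \<zeta> x - R \<zeta> (?v - \<zeta> *\<^sub>C C ?v) = (\<zeta> - \<zeta>0) *\<^sub>C R \<zeta> (C ?v)"
      by (simp only: bounded_clinear_simps(2)[OF R(1)[OF z(1)], symmetric]
          bounded_clinear_simps(5)[OF R(1)[OF z(1)], symmetric])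
    then show ?thesis using R(2)[OF z(1)] by simp
  qed
  have R_cont: "((\<lambda>\<zeta>. R \<zeta> w) \<longlongrightarrow> R \<zeta>0 w) (at \<zeta>0)" if z0: "\<zeta>0 \<in> \<Omega>" for \<zeta>0 w
  proof -
    obtain k where k: "k > 0" "\<And>x. norm (R \<zeta>0 x) \<le> k * norm x" using bounded_clinear_bound[OF R(1)[OF z0]] by blast
    have bound: "norm (R \<zeta> w - R \<zeta>0 w) \<le> cmod (\<zeta> - \<zeta>0) * (2 * k * norm (C (R \<zeta>0 w)))"
      if z: "\<zeta> \<in> \<Omega>" and d: "cmod (\<zeta> - \<zeta>0) < 1 / (2 * k * c)" for \<zeta>
    proof -
      have "norm (R \<zeta> v) \<le> 2 * k * norm v" for v
      proof -
        let ?u = "R \<zeta> v"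
        have "?u - \<zeta>0 *\<^sub>C C ?u = v + (\<zeta> - \<zeta>0) *\<^sub>C C ?u"
          using R(3)[OF z, of v] by (simp add: scaleC_diff_left algebra_simps)
        then have "?u = R \<zeta>0 (v + (\<zeta> - \<zeta>0) *\<^sub>C C ?u)" using R(2)[OF z0, of ?u] by simp
        then have "norm ?u \<le> k * norm (v + (\<zeta> - \<zeta>0) *\<^sub>C C ?u)" using k(2) by metis
        also have "\<dots> \<le> k * (norm v + cmod (\<zeta> - \<zeta>0) * (c * norm ?u))"
        proof (rule mult_left_mono)
          have "norm ((\<zeta> - \<zeta>0) *\<^sub>C C ?u) \<le> cmod (\<zeta> - \<zeta>0) * (c * norm ?u)"
            using mult_left_mono[OF c(2)[of ?u], of "cmod (\<zeta> - \<zeta>0)"] by simp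
          then show "norm (v + (\<zeta> - \<zeta>0) *\<^sub>C C ?u) \<le> norm v + cmod (\<zeta> - \<zeta>0) * (c * norm ?u)"
            using norm_triangle_ineq[of v "(\<zeta> - \<zeta>0) *\<^sub>C C ?u"] by linarith
        qed (use k in simp)
        also have "\<dots> = k * norm v + (cmod (\<zeta> - \<zeta>0) * (k * c)) * norm ?u" by (simp add: algebra_simps)
        also have "\<dots> \<le> k * norm v + (1 / 2) * norm ?u"
        proof -
          have "cmod (\<zeta> - \<zeta>0) * (k * c) \<le> 1 / 2" using d k(1) c(1) by (simp add: field_simps)
          then show ?thesis by (intro add_left_mono mult_right_mono) auto
        qed
        finally show ?thesis by simp
      qed
      from mult_left_mono[OF this[of "C (R \<zeta>0 w)"], of "cmod (\<zeta> - \<zeta>0)"]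
      show ?thesis unfolding resolvent_eq[OF z z0] by simp
    qed
    have "\<forall>\<^sub>F \<zeta> in at \<zeta>0. \<zeta> \<in> \<Omega> \<and> cmod (\<zeta> - \<zeta>0) < 1 / (2 * k * c)"
    proof (rule eventually_conj)
      show "\<forall>\<^sub>F \<zeta> in at \<zeta>0. \<zeta> \<in> \<Omega>"
        using \<open>open \<Omega>\<close> z0 by (rule eventually_at_in_open')
      show "\<forall>\<^sub>F \<zeta> in at \<zeta>0. cmod (\<zeta> - \<zeta>0) < 1 / (2 * k * c)"
        unfolding eventually_at using k(1) c(1) by (intro exI[of _ "1 / (2 * k * c)"]) (auto simp: dist_norm)
    qed
    then have "\<forall>\<^sub>F \<zeta> in at \<zeta>0. norm (R \<zeta> w - R \<zeta>0 w) \<le> cmod (\<zeta> - \<zeta>0) * (2 * k * norm (C (R \<zeta>0 w)))"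
      by eventually_elim (use bound in blast)
    moreover have "((\<lambda>\<zeta>. cmod (\<zeta> - \<zeta>0) * (2 * k * norm (C (R \<zeta>0 w)))) \<longlongrightarrow> 0) (at \<zeta>0)"
    proof -
      have "((\<lambda>\<zeta>. cmod (\<zeta> - \<zeta>0) * (2 * k * norm (C (R \<zeta>0 w)))) \<longlongrightarrow> cmod (\<zeta>0 - \<zeta>0) * (2 * k * norm (C (R \<zeta>0 w)))) (at \<zeta>0)"
        by (intro tendsto_intros)
      then show ?thesis by simp
    qed
    ultimately have "((\<lambda>\<zeta>. R \<zeta> w - R \<zeta>0 w) \<longlongrightarrow> 0) (at \<zeta>0)" by (rule Lim_null_comparison)
    then show ?thesis by (simp add: LIM_zero_iff)
  qed
  have holo: "(\<lambda>\<zeta>. cinner (R \<zeta> x) \<psi>) holomorphic_on \<Omega>" for x \<psi>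
    unfolding holomorphic_on_open[OF \<open>open \<Omega>\<close>]
  proof
    fix \<zeta>0 assume z0: "\<zeta>0 \<in> \<Omega>"
    have "((\<lambda>\<zeta>. cinner (R \<zeta> (C (R \<zeta>0 x))) \<psi>) \<longlongrightarrow> cinner (R \<zeta>0 (C (R \<zeta>0 x))) \<psi>) (at \<zeta>0)"
      by (intro tendsto_cinner R_cont z0 tendsto_const)
    then have "((\<lambda>\<zeta>. (cinner (R \<zeta> x) \<psi> - cinner (R \<zeta>0 x) \<psi>) / (\<zeta> - \<zeta>0)) \<longlongrightarrow> cinner (R \<zeta>0 (C (R \<zeta>0 x))) \<psi>) (at \<zeta>0)"
    proof (rule Lim_transform_eventually)
      have "\<forall>\<^sub>F \<zeta> in at \<zeta>0. \<zeta> \<in> \<Omega>" "\<forall>\<^sub>F \<zeta> in at \<zeta>0. \<zeta> \<noteq> \<zeta>0"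
        using \<open>open \<Omega>\<close> z0 by (rule eventually_at_in_open') (simp add: eventually_at_filter)
      then show "\<forall>\<^sub>F \<zeta> in at \<zeta>0. cinner (R \<zeta> (C (R \<zeta>0 x))) \<psi> = (cinner (R \<zeta> x) \<psi> - cinner (R \<zeta>0 x) \<psi>) / (\<zeta> - \<zeta>0)"
      proof eventually_elim
        case (elim \<zeta>)
        have "cinner (R \<zeta> x) \<psi> - cinner (R \<zeta>0 x) \<psi> = (\<zeta> - \<zeta>0) * cinner (R \<zeta> (C (R \<zeta>0 x))) \<psi>"
          unfolding cinner_diff_left[symmetric] resolvent_eq[OF elim(1) z0] by (rule cinner_scaleC_left)
        then show ?case using elim(2) by simp
      qed
    qed
    then show "\<exists>f'. ((\<lambda>\<zeta>. cinner (R \<zeta> x) \<psi>) has_field_derivative f') (at \<zeta>0)"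
      unfolding has_field_derivative_iff by blast
  qed
  have zero: "0 \<in> \<Omega>" using inv[of 0] r by (simp add: \<Omega>_def)
  have Cn: "norm ((C ^^ n) x) \<le> c ^ n * norm x" for n x
    by (rule funpow_bound[OF c(2)]) (use c(1) in simp)
  have Cnlin: "bounded_clinear (C ^^ n)" for n by (rule bounded_clinear_funpow[OF C])
  have partial: "R \<zeta> x = (\<Sum>k<n. \<zeta> ^ k *\<^sub>C (C ^^ k) x) + \<zeta> ^ n *\<^sub>C R \<zeta> ((C ^^ n) x)" if z: "\<zeta> \<in> \<Omega>" for \<zeta> x n
  proof (induction n)
    case (Suc n)
    have step: "R \<zeta> w = w + \<zeta> *\<^sub>C R \<zeta> (C w)" for w
      using R(2)[OF z, of w] by (simp add: bounded_clinear_simps[OF R(1)[OF z]] algebra_simps)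
    have "\<zeta> ^ n *\<^sub>C R \<zeta> ((C ^^ n) x) = \<zeta> ^ n *\<^sub>C (C ^^ n) x + \<zeta> ^ Suc n *\<^sub>C R \<zeta> ((C ^^ Suc n) x)"
      by (subst step) (simp add: scaleC_add_right scaleC_scaleC mult.commute)
    then show ?case using Suc by (simp add: add.assoc)
  qed simp
  have coeff: "(deriv ^^ n) (\<lambda>\<zeta>. cinner (R \<zeta> x) \<psi>) 0 / fact n = cinner ((C ^^ n) x) \<psi>" for n x \<psi>
  proof -
    have "(\<lambda>\<zeta>. cinner (R \<zeta> x) \<psi>) has_fps_expansion Abs_fps (\<lambda>n. cinner ((C ^^ n) x) \<psi>)"
    proof (rule has_fps_expansionI)
      have "\<forall>\<^sub>F \<zeta> in nhds 0. \<zeta> \<in> \<Omega>" using \<open>open \<Omega>\<close> zero by (rule eventually_nhds_in_open)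
      moreover have "\<forall>\<^sub>F \<zeta> in nhds 0. cmod \<zeta> < 1 / c"
        unfolding eventually_nhds_metric using c(1) by (intro exI[of _ "1 / c"]) auto
      ultimately show "\<forall>\<^sub>F \<zeta> in nhds 0. (\<lambda>n. fps_nth (Abs_fps (\<lambda>n. cinner ((C ^^ n) x) \<psi>)) n * \<zeta> ^ n) sums cinner (R \<zeta> x) \<psi>"
      proof eventually_elim
        case (elim \<zeta>)
        obtain k where k: "k > 0" "\<And>x. norm (R \<zeta> x) \<le> k * norm x" using bounded_clinear_bound[OF R(1)[OF elim(1)]] by blast
        have q: "cmod \<zeta> * c < 1" using elim(2) c(1) by (simp add: field_simps)
        have "(\<lambda>n. cinner (R \<zeta> x) \<psi> - (\<Sum>i<n. cinner ((C ^^ i) x) \<psi> * \<zeta> ^ i)) \<longlonglongrightarrow> 0"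
        proof (rule Lim_null_comparison)
          show "(\<lambda>n. (cmod \<zeta> * c) ^ n * (k * norm x * norm \<psi>)) \<longlonglongrightarrow> 0"
            using q c(1) by (intro tendsto_mult_left_zero LIMSEQ_power_zero) (simp add: abs_mult)
          have "norm (cinner (R \<zeta> x) \<psi> - (\<Sum>i<n. cinner ((C ^^ i) x) \<psi> * \<zeta> ^ i)) \<le> (cmod \<zeta> * c) ^ n * (k * norm x * norm \<psi>)" for n
          proof -
            have "cinner (\<Sum>i<n. \<zeta> ^ i *\<^sub>C (C ^^ i) x) \<psi> = (\<Sum>i<n. cinner ((C ^^ i) x) \<psi> * \<zeta> ^ i)"
              by (subst linear_sum[OF bounded_linear.linear[OF bounded_linear_cinner_left]])
                 (simp add: cinner_scaleC_left mult.commute)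
            then have "cinner (R \<zeta> x) \<psi> - (\<Sum>i<n. cinner ((C ^^ i) x) \<psi> * \<zeta> ^ i) = \<zeta> ^ n * cinner (R \<zeta> ((C ^^ n) x)) \<psi>"
              by (subst partial[OF elim(1), of x n]) (simp add: cinner_add_left cinner_scaleC_left)
            then have "norm (cinner (R \<zeta> x) \<psi> - (\<Sum>i<n. cinner ((C ^^ i) x) \<psi> * \<zeta> ^ i)) = cmod \<zeta> ^ n * cmod (cinner (R \<zeta> ((C ^^ n) x)) \<psi>)"
              by (simp add: norm_mult norm_power)
            also have "\<dots> \<le> cmod \<zeta> ^ n * (k * (c ^ n * norm x) * norm \<psi>)"
            proof (rule mult_left_mono)
              have "norm (R \<zeta> ((C ^^ n) x)) \<le> k * (c ^ n * norm x)"
                using k(2)[of "(C ^^ n) x"] mult_left_mono[OF Cn[of n x], of k] k(1) by linarith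
              from mult_right_mono[OF this, of "norm \<psi>"]
              show "cmod (cinner (R \<zeta> ((C ^^ n) x)) \<psi>) \<le> k * (c ^ n * norm x) * norm \<psi>"
                using cauchy_schwarz[of "R \<zeta> ((C ^^ n) x)" \<psi>] by simp
            qed simp
            finally show ?thesis by (simp add: power_mult_distrib mult_ac)
          qed
          then show "\<forall>\<^sub>F n in sequentially. norm (cinner (R \<zeta> x) \<psi> - (\<Sum>i<n. cinner ((C ^^ i) x) \<psi> * \<zeta> ^ i)) \<le> (cmod \<zeta> * c) ^ n * (k * norm x * norm \<psi>)" by simp
        qed
        from tendsto_diff[OF tendsto_const[of "cinner (R \<zeta> x) \<psi>"] this]
        show ?case by (simp add: sums_def)
      qed
    qed
    from fps_nth_fps_expansion[OF this, of n] show ?thesis by simp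
  qed
  have sub: "cball 0 r \<subseteq> \<Omega>" using inv by (auto simp: \<Omega>_def)
  have pt: "\<exists>B. \<forall>n. cmod (cinner ((C ^^ n) x) \<psi>) * r ^ n \<le> B" for x \<psi>
  proof -
    let ?f = "\<lambda>\<zeta>. cinner (R \<zeta> x) \<psi>"
    have cont: "continuous_on (cball 0 r) ?f"
      using holomorphic_on_imp_continuous_on[OF holo] sub continuous_on_subset by blast
    have "bounded (?f ` cball 0 r)"
      by (intro compact_imp_bounded compact_continuous_image cont compact_cball)
    then obtain B where B: "\<And>\<zeta>. \<zeta> \<in> cball 0 r \<Longrightarrow> cmod (?f \<zeta>) \<le> B"
      unfolding bounded_iff by blast
    have "cmod (cinner ((C ^^ n) x) \<psi>) * r ^ n \<le> B" for n
    proof -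
      have "norm ((deriv ^^ n) ?f 0) \<le> fact n * B / r ^ n"
        using sub r by (intro Cauchy_inequality holomorphic_on_subset[OF holo] cont B) auto
      moreover have "(deriv ^^ n) ?f 0 = fact n * cinner ((C ^^ n) x) \<psi>"
        using coeff[of n x \<psi>] by (simp add: field_simps)
      ultimately have "fact n * cmod (cinner ((C ^^ n) x) \<psi>) \<le> fact n * (B / r ^ n)"
        by (simp add: norm_mult)
      then have "cmod (cinner ((C ^^ n) x) \<psi>) \<le> B / r ^ n"
        by (simp only: mult_le_cancel_left_pos[OF fact_gt_zero])
      then show ?thesis using r by (simp add: pos_le_divide_eq)
    qed
    then show ?thesis by blast
  qed
  have "\<exists>M>0. \<forall>n\<in>UNIV. \<forall>x. norm (r ^ n *\<^sub>R (C ^^ n) x) \<le> M * norm x"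
  proof (rule uniform_boundedness)
    show "bounded_linear (\<lambda>x. r ^ n *\<^sub>R (C ^^ n) x)" for n
      by (intro bounded_clinear_bounded_linear bounded_clinear_scaleR Cnlin)
    fix x
    have "\<exists>M>0. \<forall>n\<in>UNIV. \<forall>\<psi>. norm (cinner (r ^ n *\<^sub>R (C ^^ n) x) \<psi>) \<le> M * norm \<psi>"
    proof (rule uniform_boundedness)
      fix \<psi>
      obtain B where "\<And>n. cmod (cinner ((C ^^ n) x) \<psi>) * r ^ n \<le> B" using pt by blast
      then show "\<exists>c. \<forall>n\<in>UNIV. norm (cinner (r ^ n *\<^sub>R (C ^^ n) x) \<psi>) \<le> c"
        using r by (intro exI[of _ B]) (simp add: cinner_scaleR_left mult.commute)
    qed (rule bounded_linear_cinner_right)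
    then obtain M where M: "M > 0" "\<And>n \<psi>. norm (cinner (r ^ n *\<^sub>R (C ^^ n) x) \<psi>) \<le> M * norm \<psi>" by blast
    then show "\<exists>c. \<forall>n\<in>UNIV. norm (r ^ n *\<^sub>R (C ^^ n) x) \<le> c"
      by (intro exI[of _ M] ballI norm_le_by_cinner) auto
  qed
  then show ?thesis using r by simp
qed

text \<open>The spectrum is compact, so it lies in \<open>Re z \<ge> - \<alpha>'\<close> for some \<open>\<alpha>' < \<alpha>\<close>.  For \<open>z\<close> in the spectrum,
  \<open>\<bar>1 - z / \<mu>\<bar>\<^sup>2 = 1 - 2 Re z / \<mu> + \<bar>z\<bar>\<^sup>2 / \<mu>\<^sup>2\<close>, and for large \<open>\<mu>\<close> the last term is smaller than the gap between
  \<open>2 \<alpha>' / \<mu>\<close> and \<open>2 \<alpha> / \<mu>\<close>.  Hence the spectrum of \<open>1 - L / \<mu>\<close> lies in a disc of radius less than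
  \<open>1 + \<alpha> / \<mu>\<close>.\<close>

theorem power_growth_of_spectral_bound:
  fixes L :: "'x::complex_hilbert_space \<Rightarrow> 'x"
  assumes L: "bounded_clinear L" and \<alpha>: "0 < \<alpha>"
    and inv: "\<And>z. Re z \<le> - \<alpha> \<Longrightarrow> \<exists>R. bounded_inverse (\<lambda>x. z *\<^sub>C x - L x) R"
  obtains \<mu> \<rho> M where "0 < \<mu>" "0 < \<rho>" "\<rho> < 1 + \<alpha> / \<mu>" "0 < M"
    "\<And>n x. norm (((\<lambda>x. x - (1 / \<mu>) *\<^sub>R L x) ^^ n) x) \<le> M * \<rho> ^ n * norm x"
proof -
  obtain a where a: "a > 0" "\<And>x. norm (L x) \<le> a * norm x" using bounded_clinear_bound[OF L] by blast
  define \<sigma> where "\<sigma> = {z. \<not> (\<exists>R. bounded_inverse (\<lambda>x. z *\<^sub>C x - L x) R)}"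
  have P: "bounded_clinear (\<lambda>x. z *\<^sub>C x - L x)" for z by (intro bounded_clinear_intros L)
  have \<sigma>_bounded: "cmod z \<le> a" if "z \<in> \<sigma>" for z
  proof (rule ccontr)
    assume "\<not> cmod z \<le> a"
    then have z: "cmod z > a" "z \<noteq> 0" using a by auto
    \<comment> \<open>the factor \<open>cnj z\<close> turns \<open>z\<close> into a positive number and makes the operator coercive\<close>
    have "\<exists>R. bounded_inverse (\<lambda>x. cnj z *\<^sub>C (z *\<^sub>C x - L x)) R"
    proof (rule coercive_bounded_inverse)
      show "bounded_clinear (\<lambda>x. cnj z *\<^sub>C (z *\<^sub>C x - L x))" by (intro bounded_clinear_scaleC P)
      show "0 < cmod z * (cmod z - a)" using z a by simp
      fix x
      have "Re (cnj z * cinner (L x) x) \<le> cmod z * (norm (L x) * norm x)"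
        using complex_Re_le_cmod[of "cnj z * cinner (L x) x"]
          mult_left_mono[OF cauchy_schwarz[of "L x" x], of "cmod z"] by (simp add: norm_mult)
      also have "\<dots> \<le> cmod z * (a * norm x * norm x)" by (intro mult_left_mono mult_right_mono a) auto
      finally have 1: "Re (cnj z * cinner (L x) x) \<le> cmod z * a * (norm x)\<^sup>2"
        by (simp add: power2_eq_square mult.assoc)
      have "cinner (cnj z *\<^sub>C (z *\<^sub>C x - L x)) x = cnj z * z * cinner x x - cnj z * cinner (L x) x"
        by (simp add: cinner_simps algebra_simps)
      moreover have "cnj z * z = complex_of_real ((cmod z)\<^sup>2)" by (simp add: complex_norm_square mult.commute del: of_real_power)
      ultimately have "Re (cinner (cnj z *\<^sub>C (z *\<^sub>C x - L x)) x) = (cmod z)\<^sup>2 * (norm x)\<^sup>2 - Re (cnj z * cinner (L x) x)"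
        by (simp add: cinner_self flip: of_real_mult of_real_power)
      with 1 show "cmod z * (cmod z - a) * (norm x)\<^sup>2 \<le> Re (cinner (cnj z *\<^sub>C (z *\<^sub>C x - L x)) x)"
        by (simp add: algebra_simps power2_eq_square)
    qed
    then obtain R where "bounded_inverse (\<lambda>x. cnj z *\<^sub>C (z *\<^sub>C x - L x)) R" by blast
    from bounded_inverse_scaleC[OF this, of "1 / cnj z" "\<lambda>x. z *\<^sub>C x - L x"]
    have "\<exists>R. bounded_inverse (\<lambda>x. z *\<^sub>C x - L x) R"
      using z by (auto simp: scaleC_scaleC bounded_clinear_scaleC[OF P])
    with that show False by (simp add: \<sigma>_def)
  qed
  have "open (- \<sigma>)" unfolding open_dist
  proof
    fix z0 assume "z0 \<in> - \<sigma>"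
    then obtain R where R: "bounded_inverse (\<lambda>x. z0 *\<^sub>C x - L x) R" by (auto simp: \<sigma>_def)
    then have "bounded_clinear R" by (simp add: bounded_inverse_def)
    then obtain k where k: "k > 0" "\<And>x. norm (R x) \<le> k * norm x" using bounded_clinear_bound by blast
    have "z \<in> - \<sigma>" if d: "dist z z0 < 1 / k" for z
    proof -
      have "\<exists>R'. bounded_inverse (\<lambda>x. (z0 *\<^sub>C x - L x) - (z0 - z) *\<^sub>C x) R'"
      proof (rule bounded_inverse_perturb[OF R P _ _ k(2)])
        show "bounded_clinear (\<lambda>x. (z0 - z) *\<^sub>C x)" by (intro bounded_clinear_intros)
        show "norm ((z0 - z) *\<^sub>C x) \<le> cmod (z0 - z) * norm x" for x :: 'x by simp
        show "k * cmod (z0 - z) < 1" using d k(1) by (simp add: dist_norm norm_minus_commute field_simps)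
      qed (use k in simp)
      then show ?thesis by (simp add: \<sigma>_def scaleC_diff_left)
    qed
    then show "\<exists>e>0. \<forall>z. dist z z0 < e \<longrightarrow> z \<in> - \<sigma>" using k(1) by (intro exI[of _ "1 / k"]) auto
  qed
  then have "closed \<sigma>" by (simp add: closed_def)
  moreover have "bounded \<sigma>" using \<sigma>_bounded by (auto simp: bounded_iff)
  ultimately have compact: "compact \<sigma>" by (simp add: compact_eq_bounded_closed)
  have "\<exists>\<alpha>'. 0 < \<alpha>' \<and> \<alpha>' < \<alpha> \<and> (\<forall>z\<in>\<sigma>. - \<alpha>' \<le> Re z)"
  proof (cases "\<sigma> = {}")
    case True
    then show ?thesis using \<alpha> by (intro exI[of _ "\<alpha> / 2"]) auto
  next
    case False
    obtain z where z: "z \<in> \<sigma>" "\<forall>w\<in>\<sigma>. Re z \<le> Re w"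
      using continuous_attains_inf[OF compact False, of Re] continuous_on_Re[OF continuous_on_id] by auto
    have "- \<alpha> < Re z" using inv[of z] z(1) by (auto simp: \<sigma>_def not_le[symmetric])
    then show ?thesis using z \<alpha> by (intro exI[of _ "max (\<alpha> / 2) (- Re z)"]) (auto simp: max_def)
  qed
  then obtain \<alpha>' where \<alpha>': "0 < \<alpha>'" "\<alpha>' < \<alpha>" "\<And>z. z \<in> \<sigma> \<Longrightarrow> - \<alpha>' \<le> Re z" by blast
  define \<alpha>'' where "\<alpha>'' = (\<alpha> + \<alpha>') / 2"
  have \<alpha>'': "\<alpha>' < \<alpha>''" "\<alpha>'' < \<alpha>" using \<alpha>' by (auto simp: \<alpha>''_def)
  \<comment> \<open>large enough for \<open>a\<^sup>2 / \<mu>\<^sup>2 < 2 (\<alpha>'' - \<alpha>') / \<mu>\<close>\<close>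
  define \<mu> where "\<mu> = a\<^sup>2 / (2 * (\<alpha>'' - \<alpha>')) + 1"
  have \<mu>: "\<mu> > 0" "a\<^sup>2 < \<mu> * (2 * (\<alpha>'' - \<alpha>'))"
  proof -
    show "\<mu> > 0" using \<alpha>'' by (simp add: \<mu>_def add_nonneg_pos)
    show "a\<^sup>2 < \<mu> * (2 * (\<alpha>'' - \<alpha>'))" using \<alpha>'' by (simp add: \<mu>_def distrib_right)
  qed
  define \<rho> where "\<rho> = 1 + \<alpha>'' / \<mu>"
  have \<rho>: "\<rho> > 0" "\<rho> < 1 + \<alpha> / \<mu>"
    using \<mu>(1) \<alpha>'' \<alpha>'(1) by (auto simp: \<rho>_def divide_strict_right_mono intro!: add_pos_pos divide_pos_pos)
  let ?Z = "\<lambda>x. x - (1 / \<mu>) *\<^sub>R L x"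
  have Z: "bounded_clinear ?Z" by (intro bounded_clinear_intros L)
  have "\<exists>M>0. \<forall>n x. (1 / \<rho>) ^ n * norm ((?Z ^^ n) x) \<le> M * norm x"
  proof (rule power_bound_of_resolvent[OF Z])
    show "1 / \<rho> > 0" using \<rho> by simp
    fix \<zeta> assume \<zeta>: "cmod \<zeta> \<le> 1 / \<rho>"
    show "\<exists>R. bounded_inverse (\<lambda>x. x - \<zeta> *\<^sub>C (x - (1 / \<mu>) *\<^sub>R L x)) R"
    proof (cases "\<zeta> = 0")
      case True
      then show ?thesis using bounded_clinear_id by (intro exI[of _ "\<lambda>x. x"]) (simp add: bounded_inverse_def)
    next
      case False
      \<comment> \<open>\<open>1 - \<zeta> (1 - L / \<mu>) = - (\<zeta> / \<mu>) (z - L)\<close>\<close>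
      define z where "z = complex_of_real \<mu> * (1 - 1 / \<zeta>)"
      have "z \<notin> \<sigma>"
      proof
        assume z: "z \<in> \<sigma>"
        have w: "1 / \<zeta> = 1 - z / \<mu>" using \<mu>(1) by (simp add: z_def)
        have "\<rho> \<le> cmod (1 / \<zeta>)" using \<zeta> False \<rho>(1) by (simp add: norm_divide field_simps)
        then have "\<rho>\<^sup>2 \<le> (cmod (1 - z / \<mu>))\<^sup>2" unfolding w using \<rho>(1) by (intro power_mono) auto
        also have "\<dots> = 1 - 2 * Re z / \<mu> + (cmod z)\<^sup>2 / \<mu>\<^sup>2"
          by (simp add: cmod_power2 power2_diff power_divide add_divide_distrib)
        also have "\<dots> \<le> 1 + 2 * \<alpha>' / \<mu> + a\<^sup>2 / \<mu>\<^sup>2"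
        proof -
          have "- 2 * Re z / \<mu> \<le> 2 * \<alpha>' / \<mu>" using \<alpha>'(3)[OF z] \<mu>(1) by (intro divide_right_mono) auto
          moreover have "(cmod z)\<^sup>2 / \<mu>\<^sup>2 \<le> a\<^sup>2 / \<mu>\<^sup>2" using \<sigma>_bounded[OF z] by (intro divide_right_mono power_mono) auto
          ultimately show ?thesis by simp
        qed
        also have "\<dots> < 1 + 2 * \<alpha>'' / \<mu>"
        proof -
          have "a\<^sup>2 / \<mu>\<^sup>2 < \<mu> * (2 * (\<alpha>'' - \<alpha>')) / \<mu>\<^sup>2" using \<mu> by (intro divide_strict_right_mono) auto
          also have "\<dots> = 2 * \<alpha>'' / \<mu> - 2 * \<alpha>' / \<mu>" using \<mu>(1) by (simp add: power2_eq_square field_simps)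
          finally show ?thesis by simp
        qed
        also have "\<dots> \<le> \<rho>\<^sup>2" by (simp add: \<rho>_def power2_sum)
        finally show False by simp
      qed
      then obtain R where R: "bounded_inverse (\<lambda>x. z *\<^sub>C x - L x) R" by (auto simp: \<sigma>_def)
      have "- (\<zeta> / \<mu>) * z = 1 - \<zeta>" using False \<mu>(1) by (simp add: z_def field_simps)
      then have "x - \<zeta> *\<^sub>C (x - (1 / \<mu>) *\<^sub>R L x) = (- (\<zeta> / \<mu>)) *\<^sub>C (z *\<^sub>C x - L x)" for x
        unfolding scaleC_diff_right scaleC_scaleC scaleC_of_real[symmetric]
        by (simp only: scaleC_diff_left scaleC_minus_left scaleC_one) simp
      from bounded_inverse_scaleC[OF R _ this P] False \<mu>(1) show ?thesis by auto
    qed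
  qed
  then obtain M where M: "M > 0" "\<And>n x. (1 / \<rho>) ^ n * norm ((?Z ^^ n) x) \<le> M * norm x" by blast
  have "norm ((?Z ^^ n) x) \<le> M * \<rho> ^ n * norm x" for n x
  proof -
    have "norm ((?Z ^^ n) x) = \<rho> ^ n * ((1 / \<rho>) ^ n * norm ((?Z ^^ n) x))"
      using \<rho>(1) by (simp add: power_divide)
    also have "\<dots> \<le> \<rho> ^ n * (M * norm x)" using \<rho>(1) by (intro mult_left_mono M) auto
    finally show ?thesis by (simp add: mult_ac)
  qed
  then show thesis using that[OF \<mu>(1) \<rho> M(1)] by blast
qed

section \<open>Linear differential equations with a bounded operator\<close>

text \<open>The exponential series \<open>\<Sum> t\<^sup>n N\<^sup>n x / n!\<close>, differentiated term by term.\<close>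

theorem linear_ode_solution:
  fixes N :: "'x::complex_hilbert_space \<Rightarrow> 'x"
  assumes N: "bounded_clinear N"
  obtains y where "y 0 = x" "\<And>t. (y has_vector_derivative N (y t)) (at t)"
proof -
  obtain k where k: "k > 0" "\<And>x. norm (N x) \<le> k * norm x" using bounded_clinear_bound[OF N] by blast
  define f where "f n t = (t ^ n / fact n) *\<^sub>R (N ^^ n) x" for n and t :: real
  define y where "y t = (\<Sum>n. f n t)" for t
  define f' where "f' n t = (if n = 0 then 0 else N (f (n - 1) t))" for n t
  have Nf: "N (f n t) = (t ^ n / fact n) *\<^sub>R (N ^^ Suc n) x" for n t
    by (simp add: f_def bounded_clinear_simps[OF N])
  have f'_deriv: "(f n has_vector_derivative f' n t) (at t within A)" for n t A
  proof -
    have "((\<lambda>t. t ^ n / fact n) has_real_derivative (real n * t ^ (n - 1)) / fact n) (at t within A)"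
      by (auto intro!: derivative_eq_intros)
    then have "((\<lambda>t. (t ^ n / fact n) *\<^sub>R (N ^^ n) x) has_vector_derivative
        ((real n * t ^ (n - 1)) / fact n) *\<^sub>R (N ^^ n) x) (at t within A)"
      by (auto intro!: derivative_eq_intros simp: has_vector_derivative_def has_field_derivative_def)
    moreover have "((real n * t ^ (n - 1)) / fact n) *\<^sub>R (N ^^ n) x = f' n t"
    proof (cases n)
      case (Suc m)
      have "real (Suc m) * t ^ m / fact (Suc m) = t ^ m / fact m" by (simp add: fact_reduce)
      then show ?thesis using Suc Nf[of m t] by (simp add: f'_def)
    qed (simp add: f'_def)
    ultimately show ?thesis by (simp add: f_def[abs_def])
  qed
  have uniform: "uniform_limit (ball 0 r) (\<lambda>n t. \<Sum>i<n. f i t) y sequentially" if "r > 0" for r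
    unfolding y_def
  proof (rule Weierstrass_m_test)
    show "norm (f n t) \<le> (r * k) ^ n /\<^sub>R fact n * norm x" if "t \<in> ball 0 r" for n t
    proof -
      have "norm (f n t) \<le> \<bar>t\<bar> ^ n / fact n * (k ^ n * norm x)"
        using mult_left_mono[OF funpow_bound[of N k n x], of "\<bar>t\<bar> ^ n / fact n"] k
        by (simp add: f_def power_abs)
      also have "\<dots> \<le> r ^ n / fact n * (k ^ n * norm x)"
        using that k by (intro mult_right_mono divide_right_mono power_mono) auto
      finally show ?thesis by (simp add: power_mult_distrib divide_inverse mult_ac)
    qed
    show "summable (\<lambda>n. (r * k) ^ n /\<^sub>R fact n * norm x)"
      by (intro summable_mult2 summable_exp_generic)
  qed
  have deriv: "(y has_vector_derivative N (y t)) (at t)" for t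
  proof -
    define r where "r = \<bar>t\<bar> + 1"
    have r: "r > 0" "t \<in> ball 0 r" by (auto simp: r_def)
    have sums: "(\<lambda>n. f n s) sums y s" if "s \<in> ball 0 r" for s
      using tendsto_uniform_limitI[OF uniform[OF r(1)] that] by (simp add: sums_def)
    have "\<exists>g. \<forall>s\<in>ball 0 r. (\<lambda>n. f n s) sums g s \<and> (g has_derivative (\<lambda>h. h *\<^sub>R N (y s))) (at s within ball 0 r)"
    proof (rule has_derivative_series[where f' = "\<lambda>n s h. h *\<^sub>R f' n s", OF convex_ball])
      show "t \<in> ball 0 r" "(\<lambda>n. f n t) sums y t" by (rule r(2), rule sums[OF r(2)])
      show "(f n has_derivative (\<lambda>h. h *\<^sub>R f' n s)) (at s within ball 0 r)" for n s
        using f'_deriv unfolding has_vector_derivative_def .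
      fix e :: real assume e: "e > 0"
      have "\<forall>\<^sub>F n in sequentially. \<forall>s\<in>ball 0 r. dist (\<Sum>i<n. f i s) (y s) < e / k"
        using uniform_limitD[OF uniform[OF r(1)], of "e / k"] e k(1) by simp
      then obtain m where m: "\<And>n s. n \<ge> m \<Longrightarrow> s \<in> ball 0 r \<Longrightarrow> dist (\<Sum>i<n. f i s) (y s) < e / k"
        unfolding eventually_sequentially by blast
      have "norm ((\<Sum>i<n. h *\<^sub>R f' i s) - h *\<^sub>R N (y s)) \<le> e * norm h"
        if n: "n \<ge> Suc m" and s: "s \<in> ball 0 r" for n s h
      proof -
        obtain p where p: "n = Suc p" "p \<ge> m" using n by (cases n) auto
        have "(\<Sum>i<n. f' i s) = (\<Sum>i<p. N (f i s))" unfolding p sum.lessThan_Suc_shift by (simp add: f'_def)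
        also have "\<dots> = N (\<Sum>i<p. f i s)"
          using linear_sum[OF bounded_linear.linear[OF bounded_clinear_bounded_linear[OF N]], of "\<lambda>i. f i s"] by simp
        finally have "(\<Sum>i<n. h *\<^sub>R f' i s) - h *\<^sub>R N (y s) = h *\<^sub>R N ((\<Sum>i<p. f i s) - y s)"
          by (simp add: scaleR_sum_right[symmetric] bounded_clinear_simps[OF N] scaleR_diff_right)
        then have "norm ((\<Sum>i<n. h *\<^sub>R f' i s) - h *\<^sub>R N (y s)) \<le> \<bar>h\<bar> * (k * dist (\<Sum>i<p. f i s) (y s))"
          using mult_left_mono[OF k(2)[of "(\<Sum>i<p. f i s) - y s"], of "\<bar>h\<bar>"] by (simp add: dist_norm)
        also have "\<dots> \<le> \<bar>h\<bar> * (k * (e / k))"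
          using m[OF p(2) s] k(1) by (intro mult_left_mono) auto
        finally show ?thesis using k(1) by (simp add: mult.commute)
      qed
      then show "\<forall>\<^sub>F n in sequentially. \<forall>s\<in>ball 0 r. \<forall>h. norm ((\<Sum>i<n. h *\<^sub>R f' i s) - h *\<^sub>R N (y s)) \<le> e * norm h"
        unfolding eventually_sequentially by blast
    qed
    then obtain g where g: "\<And>s. s \<in> ball 0 r \<Longrightarrow> (\<lambda>n. f n s) sums g s"
      "\<And>s. s \<in> ball 0 r \<Longrightarrow> (g has_derivative (\<lambda>h. h *\<^sub>R N (y s))) (at s within ball 0 r)" by blast
    have eq: "y s = g s" if "s \<in> ball 0 r" for s using sums_unique2[OF sums[OF that] g(1)[OF that]] .
    have "(g has_vector_derivative N (y t)) (at t within ball 0 r)"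
      using g(2)[OF r(2)] unfolding has_vector_derivative_def .
    from has_vector_derivative_transform[OF r(2) _ this, of y] eq
    have "(y has_vector_derivative N (y t)) (at t within ball 0 r)" by blast
    then show ?thesis unfolding has_vector_derivative_within_open[OF r(2) open_ball] .
  qed
  have "(\<lambda>n. f n 0) sums (\<Sum>n\<in>{0}. f n 0)"
    by (rule sums_finite) (auto simp: f_def)
  then have "y 0 = x" unfolding y_def by (simp add: sums_iff f_def)
  then show thesis using that deriv by blast
qed

section \<open>Stabilization of a bounded system\<close>

lemma hadj_funpow:
  fixes T :: "'x::complex_hilbert_space \<Rightarrow> 'x"
  assumes "bounded_clinear T"
  shows "cinner ((T ^^ n) x) y = cinner x ((hadj T ^^ n) y)"
proof (induction n arbitrary: x)
  case (Suc n)
  have "cinner ((T ^^ Suc n) x) y = cinner ((T ^^ n) (T x)) y" by (simp add: funpow_swap1)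
  also have "\<dots> = cinner (T x) ((hadj T ^^ n) y)" by (rule Suc)
  also have "\<dots> = cinner x ((hadj T ^^ Suc n) y)" by (simp add: hadj[OF assms])
  finally show ?case .
qed simp

text \<open>Polynomials of degree \<open>n\<close> in \<open>V\<close> are polynomials of degree \<open>n\<close> in \<open>E\<close>.\<close>

lemma power_change_of_basis:
  fixes G :: "'x::complex_hilbert_space \<Rightarrow> 'y::complex_hilbert_space" and E V :: "'x \<Rightarrow> 'x"
  assumes G: "bounded_clinear G" and E: "bounded_clinear E" and V: "\<And>x. V x = s *\<^sub>R x + t *\<^sub>R E x"
  shows "\<exists>C\<ge>0. \<forall>x. norm (G ((V ^^ n) x)) \<le> C * (\<Sum>j<Suc n. norm (G ((E ^^ j) x)))"
proof (induction n)
  case 0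
  show ?case by (intro exI[of _ 1]) simp
next
  case (Suc n)
  then obtain C where C: "C \<ge> 0" "\<And>x. norm (G ((V ^^ n) x)) \<le> C * (\<Sum>j<Suc n. norm (G ((E ^^ j) x)))" by blast
  have V': "bounded_clinear V" unfolding V by (intro bounded_clinear_intros E)
  note Vn = bounded_clinear_simps[OF bounded_clinear_funpow[OF V', of n]]
  have "norm (G ((V ^^ Suc n) x)) \<le> ((\<bar>s\<bar> + \<bar>t\<bar>) * C) * (\<Sum>j<Suc (Suc n). norm (G ((E ^^ j) x)))" for x
  proof -
    let ?a = "\<lambda>j. norm (G ((E ^^ j) x))"
    have "G ((V ^^ Suc n) x) = s *\<^sub>R G ((V ^^ n) x) + t *\<^sub>R G ((V ^^ n) (E x))"
      using V[of x] by (simp add: funpow_swap1 Vn bounded_clinear_simps[OF G])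
    then have "norm (G ((V ^^ Suc n) x)) \<le> \<bar>s\<bar> * norm (G ((V ^^ n) x)) + \<bar>t\<bar> * norm (G ((V ^^ n) (E x)))"
      using norm_triangle_ineq[of "s *\<^sub>R G ((V ^^ n) x)" "t *\<^sub>R G ((V ^^ n) (E x))"] by simp
    also have "\<dots> \<le> \<bar>s\<bar> * (C * (\<Sum>j<Suc (Suc n). ?a j)) + \<bar>t\<bar> * (C * (\<Sum>j<Suc (Suc n). ?a j))"
    proof (intro add_mono mult_left_mono)
      have "(\<Sum>j<Suc n. ?a j) \<le> (\<Sum>j<Suc (Suc n). ?a j)" by (intro sum_mono2) auto
      then show "norm (G ((V ^^ n) x)) \<le> C * (\<Sum>j<Suc (Suc n). ?a j)"
        using C(2)[of x] mult_left_mono[OF _ C(1)] order_trans by blast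
      have "(\<Sum>j<Suc n. norm (G ((E ^^ j) (E x)))) = (\<Sum>j<Suc n. ?a (Suc j))" by (simp add: funpow_swap1)
      also have "\<dots> \<le> (\<Sum>j<Suc (Suc n). ?a j)" unfolding sum.lessThan_Suc_shift[of _ "Suc n"] by simp
      finally show "norm (G ((V ^^ n) (E x))) \<le> C * (\<Sum>j<Suc (Suc n). ?a j)"
        using C(2)[of "E x"] mult_left_mono[OF _ C(1)] order_trans by blast
    qed auto
    finally show ?thesis by (simp only: distrib_right distrib_left mult.assoc)
  qed
  then show ?case using C(1) by (intro exI[of _ "(\<bar>s\<bar> + \<bar>t\<bar>) * C"]) auto
qed

text \<open>With \<open>E = a + 2 + L\<close> and \<open>R = E\<^sup>-\<^sup>1\<close>, the Gramian is \<open>W = \<Sum> R\<^sup>k B B\<^sup>* R\<^sup>*\<^sup>k\<close> over \<open>1 \<le> k \<le> n\<close>.  The sum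
  telescopes to \<open>E W E\<^sup>* \<le> W + B B\<^sup>*\<close>.  Writing \<open>E = 1 + H\<close> and dropping the nonnegative term \<open>H W H\<^sup>*\<close>
  yields the Lyapunov inequality \<open>H W + W H\<^sup>* \<le> B B\<^sup>*\<close> with \<open>H = L + a + 1\<close>.  Observability makes \<open>W\<close>
  coercive on the range of \<open>P\<close>, since \<open>R\<^sup>*\<^sup>n\<close> is invertible and \<open>E\<^sup>*\<close> and \<open>1 - \<kappa> L\<^sup>*\<close> are affine functions of
  the same operator.  With the feedback \<open>K = - B\<^sup>* W\<^sup>-\<^sup>1\<close> the function \<open>\<langle>W\<^sup>-\<^sup>1 y, y\<rangle>\<close> then decays at rate
  \<open>2 (a + 1)\<close> along trajectories in the range of \<open>P\<close>.  The orthogonal projection \<open>P\<close> allows all adjoints to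
  be taken in the whole space.\<close>

theorem stabilizing_feedback_of_observability:
  fixes L P :: "'x::complex_hilbert_space \<Rightarrow> 'x" and B :: "'u::complex_hilbert_space \<Rightarrow> 'x"
  assumes L: "bounded_clinear L" and B: "bounded_clinear B" and P: "bounded_clinear P"
    and Psym: "\<And>x y. cinner (P x) y = cinner x (P y)" and Pidem: "\<And>x. P (P x) = P x"
    and LP: "\<And>x. L (P x) = L x" "\<And>x. P (L x) = L x" and PB: "\<And>u. P (B u) = B u"
    and c: "0 < c"
    and obs: "\<And>\<phi>. P \<phi> = \<phi> \<Longrightarrow> c * norm \<phi> \<le> (\<Sum>k<n. norm (hadj B ((hadj (\<lambda>x. x - \<kappa> *\<^sub>R L x) ^^ k) \<phi>)))"
  obtains K and m \<beta> :: real where "bounded_clinear K" "0 < \<beta>" "0 < m"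
    "\<And>y t. (\<And>t. (y has_vector_derivative L (y t) + B (K (y t))) (at t)) \<Longrightarrow> (\<And>t. P (y t) = y t) \<Longrightarrow>
      0 \<le> t \<Longrightarrow> norm (y t) \<le> m * exp (- \<beta> * t) * norm (y 0)"
proof -
  obtain a where a: "a > 0" "\<And>x. norm (L x) \<le> a * norm x" using bounded_clinear_bound[OF L] by blast
  define E where "E x = (a + 2) *\<^sub>R x + L x" for x
  have E: "bounded_clinear E" unfolding E_def by (intro bounded_clinear_intros L)
  have "\<exists>R. bounded_inverse E R"
  proof (rule coercive_bounded_inverse[OF E, of 1])
    fix x
    have "- Re (cinner (L x) x) \<le> a * (norm x)\<^sup>2"
      using Re_cinner_le[of "- L x" x] mult_right_mono[OF a(2)[of x] norm_ge_zero[of x]]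
      by (simp add: cinner_minus_left power2_eq_square mult.assoc)
    moreover have "Re (cinner (E x) x) = (a + 2) * (norm x)\<^sup>2 + Re (cinner (L x) x)"
      by (simp add: E_def cinner_add_left cinner_scaleR_left norm_sq_cinner)
    moreover have "(a + 2) * (norm x)\<^sup>2 = a * (norm x)\<^sup>2 + 2 * (norm x)\<^sup>2" by (simp add: distrib_right)
    moreover have "0 \<le> (norm x)\<^sup>2" by simp
    ultimately show "1 * (norm x)\<^sup>2 \<le> Re (cinner (E x) x)" by linarith
  qed simp
  then obtain R where R: "bounded_clinear R" "\<And>x. R (E x) = x" "\<And>x. E (R x) = x"
    unfolding bounded_inverse_def by auto
  define Es where "Es = hadj E"
  define Rs where "Rs = hadj R"
  define Bs where "Bs = hadj B"
  have Es: "bounded_clinear Es" and Rs: "bounded_clinear Rs" and Bs: "bounded_clinear Bs"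
    unfolding Es_def Rs_def Bs_def by (intro bounded_clinear_hadj E R B)+
  have Rs_Es: "Rs (Es x) = x" for x
    by (rule cinner_ext_right) (simp add: Rs_def Es_def hadj[OF R(1), symmetric] hadj[OF E, symmetric] R)
  have Es_Rs: "Es (Rs x) = x" for x
    by (rule cinner_ext_right) (simp add: Rs_def Es_def hadj[OF R(1), symmetric] hadj[OF E, symmetric] R)
  have Es_eq: "Es x = (a + 2) *\<^sub>R x + hadj L x" for x
    unfolding Es_def by (rule hadj_eqI[OF E])
      (simp add: E_def cinner_simps hadj[OF L])
  have RP: "R (P x) = P (R x)" for x
  proof -
    have "E (P (R x)) = P (E (R x))" by (simp add: E_def LP bounded_clinear_simps[OF P])
    then show ?thesis using R by metis
  qed
  have RsP: "Rs (P x) = P (Rs x)" for x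
    by (rule cinner_ext_right) (simp add: Rs_def hadj[OF R(1), symmetric] Psym[symmetric] RP)
  have BsP: "Bs (P x) = Bs x" for x
    by (rule cinner_ext_right) (simp add: Bs_def hadj[OF B, symmetric] Psym[symmetric] PB)
  have RsPn: "(Rs ^^ k) (P x) = P ((Rs ^^ k) x)" for k x by (induction k) (auto simp: RsP)
  have RPn: "(R ^^ k) (P x) = P ((R ^^ k) x)" for k x by (induction k) (auto simp: RP)
  define W where "W x = (\<Sum>k\<in>{1..n}. (R ^^ k) (B (Bs ((Rs ^^ k) x))))" for x
  \<comment> \<open>the quadratic form of \<open>W\<close>\<close>
  define q where "q x = (\<Sum>k\<in>{1..n}. (norm (Bs ((Rs ^^ k) x)))\<^sup>2)" for x
  have W: "bounded_clinear W"
    unfolding W_def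
    by (intro bounded_clinear_sum bounded_clinear_compose[OF bounded_clinear_funpow[OF R(1)]
        bounded_clinear_compose[OF B bounded_clinear_compose[OF Bs bounded_clinear_funpow[OF Rs]]]])
  have Wxy: "cinner (W x) y = (\<Sum>k\<in>{1..n}. cinner (Bs ((Rs ^^ k) x)) (Bs ((Rs ^^ k) y)))" for x y
    unfolding W_def
    by (subst linear_sum[OF bounded_linear.linear[OF bounded_linear_cinner_left]])
       (simp add: hadj_funpow[OF R(1)] hadj[OF B] Rs_def Bs_def)
  have Wsym: "cinner (W x) y = cinner x (W y)" for x y
  proof -
    have "cnj (cinner (W y) x) = cinner (W x) y" unfolding Wxy cnj_sum
      by (intro sum.cong refl) (simp add: cinner_commute[symmetric])
    then show ?thesis by (simp add: cinner_commute[symmetric])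
  qed
  have Wq: "Re (cinner (W x) x) = q x" for x unfolding Wxy q_def by (simp add: norm_sq_cinner)
  have PW: "P (W x) = W x" for x
    unfolding W_def linear_sum[OF bounded_linear.linear[OF bounded_clinear_bounded_linear[OF P]]]
    by (intro sum.cong refl) (simp add: RPn[symmetric] PB)
  have qP: "q (P x) = q x" for x by (simp add: q_def RsPn BsP)
  have lyap: "2 * Re (cinner (W (hadj L x)) x) + 2 * (a + 1) * q x \<le> (norm (Bs x))\<^sup>2" for x
  proof -
    define h where "h = hadj L x + (a + 1) *\<^sub>R x"
    have Esx: "Es x = h + x" by (simp add: Es_eq h_def algebra_simps scaleR_2)
    have "q (Es x) = (\<Sum>k\<in>{1..n}. (norm (Bs ((Rs ^^ (k - 1)) x)))\<^sup>2)"
      unfolding q_def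
    proof (intro sum.cong refl)
      fix k assume "k \<in> {1..n}"
      then obtain j where "k = Suc j" by (cases k) auto
      then show "(norm (Bs ((Rs ^^ k) (Es x))))\<^sup>2 = (norm (Bs ((Rs ^^ (k - 1)) x)))\<^sup>2"
        by (simp add: funpow_swap1 Rs_Es)
    qed
    also have "\<dots> = (\<Sum>j<n. (norm (Bs ((Rs ^^ j) x)))\<^sup>2)"
      by (rule sum.reindex_bij_witness[of _ Suc "\<lambda>k. k - 1"]) auto
    also have "\<dots> \<le> (\<Sum>j\<in>{0..n}. (norm (Bs ((Rs ^^ j) x)))\<^sup>2)" by (intro sum_mono2) auto
    also have "\<dots> = (norm (Bs x))\<^sup>2 + q x" unfolding q_def by (simp add: sum.atLeast_Suc_atMost)
    finally have 1: "q (Es x) \<le> (norm (Bs x))\<^sup>2 + q x" .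
    have "cinner (W (h + x)) (h + x) = cinner (W h) h + cinner (W x) x + (cinner (W h) x + cinner (W x) h)"
      by (simp add: bounded_clinear_simps[OF W] cinner_simps)
    moreover have "Re (cinner (W x) h) = Re (cinner (W h) x)"
      by (subst Wsym) (subst cinner_commute, simp)
    ultimately have "q (Es x) = q h + q x + 2 * Re (cinner (W h) x)"
      unfolding Esx Wq[symmetric] by simp
    moreover have "0 \<le> q h" unfolding q_def by (intro sum_nonneg) auto
    moreover have "Re (cinner (W h) x) = Re (cinner (W (hadj L x)) x) + (a + 1) * q x"
      unfolding Wq[symmetric] by (simp add: h_def bounded_clinear_simps[OF W] cinner_simps)
    ultimately show ?thesis using 1 by (simp add: algebra_simps)
  qed
  have "\<exists>d>0. \<forall>\<phi>. P \<phi> = \<phi> \<longrightarrow> d * (norm \<phi>)\<^sup>2 \<le> q \<phi>"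
  proof -
    define Z where "Z = hadj (\<lambda>x. x - \<kappa> *\<^sub>R L x)"
    have Zeq: "Z x = (1 + \<kappa> * (a + 2)) *\<^sub>R x + (- \<kappa>) *\<^sub>R Es x" for x
      unfolding Z_def
    proof (rule hadj_eqI)
      show "bounded_clinear (\<lambda>x. x - \<kappa> *\<^sub>R L x)" by (intro bounded_clinear_intros L)
      show "cinner (z - \<kappa> *\<^sub>R L z) x = cinner z ((1 + \<kappa> * (a + 2)) *\<^sub>R x + (- \<kappa>) *\<^sub>R Es x)" for z
        by (simp add: Es_eq cinner_simps hadj[OF L] algebra_simps)
    qed
    have "\<exists>C. \<forall>k. 0 \<le> C k \<and> (\<forall>x. norm (Bs ((Z ^^ k) x)) \<le> C k * (\<Sum>j<Suc k. norm (Bs ((Es ^^ j) x))))"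
      using power_change_of_basis[OF Bs Es Zeq] by metis
    then obtain C where C: "\<And>k. 0 \<le> C k"
      "\<And>k x. norm (Bs ((Z ^^ k) x)) \<le> C k * (\<Sum>j<Suc k. norm (Bs ((Es ^^ j) x)))" by blast
    define Ct where "Ct = (\<Sum>k<n. C k) + 1"
    have Ct: "Ct > 0" unfolding Ct_def by (intro add_nonneg_pos sum_nonneg C) auto
    obtain e where e: "e > 0" "\<And>x. norm (Es x) \<le> e * norm x" using bounded_clinear_bound[OF Es] by blast
    define d where "d = (c / Ct / e ^ n)\<^sup>2 / (real n + 1)"
    have d: "d > 0" using c Ct e by (simp add: d_def)
    have "d * (norm \<phi>)\<^sup>2 \<le> q \<phi>" if \<phi>: "P \<phi> = \<phi>" for \<phi>
    proof -
      define \<eta> where "\<eta> = (Rs ^^ n) \<phi>"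
      have P\<eta>: "P \<eta> = \<eta>" unfolding \<eta>_def by (simp add: RsPn[symmetric] \<phi>)
      have EsRsn: "(Es ^^ j) ((Rs ^^ j) x) = x" for j x
        by (induction j arbitrary: x) (auto simp: funpow_swap1 Es_Rs)
      have unshift: "(Es ^^ j) \<eta> = (Rs ^^ (n - j)) \<phi>" if "j \<le> n" for j
      proof -
        have "\<eta> = (Rs ^^ j) ((Rs ^^ (n - j)) \<phi>)"
          unfolding \<eta>_def using that by (simp add: funpow_add[symmetric, THEN fun_cong, unfolded o_apply])
        then show ?thesis using EsRsn by simp
      qed
      have "(\<Sum>j<n. (norm (Bs ((Es ^^ j) \<eta>)))\<^sup>2) = (\<Sum>j<n. (norm (Bs ((Rs ^^ (n - j)) \<phi>)))\<^sup>2)"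
        by (intro sum.cong refl) (simp add: unshift)
      also have "\<dots> = q \<phi>" unfolding q_def
        by (rule sum.reindex_bij_witness[of _ "\<lambda>k. n - k" "\<lambda>j. n - j"]) auto
      finally have qsum: "(\<Sum>j<n. (norm (Bs ((Es ^^ j) \<eta>)))\<^sup>2) = q \<phi>" .
      have "c * norm \<eta> \<le> (\<Sum>k<n. norm (Bs ((Z ^^ k) \<eta>)))"
        using obs[OF P\<eta>] unfolding Bs_def Z_def .
      also have "\<dots> \<le> (\<Sum>k<n. C k * (\<Sum>j<n. norm (Bs ((Es ^^ j) \<eta>))))"
      proof (intro sum_mono)
        fix k assume "k \<in> {..<n}"
        then have "(\<Sum>j<Suc k. norm (Bs ((Es ^^ j) \<eta>))) \<le> (\<Sum>j<n. norm (Bs ((Es ^^ j) \<eta>)))"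
          by (intro sum_mono2) auto
        then show "norm (Bs ((Z ^^ k) \<eta>)) \<le> C k * (\<Sum>j<n. norm (Bs ((Es ^^ j) \<eta>)))"
          using C(2)[of k \<eta>] mult_left_mono[OF _ C(1)[of k]] order_trans by blast
      qed
      also have "\<dots> = (\<Sum>k<n. C k) * (\<Sum>j<n. norm (Bs ((Es ^^ j) \<eta>)))" by (simp add: sum_distrib_right)
      also have "\<dots> \<le> Ct * (\<Sum>j<n. norm (Bs ((Es ^^ j) \<eta>)))"
        by (intro mult_right_mono sum_nonneg) (auto simp: Ct_def)
      finally have "c / Ct * norm \<eta> \<le> (\<Sum>j<n. norm (Bs ((Es ^^ j) \<eta>)))"
        using Ct by (simp add: pos_divide_le_eq mult.commute)
      moreover have "norm \<phi> \<le> e ^ n * norm \<eta>"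
        using funpow_bound[of Es e n \<eta>] e unshift[of n] by simp
      then have "c / Ct / e ^ n * norm \<phi> \<le> c / Ct * norm \<eta>"
        using mult_left_mono[of "norm \<phi>" "e ^ n * norm \<eta>" "c / Ct / e ^ n"] c Ct e(1) by simp
      ultimately have "c / Ct / e ^ n * norm \<phi> \<le> (\<Sum>j<n. norm (Bs ((Es ^^ j) \<eta>)))" by linarith
      then have "(c / Ct / e ^ n * norm \<phi>)\<^sup>2 \<le> (\<Sum>j<n. norm (Bs ((Es ^^ j) \<eta>)))\<^sup>2"
        using c Ct e(1) by (intro power_mono) auto
      also have "\<dots> \<le> q \<phi> * real n"
        using sum_squared_le_sum_of_squares[of "\<lambda>j. norm (Bs ((Es ^^ j) \<eta>))" "{..<n}"] qsum by simp
      also have "\<dots> \<le> q \<phi> * (real n + 1)"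
      proof -
        have "0 \<le> q \<phi>" unfolding q_def by (intro sum_nonneg) auto
        then show ?thesis by (intro mult_left_mono) auto
      qed
      finally have "(c / Ct / e ^ n)\<^sup>2 * (norm \<phi>)\<^sup>2 \<le> q \<phi> * (real n + 1)" by (simp only: power_mult_distrib)
      then show ?thesis unfolding d_def by (simp add: pos_divide_le_eq)
    qed
    then show ?thesis using d by blast
  qed
  then obtain d where d: "d > 0" "\<And>\<phi>. P \<phi> = \<phi> \<Longrightarrow> d * (norm \<phi>)\<^sup>2 \<le> q \<phi>" by blast
  \<comment> \<open>\<open>W\<close> vanishes on the kernel of \<open>P\<close>; adding the complementary projection makes it invertible\<close>
  define Wf where "Wf x = W x + (x - P x)" for x
  have Wf: "bounded_clinear Wf" unfolding Wf_def by (intro bounded_clinear_intros W P)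
  have Wfsym: "cinner (Wf x) y = cinner x (Wf y)" for x y
    by (simp add: Wf_def cinner_simps Wsym Psym)
  have "\<exists>V. bounded_inverse Wf V"
  proof (rule coercive_bounded_inverse[OF Wf, of "min d 1"])
    show "0 < min d 1" using d by simp
    fix x
    have orth: "cinner (P x) (x - P x) = 0" by (simp add: cinner_diff_right Psym Pidem)
    have dec: "(norm x)\<^sup>2 = (norm (P x))\<^sup>2 + (norm (x - P x))\<^sup>2"
      using norm_add_sq[of "P x" "x - P x"] orth by simp
    have "cinner (x - P x) x = cinner (x - P x) (x - P x)"
      using orth cinner_commute[of "P x" "x - P x"] by (simp add: cinner_diff_right)
    then have "Re (cinner (Wf x) x) = q (P x) + (norm (x - P x))\<^sup>2"
      by (simp add: Wf_def cinner_add_left Wq qP norm_sq_cinner)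
    moreover have "min d 1 * (norm (P x))\<^sup>2 \<le> d * (norm (P x))\<^sup>2" by (intro mult_right_mono) auto
    moreover have "min d 1 * (norm (x - P x))\<^sup>2 \<le> 1 * (norm (x - P x))\<^sup>2" by (intro mult_right_mono) auto
    moreover have "d * (norm (P x))\<^sup>2 \<le> q (P x)" by (rule d) (rule Pidem)
    ultimately show "min d 1 * (norm x)\<^sup>2 \<le> Re (cinner (Wf x) x)" unfolding dec distrib_left by linarith
  qed
  then obtain V where V: "bounded_clinear V" "\<And>x. V (Wf x) = x" "\<And>x. Wf (V x) = x"
    unfolding bounded_inverse_def by auto
  have Vsym: "cinner (V x) y = cinner x (V y)" for x y
    using Wfsym[of "V x" "V y"] V(3) by simp
  define K where "K x = - Bs (V x)" for x
  have K: "bounded_clinear K" unfolding K_def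
    by (rule bounded_clinear_minus[OF bounded_clinear_compose[OF Bs V(1)]])
  obtain v where v: "v > 0" "\<And>x. norm (V x) \<le> v * norm x" using bounded_clinear_bound[OF V(1)] by blast
  obtain w where w: "w > 0" "\<And>x. norm (W x) \<le> w * norm x" using bounded_clinear_bound[OF W] by blast
  define \<beta> where "\<beta> = a + 1"
  define m where "m = sqrt (w\<^sup>2 * v / d)"
  have m: "m > 0" using w v d by (simp add: m_def)
  have "norm (y t) \<le> m * exp (- \<beta> * t) * norm (y 0)"
    if der: "\<And>t. (y has_vector_derivative L (y t) + B (K (y t))) (at t)"
      and yP: "\<And>t. P (y t) = y t" and t: "0 \<le> t" for y t
  proof -
    \<comment> \<open>on the range of \<open>P\<close> the operator \<open>V\<close> inverts \<open>W\<close> itself\<close>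
    have inner: "P (V x) = V x \<and> x = W (V x)" if "P x = x" for x
    proof -
      have x: "W (V x) + (V x - P (V x)) = x" using V(3)[of x] by (simp add: Wf_def)
      then have "P (W (V x) + (V x - P (V x))) = x" using that by simp
      then have "W (V x) = x" by (simp add: bounded_clinear_simps[OF P] PW Pidem)
      then show ?thesis using x by simp
    qed
    define U where "U s = Re (cinner (V (y s)) (y s))" for s
    have Uq: "U s = q (V (y s))" for s
    proof -
      have "y s = W (V (y s))" using inner[OF yP] by blast
      then have "U s = Re (cinner (V (y s)) (W (V (y s))))" unfolding U_def by simp
      then show ?thesis using Wq[of "V (y s)"] Wsym by simp
    qed
    have Uder: "\<exists>u'. (U has_real_derivative u') (at s) \<and> u' \<le> - (2 * \<beta>) * U s" for s
    proof -
      let ?y' = "L (y s) + B (K (y s))"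
      have "((\<lambda>s. V (y s)) has_vector_derivative V ?y') (at s)"
        by (rule bounded_linear.has_vector_derivative[OF bounded_clinear_bounded_linear[OF V(1)] der])
      then have "((\<lambda>s. cinner (V (y s)) (y s)) has_vector_derivative cinner (V (y s)) ?y' + cinner (V ?y') (y s)) (at s)"
        by (rule bounded_bilinear.has_vector_derivative[OF bounded_bilinear_cinner _ der])
      from bounded_linear.has_vector_derivative[OF bounded_linear_Re this]
      have 1: "(U has_real_derivative Re (cinner (V (y s)) ?y' + cinner (V ?y') (y s))) (at s)"
        unfolding U_def has_real_derivative_iff_has_vector_derivative .
      let ?w = "V (y s)"
      have yw: "y s = W ?w" using inner[OF yP] by blast
      have "Re (cinner (V ?y') (y s)) = Re (cinner ?w ?y')"
        by (subst Vsym) (subst cinner_commute, simp)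
      moreover have "Re (cinner ?w (L (y s))) = Re (cinner (W (hadj L ?w)) ?w)"
      proof -
        have "cinner ?w (L (y s)) = cinner (hadj L ?w) (W ?w)"
          using hadj_left[OF L, of ?w "y s"] yw by simp
        then show ?thesis by (simp add: Wsym)
      qed
      moreover have "Re (cinner ?w (B (K (y s)))) = - (norm (Bs ?w))\<^sup>2"
        by (simp add: hadj_left[OF B] Bs_def[symmetric] K_def cinner_minus_right norm_sq_cinner)
      ultimately have "Re (cinner (V (y s)) ?y' + cinner (V ?y') (y s))
          = 2 * Re (cinner (W (hadj L ?w)) ?w) - 2 * (norm (Bs ?w))\<^sup>2"
        by (simp add: cinner_add_right)
      also have "\<dots> \<le> - (2 * \<beta>) * U s"
        using lyap[of ?w] zero_le_power2[of "norm (Bs ?w)"] unfolding Uq \<beta>_def mult_minus_left by linarith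
      finally show ?thesis using 1 by blast
    qed
    have "exp (2 * \<beta> * 0) * U 0 \<ge> exp (2 * \<beta> * t) * U t"
    proof (rule DERIV_nonpos_imp_nonincreasing[OF t])
      fix s
      obtain u' where u': "(U has_real_derivative u') (at s)" "u' \<le> - (2 * \<beta>) * U s" using Uder by blast
      have "((\<lambda>s. exp (2 * \<beta> * s) * U s) has_real_derivative exp (2 * \<beta> * s) * (2 * \<beta>) * U s + exp (2 * \<beta> * s) * u') (at s)"
        using u'(1) by (auto intro!: derivative_eq_intros)
      moreover have "exp (2 * \<beta> * s) * (2 * \<beta>) * U s + exp (2 * \<beta> * s) * u' = exp (2 * \<beta> * s) * (2 * \<beta> * U s + u')"
        by (simp add: algebra_simps)
      moreover have "exp (2 * \<beta> * s) * (2 * \<beta> * U s + u') \<le> 0" using u'(2) by (intro mult_nonneg_nonpos) auto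
      ultimately show "\<exists>u. ((\<lambda>s. exp (2 * \<beta> * s) * U s) has_real_derivative u) (at s) \<and> u \<le> 0" by auto
    qed
    then have "exp (2 * \<beta> * t) * U t \<le> U 0" by simp
    then have "exp (- (2 * \<beta> * t)) * (exp (2 * \<beta> * t) * U t) \<le> exp (- (2 * \<beta> * t)) * U 0"
      by (rule mult_left_mono) simp
    then have decay: "U t \<le> exp (- (2 * \<beta> * t)) * U 0" by (simp add: mult.assoc[symmetric] exp_add[symmetric])
    have "U 0 \<le> norm (V (y 0)) * norm (y 0)" unfolding U_def by (rule Re_cinner_le)
    also have "\<dots> \<le> v * norm (y 0) * norm (y 0)" by (intro mult_right_mono v) auto
    finally have up: "U 0 \<le> v * (norm (y 0))\<^sup>2" by (simp add: power2_eq_square mult.assoc)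
    have low: "(norm (y t))\<^sup>2 \<le> w\<^sup>2 / d * U t"
    proof -
      have "norm (y t) \<le> w * norm (V (y t))" using w(2)[of "V (y t)"] inner[OF yP, of t] by simp
      then have "(norm (y t))\<^sup>2 \<le> w\<^sup>2 * (norm (V (y t)))\<^sup>2"
        using power_mono[of "norm (y t)" "w * norm (V (y t))" 2] by (simp add: power_mult_distrib)
      also have "(norm (V (y t)))\<^sup>2 \<le> U t / d"
        unfolding Uq using d(2)[of "V (y t)"] inner[OF yP, of t] d(1) by (simp add: pos_le_divide_eq mult.commute)
      finally show ?thesis by (simp add: mult_left_mono)
    qed
    have "(norm (y t))\<^sup>2 \<le> w\<^sup>2 / d * (exp (- (2 * \<beta> * t)) * (v * (norm (y 0))\<^sup>2))"
    proof -
      have "U t \<le> exp (- (2 * \<beta> * t)) * (v * (norm (y 0))\<^sup>2)"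
        by (rule order_trans[OF decay mult_left_mono[OF up exp_ge_zero]])
      then have "w\<^sup>2 / d * U t \<le> w\<^sup>2 / d * (exp (- (2 * \<beta> * t)) * (v * (norm (y 0))\<^sup>2))"
        using d(1) by (intro mult_left_mono) auto
      with low show ?thesis by linarith
    qed
    also have "\<dots> = (m * exp (- \<beta> * t) * norm (y 0))\<^sup>2"
    proof -
      have "(exp (- \<beta> * t))\<^sup>2 = exp (- (2 * \<beta> * t))" by (simp add: power2_eq_square exp_add[symmetric])
      then show ?thesis using w v d by (simp add: m_def power_mult_distrib)
    qed
    finally show ?thesis using m by (simp add: abs_le_square_iff[symmetric])
  qed
  then show thesis using that[OF K _ m, of \<beta>] a by (simp add: \<beta>_def)
qed

section \<open>Splitting off the bounded part of the generator\<close>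

text \<open>Gronwall's argument: at the maximum of \<open>exp (- 2 k s) norm (e s)\<close> the integral equation bounds this
  quantity by half of itself.\<close>

lemma volterra_zero:
  fixes e :: "real \<Rightarrow> 'x::complex_hilbert_space"
  assumes cont: "continuous_on {0..T} e" and T: "0 \<le> T" and k: "0 < k"
    and int: "\<And>t \<phi>. t \<in> {0..T} \<Longrightarrow> (h t \<phi> has_integral cinner (e t) \<phi>) {0..t}"
    and bound: "\<And>t \<phi> s. t \<in> {0..T} \<Longrightarrow> s \<in> {0..t} \<Longrightarrow> cmod (h t \<phi> s) \<le> k * norm (e s) * norm \<phi>"
  shows "e T = 0"
proof -
  let ?m = "\<lambda>s. exp (- (2 * k) * s) * norm (e s)"
  have "continuous_on {0..T} ?m" by (intro continuous_intros cont)
  then obtain s0 where s0: "s0 \<in> {0..T}" "\<And>s. s \<in> {0..T} \<Longrightarrow> ?m s \<le> ?m s0"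
    using continuous_attains_sup[of "{0..T}" ?m] T by auto
  define \<mu> where "\<mu> = ?m s0"
  have \<mu>0: "0 \<le> \<mu>" by (simp add: \<mu>_def)
  have es: "norm (e s) \<le> \<mu> * exp (2 * k * s)" if "s \<in> {0..T}" for s
  proof -
    have "norm (e s) = exp (2 * k * s) * ?m s" by (simp add: mult.assoc[symmetric] exp_add[symmetric])
    also have "\<dots> \<le> exp (2 * k * s) * \<mu>" unfolding \<mu>_def using s0(2)[OF that] by (intro mult_left_mono) auto
    finally show ?thesis by (simp add: mult.commute)
  qed
  have g: "((\<lambda>s. k * \<mu> * norm (e s0) * exp (2 * k * s)) has_integral
      k * \<mu> * norm (e s0) * ((exp (2 * k * s0) - 1) / (2 * k))) {0..s0}"
  proof (rule has_integral_mult_right)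
    have "((\<lambda>s. exp (2 * k * s)) has_integral exp (2 * k * s0) / (2 * k) - exp (2 * k * 0) / (2 * k)) {0..s0}"
      using s0(1) k by (intro fundamental_theorem_of_calculus)
        (auto intro!: derivative_eq_intros simp: has_real_derivative_iff_has_vector_derivative[symmetric])
    then show "((\<lambda>s. exp (2 * k * s)) has_integral (exp (2 * k * s0) - 1) / (2 * k)) {0..s0}"
      by (simp add: diff_divide_distrib)
  qed
  have "norm (integral {0..s0} (h s0 (e s0))) \<le> integral {0..s0} (\<lambda>s. k * \<mu> * norm (e s0) * exp (2 * k * s))"
  proof (rule integral_norm_bound_integral)
    show "h s0 (e s0) integrable_on {0..s0}" by (rule has_integral_integrable[OF int[OF s0(1)]])
    show "(\<lambda>s. k * \<mu> * norm (e s0) * exp (2 * k * s)) integrable_on {0..s0}" by (rule has_integral_integrable[OF g])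
    fix s assume s: "s \<in> {0..s0}"
    have "k * norm (e s) * norm (e s0) \<le> k * (\<mu> * exp (2 * k * s)) * norm (e s0)"
      using k es[of s] s s0(1) by (intro mult_right_mono mult_left_mono) auto
    then show "norm (h s0 (e s0) s) \<le> k * \<mu> * norm (e s0) * exp (2 * k * s)"
      using bound[OF s0(1) s, of "e s0"] by (simp add: mult_ac)
  qed
  then have "cmod (cinner (e s0) (e s0)) \<le> k * \<mu> * norm (e s0) * ((exp (2 * k * s0) - 1) / (2 * k))"
    using integral_unique[OF g] integral_unique[OF int[OF s0(1), of "e s0"]] by simp
  also have "\<dots> = \<mu> * norm (e s0) * (exp (2 * k * s0) - 1) / 2" using k by simp
  also have "\<dots> \<le> \<mu> * norm (e s0) * exp (2 * k * s0) / 2"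
    using \<mu>0 by (intro divide_right_mono mult_left_mono) auto
  finally have "norm (e s0) * norm (e s0) \<le> \<mu> * exp (2 * k * s0) / 2 * norm (e s0)"
    by (simp add: cinner_self norm_mult norm_power power2_eq_square mult_ac)
  then have "norm (e s0) \<le> \<mu> * exp (2 * k * s0) / 2"
    using \<mu>0 by (cases "e s0 = 0") auto
  then have "exp (- (2 * k) * s0) * norm (e s0) \<le> exp (- (2 * k) * s0) * (\<mu> * exp (2 * k * s0) / 2)"
    by (rule mult_left_mono) simp
  also have "\<dots> = \<mu> / 2" by (simp add: mult.left_commute[of _ \<mu>] exp_add[symmetric])
  finally have "\<mu> \<le> 0" unfolding \<mu>_def[symmetric] by simp
  then have "\<mu> * exp (2 * k * T) \<le> 0" by (rule mult_nonpos_nonneg) simp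
  moreover have "norm (e T) \<le> \<mu> * exp (2 * k * T)" using es T by simp
  ultimately have "norm (e T) \<le> 0" by linarith
  then show ?thesis by simp
qed

lemma bounded_clinear_fst: "bounded_clinear fst"
  by (rule bounded_clinear_intro[where C = 1]) (auto simp: scaleC_prod_def norm_fst_le)

lemma bounded_clinear_snd: "bounded_clinear snd"
  by (rule bounded_clinear_intro[where C = 1]) (auto simp: scaleC_prod_def norm_snd_le)

context c0_generator
begin

text \<open>Continuing the kernel by \<open>S(0)\<close> to \<open>s > t\<close> makes the integrand continuous on the square \<open>[0, T]\<^sup>2\<close> and adds
  the integral of \<open>g\<close> over \<open>[t, T]\<close>.\<close>

lemma convolution_continuous:
  assumes g: "continuous_on {0..} g"
  shows "continuous_on {0..} (\<lambda>t. integral {0..t} (\<lambda>s. S (t - s) (g s)))"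
proof -
  have on: "continuous_on {0..T} (\<lambda>t. integral {0..t} (\<lambda>s. S (t - s) (g s)))" if T: "0 \<le> T" for T
  proof -
    have gT: "continuous_on {0..T} g" by (rule continuous_on_subset[OF g]) simp
    let ?f = "\<lambda>t s. S (max (t - s) 0) (g s)"
    have "continuous_on ({0..T} \<times> cbox 0 T) (\<lambda>p. S (max (fst p - snd p) 0) (g (snd p)))"
    proof (rule S_continuous)
      show "continuous_on ({0..T} \<times> cbox 0 T) (\<lambda>p. g (snd p))"
        by (rule continuous_on_compose2[OF gT continuous_on_snd[OF continuous_on_id]]) auto
    qed (auto intro!: continuous_intros)
    then have "continuous_on {0..T} (\<lambda>t. integral (cbox 0 T) (?f t))"
      by (intro integral_continuous_on_param) (simp add: case_prod_beta)
    moreover have "continuous_on {0..T} (\<lambda>t. integral {0..t} g)"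
      by (rule indefinite_integral_continuous_1) (rule integrable_continuous_real[OF gT])
    ultimately have c: "continuous_on {0..T} (\<lambda>t. integral (cbox 0 T) (?f t) - (integral {0..T} g - integral {0..t} g))"
      by (intro continuous_intros)
    have eq: "integral (cbox 0 T) (?f t) - (integral {0..T} g - integral {0..t} g) = integral {0..t} (\<lambda>s. S (t - s) (g s))"
      if t: "t \<in> {0..T}" for t
    proof -
      have "continuous_on {0..T} (?f t)"
        by (rule S_continuous[OF gT]) (auto intro!: continuous_intros)
      then have i: "?f t integrable_on {0..T}" by (rule integrable_continuous_real)
      have 1: "integral {0..t} (?f t) + integral {t..T} (?f t) = integral {0..T} (?f t)"
        using t by (intro Henstock_Kurzweil_Integration.integral_combine i) auto
      have 2: "integral {0..t} (?f t) = integral {0..t} (\<lambda>s. S (t - s) (g s))"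
        by (rule integral_cong) (simp add: max_absorb1)
      have 3: "integral {t..T} (?f t) = integral {t..T} g"
        by (rule integral_cong) (simp add: max_absorb2 S_zero)
      have 4: "integral {0..t} g + integral {t..T} g = integral {0..T} g"
        using t by (intro Henstock_Kurzweil_Integration.integral_combine integrable_continuous_real gT) auto
      show ?thesis unfolding box_real 1[symmetric] 4[symmetric] 2 3 by simp
    qed
    show ?thesis using c by (rule continuous_on_eq) (rule eq)
  qed
  show ?thesis unfolding continuous_on_def
  proof
    fix t :: real assume "t \<in> {0..}"
    then have t: "0 \<le> t" by simp
    let ?c = "\<lambda>t. integral {0..t} (\<lambda>s. S (t - s) (g s))"
    have "(?c \<longlongrightarrow> ?c t) (at t within {0..t+1})"
      using on[of "t + 1"] t unfolding continuous_on_def by auto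
    moreover have "at t within {0..t+1} = at t within {0..}"
      by (rule at_within_nhd[of _ "{..<t+1}"]) auto
    ultimately show "(?c \<longlongrightarrow> ?c t) (at t within {0..})" by simp
  qed
qed

end

text \<open>A projection that commutes with the semigroup, onto a subspace on which the generator is bounded.\<close>

locale reducing_projection = c0_generator D A S
  for D :: "'x::complex_hilbert_space set" and A S +
  fixes Q :: "'x set" and P :: "'x \<Rightarrow> 'x"
  assumes Q: "csubspace Q" "closed Q" and Q_dom: "Q \<subseteq> D"
    and A_bounded: "\<exists>C. \<forall>x\<in>Q. norm (A x) \<le> C * norm x"
    and P_clinear: "bounded_clinear P" and P_in: "P x \<in> Q" and P_id: "x \<in> Q \<Longrightarrow> P x = x"
    and P_S: "0 \<le> t \<Longrightarrow> P (S t x) = S t (P x)"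
begin

lemmas P_simps = bounded_clinear_simps[OF P_clinear]

lemma P_idem: "P (P x) = P x" by (rule P_id[OF P_in])

lemma S_in_Q: "0 \<le> t \<Longrightarrow> x \<in> Q \<Longrightarrow> S t x \<in> Q"
  by (metis P_S P_id P_in)

lemma A_in_Q: "x \<in> Q \<Longrightarrow> A x \<in> Q"
proof -
  assume x: "x \<in> Q"
  have ev: "\<forall>\<^sub>F h in at_right 0. (1 / h) *\<^sub>R (S h x - x) \<in> Q"
    unfolding eventually_at_right_field
    using x csubspace_scaleR[OF Q(1)] csubspace_diff[OF Q(1)] S_in_Q by (intro exI[of _ 1]) auto
  show "A x \<in> Q"
    by (rule Lim_in_closed_set[OF Q(2) ev trivial_limit_at_right_real])
       (use x Q_dom in \<open>auto intro: generator_limit\<close>)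
qed

lemma A_P_commute: "x \<in> D \<Longrightarrow> A (P x) = P (A x)"
proof -
  assume x: "x \<in> D"
  have "((\<lambda>h. P ((1 / h) *\<^sub>R (S h x - x))) \<longlongrightarrow> P (A x)) (at_right 0)"
    by (rule bounded_linear.tendsto[OF bounded_clinear_bounded_linear[OF P_clinear] generator_limit[OF x]])
  then have "((\<lambda>h. (1 / h) *\<^sub>R (S h (P x) - P x)) \<longlongrightarrow> P (A x)) (at_right 0)"
    by (rule Lim_transform_eventually)
       (auto simp: eventually_at_right_field P_simps P_S intro!: exI[of _ 1])
  then show "A (P x) = P (A x)" by (rule generatorI)
qed

lemma A_compose_clinear:
  assumes "bounded_clinear E" "\<And>x. E x \<in> Q"
  shows "bounded_clinear (\<lambda>x. A (E x))"
proof -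
  obtain C where C: "\<And>x. x \<in> Q \<Longrightarrow> norm (A x) \<le> C * norm x" using A_bounded by blast
  obtain p where p: "p > 0" "\<And>x. norm (E x) \<le> p * norm x" using bounded_clinear_bound[OF assms(1)] by blast
  have ED: "E x \<in> D" for x using assms(2) Q_dom by auto
  show ?thesis
  proof (rule bounded_clinear_intro)
    show "A (E (x + y)) = A (E x) + A (E y)" for x y
      using A_add[OF ED ED] by (simp add: bounded_clinear_simps[OF assms(1)])
    show "A (E (c *\<^sub>C x)) = c *\<^sub>C A (E x)" for c x
      using A_scaleC[OF ED] by (simp add: bounded_clinear_simps[OF assms(1)])
    show "norm (A (E x)) \<le> (\<bar>C\<bar> * p) * norm x" for x
    proof -
      have "norm (A (E x)) \<le> \<bar>C\<bar> * norm (E x)"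
        using C[OF assms(2), of x] mult_right_mono[OF abs_ge_self[of C] norm_ge_zero[of "E x"]] by linarith
      also have "\<dots> \<le> \<bar>C\<bar> * (p * norm x)" by (intro mult_left_mono p) auto
      finally show ?thesis by (simp add: mult.assoc)
    qed
  qed
qed

lemma AP_clinear: "bounded_clinear (\<lambda>x. A (P x))"
  by (rule A_compose_clinear[OF P_clinear P_in])

text \<open>As \<open>A P\<close> is bounded, \<open>P\<^sup>*\<close> maps \<open>X\<close> into \<open>D(A\<^sup>*)\<close>.  Testing an element of \<open>X\<^sub>-\<^sub>1\<close> with the vectors \<open>P\<^sup>* \<phi>\<close>
  therefore gives an element of \<open>X\<close>, its projection.\<close>

lemma adj_P:
  shows "hadj P \<phi> \<in> Ds" "As (hadj P \<phi>) = hadj (\<lambda>x. A (P x)) \<phi>"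
proof -
  have *: "cinner (A z) (hadj P \<phi>) = cinner z (hadj (\<lambda>x. A (P x)) \<phi>)" if "z \<in> D" for z
    using that by (simp add: hadj[OF P_clinear, symmetric] hadj[OF AP_clinear, symmetric] A_P_commute)
  show "hadj P \<phi> \<in> Ds" by (rule adj_eqI(1)[OF *])
  show "As (hadj P \<phi>) = hadj (\<lambda>x. A (P x)) \<phi>" by (rule adj_eqI(2)[OF *])
qed

text \<open>The extension of \<open>P\<close> to \<open>X\<^sub>-\<^sub>1\<close>, evaluated at \<open>a + A b\<close>.\<close>

definition P_ext :: "'x \<times> 'x \<Rightarrow> 'x" where
  "P_ext p = P (fst p) + A (P (snd p))"

lemma P_ext_clinear: "bounded_clinear P_ext"
  unfolding P_ext_def
  by (rule bounded_clinear_add[OF bounded_clinear_compose[OF P_clinear bounded_clinear_fst]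
        bounded_clinear_compose[OF AP_clinear bounded_clinear_snd]])

lemma P_ext_in: "P_ext p \<in> Q"
  unfolding P_ext_def by (intro csubspace_add[OF Q(1)] A_in_Q P_in)

lemma J_adj_P: "J p (hadj P \<phi>) = cinner (P_ext p) \<phi>"
  by (cases p) (simp add: J_apply adj_P P_ext_def cinner_add_left
      hadj[OF P_clinear, symmetric] hadj[OF AP_clinear, symmetric])

lemma P_ext_S2: "0 \<le> t \<Longrightarrow> P_ext (S2 t p) = S t (P_ext p)"
  using A_S_commute(2)[OF subsetD[OF Q_dom P_in]] by (simp add: P_ext_def S2_def P_S S_simps)

lemma weak_solution_projected:
  assumes int: "((\<lambda>s. J (S2 (t - s) (p s)) (hadj P \<phi>)) has_integral cinner (y - S t y0) (hadj P \<phi>)) {0..t}"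
    and t: "0 \<le> t"
  shows "((\<lambda>s. cinner (S (t - s) (P_ext (p s))) \<phi>) has_integral cinner (P y - S t (P y0)) \<phi>) {0..t}"
proof -
  have "cinner (y - S t y0) (hadj P \<phi>) = cinner (P y - S t (P y0)) \<phi>"
    using t by (simp add: hadj[OF P_clinear, symmetric] P_simps P_S)
  with int show ?thesis
    using has_integral_eq[of "{0..t}" "\<lambda>s. J (S2 (t - s) (p s)) (hadj P \<phi>)"
        "\<lambda>s. cinner (S (t - s) (P_ext (p s))) \<phi>"] by (simp add: J_adj_P P_ext_S2)
qed

text \<open>The classical solution of the projected equation satisfies the weak formula: on \<open>Q\<close> the operator \<open>A\<close> can be
  moved from the test vector back to \<open>q\<close>, where it cancels against the equation.\<close>

lemma bounded_part_solution:
  assumes u: "\<And>s. s \<in> {0..t} \<Longrightarrow> (q has_vector_derivative A (q s) + v s) (at s within {0..t})"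
    and q: "\<And>s. q s \<in> Q" and v: "\<And>s. v s \<in> Q" and t: "0 \<le> t"
  shows "((\<lambda>s. cinner (S (t - s) (v s)) \<phi>) has_integral cinner (q t - S t (q 0)) \<phi>) {0..t}"
proof -
  let ?\<psi> = "hadj P \<phi>"
  have "((\<lambda>s. cinner (S (t - s) (A (q s) + v s)) ?\<psi> - cinner (S (t - s) (q s)) (As ?\<psi>)) has_integral
    cinner (q t) ?\<psi> - cinner (S t (q 0)) ?\<psi>) {0..t}"
    by (rule weak_duhamel[OF adj_P(1) t u])
  moreover have "cinner (S (t - s) (A (q s) + v s)) ?\<psi> - cinner (S (t - s) (q s)) (As ?\<psi>)
      = cinner (S (t - s) (v s)) \<phi>" if "s \<in> {0..t}" for s
  proof -
    have s: "0 \<le> t - s" using that by simp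
    have qD: "q s \<in> D" using q Q_dom by auto
    have "cinner (S (t - s) (q s)) (As ?\<psi>) = cinner (S (t - s) (A (q s))) ?\<psi>"
      using adj_cinner[OF adj_P(1) A_S_commute(1)[OF qD s]] A_S_commute(2)[OF qD s] by simp
    then have "cinner (S (t - s) (A (q s) + v s)) ?\<psi> - cinner (S (t - s) (q s)) (As ?\<psi>) = cinner (S (t - s) (v s)) ?\<psi>"
      using s by (simp add: S_simps cinner_add_left)
    also have "\<dots> = cinner (S (t - s) (v s)) \<phi>"
      using s by (simp add: hadj[OF P_clinear, symmetric] P_S P_id v)
    finally show ?thesis .
  qed
  ultimately have "((\<lambda>s. cinner (S (t - s) (v s)) \<phi>) has_integral
    cinner (q t) ?\<psi> - cinner (S t (q 0)) ?\<psi>) {0..t}"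
    by (rule has_integral_eq[rotated]) auto
  moreover have "cinner (q t) ?\<psi> - cinner (S t (q 0)) ?\<psi> = cinner (q t - S t (q 0)) \<phi>"
    using t by (simp add: hadj[OF P_clinear, symmetric] P_S P_id q cinner_diff_left)
  ultimately show ?thesis by simp
qed

text \<open>A feedback that only sees \<open>P y\<close> gives a Volterra equation with bounded kernel for the projected state.
  Hence two solutions have the same projection, so the same input, so they coincide.\<close>

lemma weak_solution_projection_eqI:
  assumes F: "bounded_clinear F" "\<And>x. F x = F (P x)"
    and z: "weak_solution F y0 z" and y: "weak_solution F y0 y" and t: "0 \<le> t"
  shows "z t = y t"
proof -
  have PF: "bounded_clinear (\<lambda>x. P_ext (F x))" by (rule bounded_clinear_compose[OF P_ext_clinear F(1)])
  obtain k where k: "k > 0" "\<And>x. norm (P_ext (F x)) \<le> k * norm x" using bounded_clinear_bound[OF PF] by blast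
  define e where "e s = P (z s) - P (y s)" for s
  have ez: "e s = 0" if s: "0 \<le> s" for s
  proof -
    obtain m where m: "m \<ge> 1" "\<And>r x. r \<in> {0..s} \<Longrightarrow> norm (S r x) \<le> m * norm x" using S_bound[of s] by auto
    show ?thesis
    proof (rule volterra_zero[where k = "m * k" and h = "\<lambda>t \<phi> r. cinner (S (t - r) (P_ext (F (e r)))) \<phi>"])
      show "continuous_on {0..s} e" unfolding e_def
        by (intro continuous_on_diff bounded_linear.continuous_on[OF bounded_clinear_bounded_linear[OF P_clinear]]
            continuous_on_subset[OF weak_solution_continuous[OF z]] continuous_on_subset[OF weak_solution_continuous[OF y]]) auto
      show "0 < m * k" using m(1) k(1) by simp
      fix t \<phi> assume t: "t \<in> {0..s}"
      then have t0: "0 \<le> t" by simp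
      have "((\<lambda>r. cinner (S (t - r) (P_ext (F (z r)))) \<phi> - cinner (S (t - r) (P_ext (F (y r)))) \<phi>) has_integral
          cinner (P (z t) - S t (P y0)) \<phi> - cinner (P (y t) - S t (P y0)) \<phi>) {0..t}"
        by (intro has_integral_diff weak_solution_projected[OF _ t0] weak_solution_integral[OF z t0 adj_P(1)]
            weak_solution_integral[OF y t0 adj_P(1)])
      then have "((\<lambda>r. cinner (S (t - r) (P_ext (F (z r)))) \<phi> - cinner (S (t - r) (P_ext (F (y r)))) \<phi>) has_integral
          cinner (e t) \<phi>) {0..t}" by (simp add: e_def cinner_diff_left)
      then show "((\<lambda>r. cinner (S (t - r) (P_ext (F (e r)))) \<phi>) has_integral cinner (e t) \<phi>) {0..t}"
      proof (rule has_integral_eq[rotated])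
        fix r assume r: "r \<in> {0..t}"
        have "F (e r) = F (z r) - F (y r)"
          unfolding e_def bounded_clinear_simps[OF F(1)] using F(2)[of "z r"] F(2)[of "y r"] by simp
        then show "cinner (S (t - r) (P_ext (F (z r)))) \<phi> - cinner (S (t - r) (P_ext (F (y r)))) \<phi>
            = cinner (S (t - r) (P_ext (F (e r)))) \<phi>"
          using r by (simp add: S_simps cinner_diff_left bounded_clinear_simps[OF P_ext_clinear])
      qed
      fix r assume r: "r \<in> {0..t}"
      have "norm (S (t - r) (P_ext (F (e r)))) \<le> m * norm (P_ext (F (e r)))"
        using m(2)[of "t - r"] r t by simp
      also have "\<dots> \<le> m * (k * norm (e r))" using m(1) by (intro mult_left_mono k) simp
      finally have "norm (S (t - r) (P_ext (F (e r)))) \<le> m * (k * norm (e r))" .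
      from mult_right_mono[OF this norm_ge_zero[of \<phi>]]
      show "cmod (cinner (S (t - r) (P_ext (F (e r)))) \<phi>) \<le> m * k * norm (e r) * norm \<phi>"
        using cauchy_schwarz[of "S (t - r) (P_ext (F (e r)))" \<phi>] by (simp add: mult.assoc)
    qed (use s in simp)
  qed
  have same: "F (z s) = F (y s)" if "0 \<le> s" for s
    using ez[OF that] F(2)[of "z s"] F(2)[of "y s"] by (simp add: e_def)
  show ?thesis
  proof (rule Ds_separating)
    fix \<psi> assume \<psi>: "\<psi> \<in> Ds"
    have "((\<lambda>s. J (S2 (t - s) (F (y s))) \<psi>) has_integral cinner (z t - S t y0) \<psi>) {0..t}"
      by (rule has_integral_eq[rotated, OF weak_solution_integral[OF z t \<psi>]]) (simp add: same)
    then have "cinner (z t - S t y0) \<psi> = cinner (y t - S t y0) \<psi>"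
      using weak_solution_integral[OF y t \<psi>] has_integral_unique by blast
    then show "cinner (z t) \<psi> = cinner (y t) \<psi>" by (simp add: cinner_diff_left)
  qed
qed

end

section \<open>Stabilizability yields a bounded feedback law\<close>

lemma time_times_exp_decay:
  fixes \<omega> :: real
  assumes "0 < \<omega>" "0 \<le> t"
  shows "t * exp (- \<omega> * t) \<le> 2 / \<omega> * exp (- (\<omega> / 2) * t)"
proof -
  have "\<omega> / 2 * t \<le> exp (\<omega> / 2 * t)" using exp_ge_add_one_self[of "\<omega> / 2 * t"] by linarith
  then have "t \<le> 2 / \<omega> * exp (\<omega> / 2 * t)" using assms(1) by (simp add: field_simps)
  then have "t * exp (- \<omega> * t) \<le> 2 / \<omega> * exp (\<omega> / 2 * t) * exp (- \<omega> * t)" by (rule mult_right_mono) simp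
  also have "\<dots> = 2 / \<omega> * exp (- (\<omega> / 2) * t)" by (simp add: mult.assoc exp_add[symmetric] field_simps)
  finally show ?thesis .
qed

context reducing_projection
begin

text \<open>The projected state \<open>q\<close> is the solution of \<open>q' = L q + P B K q\<close>, which decays.  With \<open>b\<^sub>1, b\<^sub>2\<close> the coordinates
  of \<open>B K q\<close>, the input contributes \<open>\<integral> S(t - s) b\<^sub>1(s) ds + A \<integral> S(t - s) b\<^sub>2(s) ds\<close> to the state.  As \<open>b\<^sub>2\<close> is
  differentiable in time, integration by parts removes the operator \<open>A\<close> and leaves
  \<open>\<integral> S(t - s) (b\<^sub>1 + b\<^sub>2')(s) ds + S(t) b\<^sub>2(0) - b\<^sub>2(t)\<close>.  Off \<open>Q\<close> every term of this formula decays, because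
  the semigroup and the input do.\<close>

theorem feedback_solution:
  assumes b: "bounded_clinear b" and K: "bounded_clinear K"
    and L: "bounded_clinear L" "\<And>x. x \<in> Q \<Longrightarrow> L x = A x" "\<And>x. L x \<in> Q"
    and decayQ: "\<And>y t. (\<And>t. (y has_vector_derivative L (y t) + P_ext (b (K (y t)))) (at t)) \<Longrightarrow>
      (\<And>t. y t \<in> Q) \<Longrightarrow> 0 \<le> t \<Longrightarrow> norm (y t) \<le> m * exp (- \<beta> * t) * norm (y 0)"
    and \<beta>: "0 < \<beta>" and m: "0 < m"
    and decay_comp: "\<And>x t. 0 \<le> t \<Longrightarrow> norm (S t (x - P x)) \<le> c * exp (- \<epsilon> * t) * norm (x - P x)"
    and \<epsilon>: "0 < \<epsilon>" and c: "0 < c"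
  shows "\<exists>C>0. \<exists>\<omega>>0. \<forall>y0. \<exists>y. weak_solution (\<lambda>x. b (K (P x))) y0 y \<and>
    (\<forall>t\<ge>0. norm (y t) \<le> C * exp (- \<omega> * t) * norm y0)"
proof -
  define N where "N x = L x + P_ext (b (K x))" for x
  have bK: "bounded_clinear (\<lambda>x. b (K x))" by (rule bounded_clinear_compose[OF b K])
  have PbK: "bounded_clinear (\<lambda>x. P_ext (b (K x)))" by (rule bounded_clinear_compose[OF P_ext_clinear bK])
  have N: "bounded_clinear N" unfolding N_def by (rule bounded_clinear_add[OF L(1) PbK])
  have NQ: "N x \<in> Q" for x unfolding N_def by (rule csubspace_add[OF Q(1) L(3) P_ext_in])
  \<comment> \<open>the functions \<open>b\<^sub>1 + b\<^sub>2'\<close> and \<open>b\<^sub>2\<close> in terms of the projected state\<close>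
  define h where "h x = fst (b (K x)) + snd (b (K (N x)))" for x
  define w where "w x = snd (b (K x))" for x
  have w: "bounded_clinear w" unfolding w_def by (rule bounded_clinear_compose[OF bounded_clinear_snd bK])
  have h: "bounded_clinear h" unfolding h_def
    by (rule bounded_clinear_add[OF bounded_clinear_compose[OF bounded_clinear_fst bK]
          bounded_clinear_compose[OF bounded_clinear_snd bounded_clinear_compose[OF bK N]]])
  have P2: "bounded_clinear (\<lambda>x. x - P x)" by (rule bounded_clinear_diff[OF bounded_clinear_id P_clinear])
  obtain kw where kw: "kw > 0" "\<And>x. norm (w x) \<le> kw * norm x" using bounded_clinear_bound[OF w] by blast
  obtain kh where kh: "kh > 0" "\<And>x. norm (h x) \<le> kh * norm x" using bounded_clinear_bound[OF h] by blast
  obtain kp where kp: "kp > 0" "\<And>x. norm (P x) \<le> kp * norm x" using bounded_clinear_bound[OF P_clinear] by blast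
  obtain k2 where k2: "k2 > 0" "\<And>x. norm (x - P x) \<le> k2 * norm x" using bounded_clinear_bound[OF P2] by blast
  define \<omega> where "\<omega> = min \<epsilon> \<beta>"
  have \<omega>: "0 < \<omega>" "\<omega> \<le> \<epsilon>" "\<omega> \<le> \<beta>" using \<epsilon> \<beta> by (auto simp: \<omega>_def)
  define C where "C = m * kp + c * k2 + c * k2 * kh * (m * kp) * (2 / \<omega>) + c * k2 * kw * kp + k2 * kw * (m * kp)"
  have C: "C > 0" unfolding C_def using m kp c k2 kh kw \<omega> by (intro add_pos_pos mult_pos_pos) auto
  have "\<exists>y. weak_solution (\<lambda>x. b (K (P x))) y0 y \<and> (\<forall>t\<ge>0. norm (y t) \<le> C * exp (- (\<omega> / 2) * t) * norm y0)" for y0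
  proof -
    obtain q where q0: "q 0 = P y0" and qd: "\<And>t. (q has_vector_derivative N (q t)) (at t)"
      using linear_ode_solution[OF N] by blast
    have qQ: "q t \<in> Q" for t
    proof -
      have "((\<lambda>t. q t - P (q t)) has_vector_derivative 0) (at t within UNIV)" for t
      proof -
        have "((\<lambda>t. q t - P (q t)) has_vector_derivative N (q t) - P (N (q t))) (at t within UNIV)"
          by (rule bounded_linear.has_vector_derivative[OF bounded_clinear_bounded_linear[OF P2] qd])
        then show ?thesis by (simp add: P_id[OF NQ])
      qed
      then have "q t - P (q t) = q 0 - P (q 0)"
        unfolding has_vector_derivative_def
        by (intro has_derivative_zero_unique[of UNIV "\<lambda>t. q t - P (q t)"]) auto
      then have "q t = P (q t)" by (simp add: q0 P_idem)
      then show ?thesis using P_in by metis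
    qed
    have qdec: "norm (q t) \<le> m * kp * exp (- \<beta> * t) * norm y0" if t: "0 \<le> t" for t
    proof -
      have "norm (q t) \<le> m * exp (- \<beta> * t) * norm (P y0)"
        using decayQ[of q t, OF _ qQ t] qd unfolding N_def q0[symmetric] by simp
      also have "\<dots> \<le> m * exp (- \<beta> * t) * (kp * norm y0)" using m by (intro mult_left_mono kp) auto
      finally show ?thesis by (simp add: mult_ac)
    qed
    have qc: "continuous_on UNIV q" using has_vector_derivative_continuous[OF qd]
      by (simp add: continuous_at_imp_continuous_on)
    have wq: "((\<lambda>t. w (q t)) has_vector_derivative w (N (q t))) (at t)" for t
      by (rule bounded_linear.has_vector_derivative[OF bounded_clinear_bounded_linear[OF w] qd])
    have hc: "continuous_on I (\<lambda>t. h (q t))" for I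
      by (rule bounded_linear.continuous_on[OF bounded_clinear_bounded_linear[OF h] continuous_on_subset[OF qc]]) simp
    have wc: "continuous_on I (\<lambda>t. w (q t))" for I
      by (rule bounded_linear.continuous_on[OF bounded_clinear_bounded_linear[OF w] continuous_on_subset[OF qc]]) simp
    define I where "I t = integral {0..t} (\<lambda>s. S (t - s) (h (q s)))" for t
    have hint: "((\<lambda>s. S (t - s) (h (q s))) has_integral I t) {0..t}" for t
      unfolding I_def by (intro integrable_integral integrable_continuous_real S_continuous hc)
        (auto intro!: continuous_intros)
    define y where "y t = S t y0 + I t + S t (w (q 0)) - w (q t)" for t
    have ycont: "continuous_on {0..} y" unfolding y_def I_def
      by (intro continuous_on_diff continuous_on_add S_orbit_continuous convolution_continuous hc wc)
    have y0: "y 0 = y0" by (simp add: y_def I_def S_zero)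
    have yweak: "((\<lambda>s. J (S2 (t - s) (b (K (q s)))) \<psi>) has_integral cinner (y t - S t y0) \<psi>) {0..t}"
      if t: "0 \<le> t" and \<psi>: "\<psi> \<in> Ds" for t \<psi>
    proof -
      have 1: "((\<lambda>s. cinner (S (t - s) (w (N (q s)))) \<psi> - cinner (S (t - s) (w (q s))) (As \<psi>)) has_integral
          cinner (w (q t)) \<psi> - cinner (S t (w (q 0))) \<psi>) {0..t}"
        by (rule weak_duhamel[OF \<psi> t]) (rule has_vector_derivative_at_within[OF wq])
      have 2: "((\<lambda>s. cinner (S (t - s) (h (q s))) \<psi>) has_integral cinner (I t) \<psi>) {0..t}"
        using has_integral_linear[OF hint bounded_linear_cinner_left[of \<psi>]] by (simp add: o_def)
      have "cinner (I t) \<psi> - (cinner (w (q t)) \<psi> - cinner (S t (w (q 0))) \<psi>) = cinner (y t - S t y0) \<psi>"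
        by (simp add: y_def cinner_add_left cinner_diff_left)
      with has_integral_diff[OF 2 1]
      have "((\<lambda>s. cinner (S (t - s) (h (q s))) \<psi> - (cinner (S (t - s) (w (N (q s)))) \<psi> - cinner (S (t - s) (w (q s))) (As \<psi>)))
          has_integral cinner (y t - S t y0) \<psi>) {0..t}" by simp
      then show ?thesis
      proof (rule has_integral_eq[rotated])
        fix s assume "s \<in> {0..t}"
        then have "S (t - s) (h (q s)) = S (t - s) (fst (b (K (q s)))) + S (t - s) (w (N (q s)))"
          by (simp add: h_def w_def S_simps)
        then show "cinner (S (t - s) (h (q s))) \<psi> - (cinner (S (t - s) (w (N (q s)))) \<psi> - cinner (S (t - s) (w (q s))) (As \<psi>))
            = J (S2 (t - s) (b (K (q s)))) \<psi>"
          using \<psi> by (simp add: J_apply S2_def w_def cinner_add_left)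
      qed
    qed
    have Py: "P (y t) = q t" if t: "0 \<le> t" for t
    proof (rule cinner_ext)
      fix \<phi>
      have "((\<lambda>s. cinner (S (t - s) (P_ext (b (K (q s))))) \<phi>) has_integral cinner (P (y t) - S t (P y0)) \<phi>) {0..t}"
        by (rule weak_solution_projected[OF yweak[OF t adj_P(1)] t])
      moreover have "((\<lambda>s. cinner (S (t - s) (P_ext (b (K (q s))))) \<phi>) has_integral cinner (q t - S t (q 0)) \<phi>) {0..t}"
      proof (rule bounded_part_solution[OF _ qQ P_ext_in t])
        fix s show "(q has_vector_derivative A (q s) + P_ext (b (K (q s)))) (at s within {0..t})"
          using has_vector_derivative_at_within[OF qd[of s]] by (simp add: N_def L(2)[OF qQ])
      qed
      ultimately have "cinner (P (y t) - S t (P y0)) \<phi> = cinner (q t - S t (q 0)) \<phi>"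
        using has_integral_unique by blast
      then show "cinner (P (y t)) \<phi> = cinner (q t) \<phi>" by (simp add: q0 cinner_diff_left)
    qed
    have sol: "weak_solution (\<lambda>x. b (K (P x))) y0 y" unfolding weak_solution_def
    proof (intro conjI ycont y0 allI impI ballI)
      fix t :: real and \<psi> assume t: "0 \<le> t" and \<psi>: "\<psi> \<in> Ds"
      show "((\<lambda>s. J (S2 (t - s) (b (K (P (y s))))) \<psi>) has_integral cinner (y t - S t y0) \<psi>) {0..t}"
        by (rule has_integral_eq[rotated, OF yweak[OF t \<psi>]]) (simp add: Py)
    qed
    have comp_bound: "norm (S t x - P (S t x)) \<le> c * exp (- \<epsilon> * t) * (k2 * norm x)" if t: "0 \<le> t" for t x
    proof -
      have "norm (S t x - P (S t x)) \<le> c * exp (- \<epsilon> * t) * norm (x - P x)"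
        using decay_comp[OF t, of x] t by (simp add: P_S S_simps)
      also have "\<dots> \<le> c * exp (- \<epsilon> * t) * (k2 * norm x)" using c by (intro mult_left_mono k2) auto
      finally show ?thesis .
    qed
    have "norm (y t) \<le> C * exp (- (\<omega> / 2) * t) * norm y0" if t: "0 \<le> t" for t
    proof -
      let ?E = "exp (- (\<omega> / 2) * t)" and ?n = "norm y0"
      have e\<epsilon>: "exp (- \<epsilon> * t) \<le> ?E" and e\<beta>: "exp (- \<beta> * t) \<le> ?E"
        using t \<omega> mult_right_mono[of "\<omega> / 2" \<epsilon> t] mult_right_mono[of "\<omega> / 2" \<beta> t] by auto
      \<comment> \<open>the rate is halved in order to absorb the factor \<open>t\<close> from the convolution of two exponentials\<close>
      have b1: "norm (P (y t)) \<le> m * kp * ?E * ?n"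
      proof -
        have "norm (P (y t)) \<le> m * kp * exp (- \<beta> * t) * ?n" using qdec[OF t] Py[OF t] by simp
        also have "\<dots> \<le> m * kp * ?E * ?n" using m kp by (intro mult_right_mono mult_left_mono e\<beta>) auto
        finally show ?thesis .
      qed
      have b2: "norm (S t y0 - P (S t y0)) \<le> c * k2 * ?E * ?n"
      proof -
        have "c * exp (- \<epsilon> * t) * (k2 * ?n) \<le> c * ?E * (k2 * ?n)"
          using c k2 by (intro mult_right_mono mult_left_mono e\<epsilon>) auto
        with comp_bound[OF t, of y0] show ?thesis by (simp add: mult_ac)
      qed
      have b3: "norm (I t - P (I t)) \<le> c * k2 * kh * (m * kp) * (2 / \<omega>) * ?E * ?n"
      proof -
        have int: "((\<lambda>s. S (t - s) (h (q s)) - P (S (t - s) (h (q s)))) has_integral I t - P (I t)) {0..t}"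
          using has_integral_linear[OF hint bounded_clinear_bounded_linear[OF P2]] by (simp add: o_def)
        let ?B = "c * exp (- \<omega> * t) * k2 * (kh * (m * kp * ?n))"
        have "norm (I t - P (I t)) \<le> ?B * measure lborel {0..t}"
        proof (rule has_integral_bound_real[OF _ _ int])
          show "0 \<le> ?B" using c k2 kh m kp by simp
          fix s assume s: "s \<in> {0..t} - {}"
          have "norm (S (t - s) (h (q s)) - P (S (t - s) (h (q s)))) \<le> c * exp (- \<epsilon> * (t - s)) * (k2 * norm (h (q s)))"
            using s by (intro comp_bound) simp
          also have "\<dots> \<le> c * exp (- \<omega> * (t - s)) * (k2 * (kh * (m * kp * exp (- \<omega> * s) * ?n)))"
          proof -
            have 1: "exp (- \<epsilon> * (t - s)) \<le> exp (- \<omega> * (t - s))"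
              using s \<omega>(2) mult_right_mono[of \<omega> \<epsilon> "t - s"] by simp
            have "norm (q s) \<le> m * kp * exp (- \<omega> * s) * ?n"
            proof -
              have "exp (- \<beta> * s) \<le> exp (- \<omega> * s)" using s \<omega>(3) mult_right_mono[of \<omega> \<beta> s] by simp
              then have "m * kp * exp (- \<beta> * s) * ?n \<le> m * kp * exp (- \<omega> * s) * ?n"
                using m kp by (intro mult_right_mono mult_left_mono) auto
              with qdec[of s] s show ?thesis by simp
            qed
            from mult_left_mono[OF this, of kh] kh(2)[of "q s"] kh(1)
            have "norm (h (q s)) \<le> kh * (m * kp * exp (- \<omega> * s) * ?n)" by linarith
            then show ?thesis using c k2 by (intro mult_mono mult_left_mono 1) auto
          qed
          also have "\<dots> = c * (exp (- \<omega> * (t - s)) * exp (- \<omega> * s)) * k2 * (kh * (m * kp * ?n))" by (simp add: mult_ac)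
          also have "\<dots> = ?B" by (simp add: exp_add[symmetric] algebra_simps)
          finally show "norm (S (t - s) (h (q s)) - P (S (t - s) (h (q s)))) \<le> ?B" .
        qed simp
        also have "?B * measure lborel {0..t} = c * k2 * kh * (m * kp) * ?n * (t * exp (- \<omega> * t))"
          using t by (simp add: mult_ac)
        also have "\<dots> \<le> c * k2 * kh * (m * kp) * ?n * (2 / \<omega> * ?E)"
          using c k2 kh m kp by (intro mult_left_mono time_times_exp_decay \<omega> t) auto
        finally show ?thesis by (simp add: mult_ac)
      qed
      have b4: "norm (S t (w (q 0)) - P (S t (w (q 0)))) \<le> c * k2 * kw * kp * ?E * ?n"
      proof -
        have "norm (w (q 0)) \<le> kw * (kp * ?n)"
          using kw(2)[of "q 0"] mult_left_mono[OF kp(2)[of y0], of kw] kw(1) unfolding q0 by linarith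
        then have "c * exp (- \<epsilon> * t) * (k2 * norm (w (q 0))) \<le> c * ?E * (k2 * (kw * (kp * ?n)))"
          using c k2 by (intro mult_mono mult_left_mono e\<epsilon>) auto
        with comp_bound[OF t, of "w (q 0)"] show ?thesis by (simp add: mult_ac)
      qed
      have b5: "norm (w (q t) - P (w (q t))) \<le> k2 * kw * (m * kp) * ?E * ?n"
      proof -
        have "norm (q t) \<le> m * kp * ?E * ?n" using b1 Py[OF t] by simp
        then have "k2 * (kw * norm (q t)) \<le> k2 * (kw * (m * kp * ?E * ?n))"
          using k2 kw by (intro mult_left_mono) auto
        moreover have "norm (w (q t) - P (w (q t))) \<le> k2 * (kw * norm (q t))"
          using k2(2)[of "w (q t)"] mult_left_mono[OF kw(2)[of "q t"], of k2] k2(1) by linarith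
        ultimately show ?thesis by (simp add: mult_ac)
      qed
      have "y t = P (y t) + ((S t y0 - P (S t y0)) + (I t - P (I t)) + (S t (w (q 0)) - P (S t (w (q 0)))) - (w (q t) - P (w (q t))))"
        by (simp add: y_def P_simps)
      then have "norm (y t) \<le> norm (P (y t)) + (norm (S t y0 - P (S t y0)) + norm (I t - P (I t))
          + norm (S t (w (q 0)) - P (S t (w (q 0)))) + norm (w (q t) - P (w (q t))))"
        by (smt (verit) norm_triangle_ineq norm_triangle_ineq4)
      also have "\<dots> \<le> m * kp * ?E * ?n + (c * k2 * ?E * ?n + c * k2 * kh * (m * kp) * (2 / \<omega>) * ?E * ?n
          + c * k2 * kw * kp * ?E * ?n + k2 * kw * (m * kp) * ?E * ?n)"
        by (intro add_mono b1 b2 b3 b4 b5)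
      also have "\<dots> = C * ?E * ?n" unfolding C_def by (simp only: distrib_right add.assoc)
      finally show ?thesis .
    qed
    with sol show ?thesis by blast
  qed
  then show ?thesis using C \<omega>(1) by (intro exI[of _ C] conjI exI[of _ "\<omega> / 2"]) auto
qed

end

context c0_generator
begin

text \<open>The invariant of the recursion is a bound on the whole orbit of \<open>r n\<close>, which keeps the constant \<open>C\<close>
  independent of \<open>n\<close>.\<close>

lemma backward_euler_orbit:
  assumes stable: "\<And>t x. 0 \<le> t \<Longrightarrow> norm (S t x) \<le> C * exp (- \<alpha> * t) * norm x"
    and \<mu>: "0 < \<mu>" and \<alpha>: "0 < \<alpha>"
  obtains r where "r 0 = x" "\<And>n. r (Suc n) \<in> D" "\<And>n. \<mu> *\<^sub>R r (Suc n) - A (r (Suc n)) = \<mu> *\<^sub>R r n"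
    "\<And>n. norm (r n) \<le> C * norm x * (\<mu> / (\<mu> + \<alpha>)) ^ n"
proof -
  define \<theta> where "\<theta> = \<mu> / (\<mu> + \<alpha>)"
  let ?Pr = "\<lambda>n r. (n = 0 \<longrightarrow> r = x) \<and> (\<forall>t\<ge>0. norm (S t r) \<le> C * norm x * \<theta> ^ n * exp (- \<alpha> * t))"
  let ?Qr = "\<lambda>n r r'. r' \<in> D \<and> \<mu> *\<^sub>R r' - A r' = \<mu> *\<^sub>R r"
  have "\<exists>r. \<forall>n. ?Pr n (r n) \<and> ?Qr n (r n) (r (Suc n))"
  proof (rule dependent_nat_choice)
    show "\<exists>r. ?Pr 0 r" using stable by (intro exI[of _ x]) (simp add: mult_ac)
    fix r n assume r: "?Pr n r"
    have "norm (S t (\<mu> *\<^sub>R r)) \<le> \<mu> * (C * norm x * \<theta> ^ n) * exp (- \<alpha> * t)" if "0 \<le> t" for t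
      using r that \<mu> by (simp add: S_simps mult.assoc mult_left_mono)
    from resolvent_of_decaying_orbit[OF this, of \<mu>] obtain r' where r': "r' \<in> D" "\<mu> *\<^sub>R r' - A r' = \<mu> *\<^sub>R r"
      "\<And>t. 0 \<le> t \<Longrightarrow> norm (S t r') \<le> \<mu> * (C * norm x * \<theta> ^ n) / (\<mu> + \<alpha>) * exp (- \<alpha> * t)"
      using \<mu> \<alpha> by auto
    have "\<mu> * (C * norm x * \<theta> ^ n) / (\<mu> + \<alpha>) = C * norm x * \<theta> ^ Suc n" by (simp add: \<theta>_def)
    then show "\<exists>r'. ?Pr (Suc n) r' \<and> ?Qr n r r'" using r' by auto
  qed
  then obtain r where r: "\<And>n. ?Pr n (r n)" "\<And>n. ?Qr n (r n) (r (Suc n))" by blast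
  have "norm (r n) \<le> C * norm x * \<theta> ^ n" for n
    using r(1)[of n] by (auto simp: S_zero dest: spec[of _ 0])
  then show thesis using that[of r] r unfolding \<theta>_def by blast
qed

end

lemma alpha_stabilizableE:
  fixes B :: "'u::complex_hilbert_space \<Rightarrow> 'x::complex_hilbert_space \<Rightarrow> complex"
  assumes "alpha_stabilizable D A B \<alpha>"
  obtains T DM M K k C where "generates DM M T" "0 < k" "\<And>x. x \<in> DM \<Longrightarrow> norm (K x) \<le> k * (norm x + norm (M x))"
    "0 < C" "\<And>t x. 0 \<le> t \<Longrightarrow> norm (T t x) \<le> C * exp (- \<alpha> * t) * norm x"
    "\<And>x. x \<in> DM \<Longrightarrow> Xm1_embed D A (M x) = (\<lambda>\<psi>. A_ext D A x \<psi> + B (K x) \<psi>)"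
proof -
  obtain T DM M and K :: "'x \<Rightarrow> 'u" where gen: "generates DM M T"
    and Kb: "\<exists>C. \<forall>x\<in>DM. norm (K x) \<le> C * graph_norm M x"
    and Tb: "\<exists>C1\<ge>1. \<forall>t>0. onorm (T t) \<le> C1 * exp (- \<alpha> * t)"
    and MK: "\<forall>x\<in>DM. Xm1_embed D A (M x) = (\<lambda>\<psi>. A_ext D A x \<psi> + B (K x) \<psi>)"
    using assms unfolding alpha_stabilizable_def by blast
  interpret T: c0_generator DM M T by unfold_locales (rule gen)
  obtain C0 where C0: "\<And>x. x \<in> DM \<Longrightarrow> norm (K x) \<le> C0 * graph_norm M x" using Kb by blast
  obtain C1 where C1: "C1 \<ge> 1" "\<And>t. t > 0 \<Longrightarrow> onorm (T t) \<le> C1 * exp (- \<alpha> * t)" using Tb by blast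
  have "norm (K x) \<le> (\<bar>C0\<bar> + 1) * (norm x + norm (M x))" if "x \<in> DM" for x
  proof -
    have "graph_norm M x \<le> norm x + norm (M x)" unfolding graph_norm_def by (rule sqrt_sum_squares_le_sum) auto
    moreover have "0 \<le> graph_norm M x" by (simp add: graph_norm_def)
    ultimately have "C0 * graph_norm M x \<le> (\<bar>C0\<bar> + 1) * (norm x + norm (M x))"
      by (intro mult_mono) auto
    with C0[OF that] show ?thesis by linarith
  qed
  moreover have "norm (T t x) \<le> C1 * exp (- \<alpha> * t) * norm x" if "0 \<le> t" for t x
  proof (cases "t = 0")
    case True
    then show ?thesis using mult_right_mono[OF C1(1), of "norm x"] by (simp add: T.S_zero)
  next
    case False
    then have "norm (T t x) \<le> onorm (T t) * norm x"
      using that by (intro onorm bounded_clinear_bounded_linear T.S_clinear)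
    also have "\<dots> \<le> C1 * exp (- \<alpha> * t) * norm x" using False that by (intro mult_right_mono C1) auto
    finally show ?thesis .
  qed
  ultimately show thesis using that[OF gen, of "\<bar>C0\<bar> + 1" K C1] MK C1(1) by auto
qed

context reducing_projection
begin

text \<open>The projections \<open>q\<^sub>k = P r\<^sub>k\<close> of an implicit Euler orbit of the stabilized semigroup starting at \<open>\<phi>\<close> satisfy
  \<open>q\<^sub>k = Z q\<^sub>k\<^sub>+\<^sub>1 - P B u\<^sub>k / \<mu>\<close>, where the controls \<open>u\<^sub>k\<close> are bounded by a multiple of \<open>norm \<phi>\<close>.  Unrolling
  this \<open>n\<close> times and pairing with \<open>\<phi>\<close> expresses \<open>(norm \<phi>)\<^sup>2\<close> by \<open>\<langle>Z\<^sup>n q\<^sub>n, \<phi>\<rangle>\<close> and the terms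
  \<open>\<langle>u\<^sub>k, (P B)\<^sup>* Z\<^sup>*\<^sup>k \<phi>\<rangle>\<close>.  The first of these is at most half of the left-hand side for a suitable \<open>n\<close>,
  since \<open>q\<^sub>n\<close> decays faster than \<open>Z\<^sup>n\<close> grows.\<close>

theorem observability_of_stabilizability:
  fixes B :: "'u::complex_hilbert_space \<Rightarrow> 'x \<Rightarrow> complex"
  assumes b: "bounded_clinear b" "\<And>u. B u = J (b u)"
    and stab: "alpha_stabilizable D A B \<alpha>" and \<alpha>: "0 < \<alpha>"
    and L: "bounded_clinear L" "\<And>x. x \<in> Q \<Longrightarrow> L x = A x"
    and \<mu>: "0 < \<mu>" and \<rho>: "0 < \<rho>" "\<rho> < 1 + \<alpha> / \<mu>" and m: "0 < m"
    and growth: "\<And>n x. norm (((\<lambda>x. x - (1 / \<mu>) *\<^sub>R L x) ^^ n) x) \<le> m * \<rho> ^ n * norm x"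
  obtains c n where "0 < c" "\<And>\<phi>. \<phi> \<in> Q \<Longrightarrow>
    c * norm \<phi> \<le> (\<Sum>k<n. norm (hadj (\<lambda>u. P_ext (b u)) ((hadj (\<lambda>x. x - (1 / \<mu>) *\<^sub>R L x) ^^ k) \<phi>)))"
proof -
  obtain T DM M and K :: "'x \<Rightarrow> 'u" and kK C where gen: "generates DM M T" and kK: "0 < kK"
    and Kb: "\<And>x. x \<in> DM \<Longrightarrow> norm (K x) \<le> kK * (norm x + norm (M x))"
    and C: "0 < C" and Tb: "\<And>t x. 0 \<le> t \<Longrightarrow> norm (T t x) \<le> C * exp (- \<alpha> * t) * norm x"
    and MK: "\<And>x. x \<in> DM \<Longrightarrow> Xm1_embed D A (M x) = (\<lambda>\<psi>. A_ext D A x \<psi> + B (K x) \<psi>)"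
    by (rule alpha_stabilizableE[OF stab]) blast
  interpret T: c0_generator DM M T by unfold_locales (rule gen)
  define B1 where "B1 u = P_ext (b u)" for u
  have B1: "bounded_clinear B1" unfolding B1_def by (rule bounded_clinear_compose[OF P_ext_clinear b(1)])
  define Z where "Z x = x - (1 / \<mu>) *\<^sub>R L x" for x
  have Z: "bounded_clinear Z" unfolding Z_def by (intro bounded_clinear_intros L)
  have PM: "P (M x) = A (P x) + B1 (K x)" if x: "x \<in> DM" for x
  proof (rule cinner_ext)
    fix \<phi>
    have "Xm1_embed D A (M x) (hadj P \<phi>) = A_ext D A x (hadj P \<phi>) + B (K x) (hadj P \<phi>)"
      using MK[OF x] by simp
    then have "cinner (M x) (hadj P \<phi>) = cinner x (As (hadj P \<phi>)) + cinner (B1 (K x)) \<phi>"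
      using adj_P(1)[of \<phi>] by (simp add: Xm1_embed_def A_ext_def b(2) J_adj_P B1_def)
    then show "cinner (P (M x)) \<phi> = cinner (A (P x) + B1 (K x)) \<phi>"
      by (simp add: adj_P hadj[OF P_clinear, symmetric] hadj[OF AP_clinear, symmetric] cinner_add_left)
  qed
  obtain p where p: "p > 0" "\<And>x. norm (P x) \<le> p * norm x" using bounded_clinear_bound[OF P_clinear] by blast
  define \<theta> where "\<theta> = \<mu> / (\<mu> + \<alpha>)"
  have \<theta>: "0 < \<theta>" "\<theta> < 1" using \<mu> \<alpha> by (auto simp: \<theta>_def)
  have "\<rho> * \<theta> < (1 + \<alpha> / \<mu>) * \<theta>" using \<rho>(2) \<theta>(1) by (rule mult_strict_right_mono)
  also have "(1 + \<alpha> / \<mu>) * \<theta> = 1"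
  proof -
    have "1 + \<alpha> / \<mu> = (\<mu> + \<alpha>) / \<mu>" using \<mu> by (simp add: add_divide_distrib)
    then show ?thesis using \<mu> \<alpha> by (simp add: \<theta>_def)
  qed
  finally have \<rho>\<theta>: "\<rho> * \<theta> < 1" .
  have "(\<lambda>n. m * p * C * (\<rho> * \<theta>) ^ n) \<longlonglongrightarrow> m * p * C * 0"
    using \<rho>(1) \<theta>(1) \<rho>\<theta> by (intro tendsto_mult tendsto_const LIMSEQ_power_zero) simp
  then have "\<forall>\<^sub>F n in sequentially. m * p * C * (\<rho> * \<theta>) ^ n < 1 / 2"
    by (intro order_tendstoD(2)) auto
  then obtain n where n: "m * p * C * (\<rho> * \<theta>) ^ n < 1 / 2" by (auto simp: eventually_sequentially)
  define cu where "cu = kK * ((1 + 2 * \<mu>) * C)"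
  have cu: "cu > 0" using kK \<mu> C by (simp add: cu_def)
  have "(\<mu> / (2 * cu)) * norm \<phi> \<le> (\<Sum>k<n. norm (hadj B1 ((hadj Z ^^ k) \<phi>)))" if \<phi>: "\<phi> \<in> Q" for \<phi>
  proof -
    obtain r where r: "r 0 = \<phi>" "\<And>n. r (Suc n) \<in> DM" "\<And>n. \<mu> *\<^sub>R r (Suc n) - M (r (Suc n)) = \<mu> *\<^sub>R r n"
      "\<And>n. norm (r n) \<le> C * norm \<phi> * \<theta> ^ n"
      using T.backward_euler_orbit[of C \<alpha> \<mu> \<phi>, OF Tb \<mu> \<alpha>] unfolding \<theta>_def by blast
    define u where "u k = K (r (Suc k))" for k
    have rb: "norm (r k) \<le> C * norm \<phi>" for k
    proof -
      have "\<theta> ^ k \<le> 1" using \<theta> by (simp add: power_le_one)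
      then have "C * norm \<phi> * \<theta> ^ k \<le> C * norm \<phi> * 1" using C by (intro mult_left_mono) auto
      with r(4)[of k] show ?thesis by simp
    qed
    have ub: "norm (u k) \<le> cu * norm \<phi>" for k
    proof -
      have "M (r (Suc k)) = \<mu> *\<^sub>R r (Suc k) - \<mu> *\<^sub>R r k" using r(3)[of k] by (simp add: algebra_simps)
      then have "norm (M (r (Suc k))) \<le> \<mu> * norm (r (Suc k)) + \<mu> * norm (r k)"
        using norm_triangle_ineq4[of "\<mu> *\<^sub>R r (Suc k)" "\<mu> *\<^sub>R r k"] \<mu> by simp
      also have "\<dots> \<le> \<mu> * (C * norm \<phi>) + \<mu> * (C * norm \<phi>)"
        using \<mu> by (intro add_mono mult_left_mono rb) auto
      finally have "norm (r (Suc k)) + norm (M (r (Suc k))) \<le> C * norm \<phi> + (\<mu> * (C * norm \<phi>) + \<mu> * (C * norm \<phi>))"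
        using rb[of "Suc k"] by linarith
      then have "kK * (norm (r (Suc k)) + norm (M (r (Suc k)))) \<le> kK * (C * norm \<phi> + (\<mu> * (C * norm \<phi>) + \<mu> * (C * norm \<phi>)))"
        using kK by (intro mult_left_mono) auto
      with Kb[OF r(2)[of k]] show ?thesis unfolding u_def cu_def by (simp add: algebra_simps)
    qed
    have step: "P (r k) = Z (P (r (Suc k))) - (1 / \<mu>) *\<^sub>R B1 (u k)" for k
    proof -
      have "P (\<mu> *\<^sub>R r (Suc k) - M (r (Suc k))) = P (\<mu> *\<^sub>R r k)" using r(3)[of k] by simp
      then have "\<mu> *\<^sub>R P (r k) = \<mu> *\<^sub>R P (r (Suc k)) - (A (P (r (Suc k))) + B1 (u k))"
        by (simp add: P_simps PM[OF r(2)] u_def)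
      then have "(1 / \<mu>) *\<^sub>R (\<mu> *\<^sub>R P (r k)) = (1 / \<mu>) *\<^sub>R (\<mu> *\<^sub>R P (r (Suc k)) - (A (P (r (Suc k))) + B1 (u k)))" by simp
      then show ?thesis using \<mu> by (simp add: Z_def L(2)[OF P_in] scaleR_diff_right scaleR_add_right)
    qed
    have expand: "P (r 0) = (Z ^^ j) (P (r j)) - (\<Sum>k<j. (1 / \<mu>) *\<^sub>R (Z ^^ k) (B1 (u k)))" for j
    proof (induction j)
      case (Suc j)
      have e: "(Z ^^ j) (P (r j)) = (Z ^^ Suc j) (P (r (Suc j))) - (1 / \<mu>) *\<^sub>R (Z ^^ j) (B1 (u j))"
        by (subst step) (simp add: bounded_clinear_simps[OF bounded_clinear_funpow[OF Z]] funpow_swap1)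
      have "P (r 0) = (Z ^^ Suc j) (P (r (Suc j))) - (1 / \<mu>) *\<^sub>R (Z ^^ j) (B1 (u j))
          - (\<Sum>k<j. (1 / \<mu>) *\<^sub>R (Z ^^ k) (B1 (u k)))" using Suc unfolding e .
      then show ?case unfolding sum.lessThan_Suc by (simp only: diff_diff_eq add.commute)
    qed simp
    have "cinner \<phi> \<phi> = cinner ((Z ^^ n) (P (r n))) \<phi> - (\<Sum>k<n. (1 / \<mu>) *\<^sub>R cinner ((Z ^^ k) (B1 (u k))) \<phi>)"
    proof -
      have "\<phi> = (Z ^^ n) (P (r n)) - (\<Sum>k<n. (1 / \<mu>) *\<^sub>R (Z ^^ k) (B1 (u k)))"
        using expand[of n] by (simp add: r(1) P_id[OF \<phi>])
      then have "cinner \<phi> \<phi> = cinner ((Z ^^ n) (P (r n)) - (\<Sum>k<n. (1 / \<mu>) *\<^sub>R (Z ^^ k) (B1 (u k)))) \<phi>" by simp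
      then show ?thesis
        by (simp only: cinner_diff_left linear_sum[OF bounded_linear.linear[OF bounded_linear_cinner_left]] cinner_scaleR_left)
    qed
    then have "cmod (cinner \<phi> \<phi>) \<le> cmod (cinner ((Z ^^ n) (P (r n))) \<phi>) + cmod (\<Sum>k<n. (1 / \<mu>) *\<^sub>R cinner ((Z ^^ k) (B1 (u k))) \<phi>)"
      by (metis norm_triangle_ineq4)
    also have "cmod (cinner ((Z ^^ n) (P (r n))) \<phi>) \<le> 1 / 2 * norm \<phi> * norm \<phi>"
    proof -
      have "norm ((Z ^^ n) (P (r n))) \<le> m * \<rho> ^ n * norm (P (r n))"
        using growth[of n "P (r n)"] unfolding Z_def .
      also have "\<dots> \<le> m * \<rho> ^ n * (p * (C * norm \<phi> * \<theta> ^ n))"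
      proof (rule mult_left_mono)
        show "norm (P (r n)) \<le> p * (C * norm \<phi> * \<theta> ^ n)"
          using p(2)[of "r n"] mult_left_mono[OF r(4)[of n], of p] p(1) by linarith
      qed (use m \<rho> in simp)
      also have "\<dots> = m * p * C * (\<rho> * \<theta>) ^ n * norm \<phi>" by (simp add: power_mult_distrib mult_ac)
      also have "\<dots> \<le> 1 / 2 * norm \<phi>" using n by (intro mult_right_mono) auto
      finally have "norm ((Z ^^ n) (P (r n))) * norm \<phi> \<le> 1 / 2 * norm \<phi> * norm \<phi>" by (rule mult_right_mono) simp
      with cauchy_schwarz[of "(Z ^^ n) (P (r n))" \<phi>] show ?thesis by linarith
    qed
    also have "cmod (\<Sum>k<n. (1 / \<mu>) *\<^sub>R cinner ((Z ^^ k) (B1 (u k))) \<phi>)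
        \<le> (\<Sum>k<n. (1 / \<mu>) * (cu * norm \<phi> * norm (hadj B1 ((hadj Z ^^ k) \<phi>))))"
    proof (rule sum_norm_le)
      fix k
      have "cinner ((Z ^^ k) (B1 (u k))) \<phi> = cinner (u k) (hadj B1 ((hadj Z ^^ k) \<phi>))"
        by (simp add: hadj_funpow[OF Z] hadj[OF B1])
      then have "cmod (cinner ((Z ^^ k) (B1 (u k))) \<phi>) \<le> norm (u k) * norm (hadj B1 ((hadj Z ^^ k) \<phi>))"
        by (simp add: cauchy_schwarz)
      also have "\<dots> \<le> cu * norm \<phi> * norm (hadj B1 ((hadj Z ^^ k) \<phi>))" by (intro mult_right_mono ub) auto
      finally show "norm ((1 / \<mu>) *\<^sub>R cinner ((Z ^^ k) (B1 (u k))) \<phi>) \<le> (1 / \<mu>) * (cu * norm \<phi> * norm (hadj B1 ((hadj Z ^^ k) \<phi>)))"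
        using \<mu> by (simp add: divide_right_mono)
    qed
    also have "(\<Sum>k<n. (1 / \<mu>) * (cu * norm \<phi> * norm (hadj B1 ((hadj Z ^^ k) \<phi>))))
        = cu / \<mu> * (\<Sum>k<n. norm (hadj B1 ((hadj Z ^^ k) \<phi>))) * norm \<phi>"
      by (simp add: sum_distrib_left sum_distrib_right mult_ac)
    finally have "norm \<phi> * norm \<phi> \<le> 1 / 2 * norm \<phi> * norm \<phi> + cu / \<mu> * (\<Sum>k<n. norm (hadj B1 ((hadj Z ^^ k) \<phi>))) * norm \<phi>"
      by (simp add: cinner_self norm_mult norm_power power2_eq_square)
    then have "1 / 2 * norm \<phi> * norm \<phi> \<le> cu / \<mu> * (\<Sum>k<n. norm (hadj B1 ((hadj Z ^^ k) \<phi>))) * norm \<phi>" by linarith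
    then have "1 / 2 * norm \<phi> \<le> cu / \<mu> * (\<Sum>k<n. norm (hadj B1 ((hadj Z ^^ k) \<phi>)))"
    proof (cases "\<phi> = 0")
      case True
      have "0 \<le> cu / \<mu> * (\<Sum>k<n. norm (hadj B1 ((hadj Z ^^ k) \<phi>)))"
        using cu \<mu> by (intro mult_nonneg_nonneg sum_nonneg) auto
      then show ?thesis using True by simp
    qed (rule mult_right_le_imp_le, auto)
    then show ?thesis using cu \<mu> by (simp add: field_simps)
  qed
  then show thesis using that[of "\<mu> / (2 * cu)" n] cu \<mu> unfolding B1_def Z_def by simp
qed

end

text \<open>The operator \<open>L = A Po\<close> is \<open>A\<close> on \<open>Q\<close> and \<open>0\<close> on a complement, which adds at most the point \<open>0\<close> to the
  spectrum.\<close>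

lemma restricted_resolvent:
  fixes L Po :: "'x::complex_hilbert_space \<Rightarrow> 'x"
  assumes z: "z \<notin> spectrum_on Q A" "z \<noteq> 0"
    and Po: "bounded_clinear Po" "\<And>x. Po x \<in> Q" "\<And>x. x \<in> Q \<Longrightarrow> Po x = x"
    and L: "bounded_clinear L" "\<And>x. L x = A (Po x)" "\<And>x. x \<in> Q \<Longrightarrow> A x \<in> Q"
  shows "\<exists>R. bounded_inverse (\<lambda>x. z *\<^sub>C x - L x) R"
proof -
  let ?f = "\<lambda>x. z *\<^sub>C x - A x"
  have bij: "bij_betw ?f Q Q" and "\<exists>C. \<forall>x\<in>Q. norm x \<le> C * norm (?f x)"
    using z(1) unfolding spectrum_on_def by blast+
  then obtain C where C: "\<And>x. x \<in> Q \<Longrightarrow> norm x \<le> C * norm (?f x)" by blast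
  note Po_simps = bounded_clinear_simps[OF Po(1)]
  define g where "g = inv_into Q ?f"
  have g: "g y \<in> Q" "?f (g y) = y" if "y \<in> Q" for y
    using that bij unfolding g_def bij_betw_def by (auto intro: inv_into_into f_inv_into_f)
  have gf: "g (?f x) = x" if "x \<in> Q" for x
    using that bij unfolding g_def bij_betw_def by (auto intro: inv_into_f_f)
  let ?T = "\<lambda>x. z *\<^sub>C x - L x"
  have Po_T: "Po (?T x) = ?f (Po x)" for x by (simp add: Po_simps L Po)
  have compl_T: "?T x - Po (?T x) = z *\<^sub>C (x - Po x)" for x
    unfolding Po_T by (simp add: L scaleC_diff_right)
  obtain p where p: "p > 0" "\<And>x. norm (Po x) \<le> p * norm x" using bounded_clinear_bound[OF Po(1)] by blast
  have "bounded_inverse ?T (\<lambda>x. g (Po x) + (1 / z) *\<^sub>C (x - Po x))"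
  proof (rule bounded_inverseI)
    show "bounded_clinear ?T" by (intro bounded_clinear_intros L)
    show "g (Po (?T x)) + (1 / z) *\<^sub>C (?T x - Po (?T x)) = x" for x
      unfolding compl_T unfolding Po_T using z(2) by (simp add: gf[OF Po(2)] scaleC_scaleC)
    show "?T (g (Po x) + (1 / z) *\<^sub>C (x - Po x)) = x" for x
    proof -
      have "Po (g (Po x) + (1 / z) *\<^sub>C (x - Po x)) = g (Po x)"
        using g(1)[OF Po(2)] by (simp add: Po_simps Po)
      then have "?T (g (Po x) + (1 / z) *\<^sub>C (x - Po x)) = ?f (g (Po x)) + z *\<^sub>C (1 / z) *\<^sub>C (x - Po x)"
        by (simp add: L(2) scaleC_add_right)
      then show ?thesis using z(2) by (simp add: g(2)[OF Po(2)] scaleC_scaleC)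
    qed
    show "norm x \<le> (\<bar>C\<bar> * p + (1 + p) / cmod z) * norm (?T x)" for x
    proof -
      have "norm (Po x) \<le> \<bar>C\<bar> * norm (?f (Po x))"
        using C[OF Po(2), of x] mult_right_mono[OF abs_ge_self[of C] norm_ge_zero[of "?f (Po x)"]] by linarith
      also have "\<dots> \<le> \<bar>C\<bar> * (p * norm (?T x))" unfolding Po_T[symmetric] by (intro mult_left_mono p) auto
      finally have 1: "norm (Po x) \<le> \<bar>C\<bar> * p * norm (?T x)" by (simp add: mult.assoc)
      have "cmod z * norm (x - Po x) = norm (?T x - Po (?T x))" unfolding compl_T by simp
      also have "\<dots> \<le> norm (?T x) + norm (Po (?T x))" by (rule norm_triangle_ineq4)
      also have "\<dots> \<le> (1 + p) * norm (?T x)" using p(2)[of "?T x"] unfolding distrib_right by linarith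
      finally have 2: "norm (x - Po x) \<le> (1 + p) / cmod z * norm (?T x)"
        using z(2) by (simp add: pos_le_divide_eq mult.commute)
      have "norm x \<le> norm (Po x) + norm (x - Po x)" using norm_triangle_ineq[of "Po x" "x - Po x"] by simp
      with 1 2 show ?thesis unfolding distrib_right by linarith
    qed
  qed
  then show ?thesis by blast
qed

text \<open>Two projections onto \<open>Q\<^sub>1\<close> are used: the oblique one \<open>P\<close> commutes with the semigroup and produces the
  projected system, while the orthogonal one \<open>Po\<close> continues the bounded operator on \<open>Q\<^sub>1\<close> by \<open>0\<close> to all of
  \<open>X\<close>, so that its adjoint in \<open>X\<close> respects \<open>Q\<^sub>1\<close>.\<close>

theorem (in c0_generator) bounded_feedback_if_stabilizable:
  fixes B :: "'u::complex_hilbert_space \<Rightarrow> 'x \<Rightarrow> complex"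
  assumes B: "bounded_into_Xm1 D A B" and AEDC: "AEDC D A" and stab: "stabilizable D A B"
  shows "stabilizable_bounded_feedback D A S B"
proof -
  obtain b where b: "bounded_clinear b" "\<And>u. B u = J (b u)"
    using control_operator_coordinates[OF B] by blast
  obtain \<alpha> where \<alpha>: "0 < \<alpha>" and \<alpha>stab: "alpha_stabilizable D A B \<alpha>"
    using stab unfolding stabilizable_def by blast
  obtain S0 where gen0: "generates D A S0" and split: "\<exists>Q1 Q2.
           csubspace Q1 \<and> closed Q1 \<and> csubspace Q2 \<and> closed Q2 \<and>
           Q1 \<inter> Q2 = {0} \<and> (\<forall>x. \<exists>x1\<in>Q1. \<exists>x2\<in>Q2. x = x1 + x2) \<and>
           (\<forall>t\<ge>0. S0 t ` Q1 \<subseteq> Q1 \<and> S0 t ` Q2 \<subseteq> Q2) \<and>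
           Q1 \<subseteq> D \<and> (\<exists>C. \<forall>x\<in>Q1. norm (A x) \<le> C * norm x) \<and>
           spectrum_on Q1 A \<subseteq> {z. Re z > - \<alpha>} \<and>
           (\<exists>\<epsilon>>0. \<exists>C>0. \<forall>f\<in>Q2. \<forall>t>0. norm (S0 t f) \<le> C * exp (- \<epsilon> * t) * norm f)"
    using AEDC unfolding AEDC_def
    by (elim exE conjE) (rule that, assumption, erule allE, erule impE, rule \<alpha>, assumption)
  from split obtain Q1 Q2 CA \<epsilon> C where Q1: "csubspace Q1" "closed Q1" and Q2: "csubspace Q2" "closed Q2"
    and int: "Q1 \<inter> Q2 = {0}" and sum: "\<forall>x. \<exists>x1\<in>Q1. \<exists>x2\<in>Q2. x = x1 + x2"
    and inv0: "\<forall>t\<ge>0. S0 t ` Q1 \<subseteq> Q1 \<and> S0 t ` Q2 \<subseteq> Q2"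
    and Q1D: "Q1 \<subseteq> D" and Ab: "\<forall>x\<in>Q1. norm (A x) \<le> CA * norm x"
    and spec: "spectrum_on Q1 A \<subseteq> {z. Re z > - \<alpha>}"
    and \<epsilon>: "0 < \<epsilon>" and C: "0 < C"
    and decay0: "\<forall>f\<in>Q2. \<forall>t>0. norm (S0 t f) \<le> C * exp (- \<epsilon> * t) * norm f"
    by (elim exE conjE) (rule that; assumption)
  have S0: "S0 t x = S t x" if "0 \<le> t" for t x by (rule semigroup_unique[OF generates gen0 that])
  have inv: "S t x \<in> Q1" if "0 \<le> t" "x \<in> Q1" for t x using inv0 that S0[OF that(1)] by (metis image_subset_iff)
  have inv2: "S t x \<in> Q2" if "0 \<le> t" "x \<in> Q2" for t x using inv0 that S0[OF that(1)] by (metis image_subset_iff)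
  obtain P where P: "bounded_clinear P" "\<And>x. P x \<in> Q1" "\<And>x. x - P x \<in> Q2"
    "\<And>x y. y \<in> Q1 \<Longrightarrow> x - y \<in> Q2 \<Longrightarrow> P x = y"
    using oblique_projection[OF Q1 Q2 int sum] by blast
  interpret reducing_projection D A S Q1 P
  proof
    show "P x = x" if "x \<in> Q1" for x using P(4)[of x x] that csubspace_zero[OF Q2(1)] by simp
    show "P (S t x) = S t (P x)" if "0 \<le> t" for t x
    proof (rule P(4))
      show "S t (P x) \<in> Q1" by (rule inv[OF that P(2)])
      have "S t (x - P x) \<in> Q2" by (rule inv2[OF that P(3)])
      then show "S t x - S t (P x) \<in> Q2" using that by (simp add: S_simps)
    qed
    show "\<exists>C. \<forall>x\<in>Q1. norm (A x) \<le> C * norm x" using Ab by blast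
  qed (fact Q1 Q1D P)+
  obtain Po where Po: "bounded_clinear Po" "\<And>x. Po x \<in> Q1" "\<And>x. x \<in> Q1 \<Longrightarrow> Po x = x"
    "\<And>x y. cinner (Po x) y = cinner x (Po y)"
    using orthogonal_projection_operator[OF Q1] by blast
  define L where "L x = A (Po x)" for x
  have L: "bounded_clinear L" unfolding L_def by (rule A_compose_clinear[OF Po(1,2)])
  have LQ: "L x = A x" if "x \<in> Q1" for x using that by (simp add: L_def Po)
  have Lin: "L x \<in> Q1" for x unfolding L_def by (rule A_in_Q[OF Po(2)])
  have "\<exists>R. bounded_inverse (\<lambda>x. z *\<^sub>C x - L x) R" if "Re z \<le> - \<alpha>" for z
    by (rule restricted_resolvent[OF _ _ Po(1-3) L L_def A_in_Q]) (use that spec \<alpha> in auto)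
  then obtain \<mu> \<rho> m where \<mu>: "0 < \<mu>" and \<rho>: "0 < \<rho>" "\<rho> < 1 + \<alpha> / \<mu>" and m: "0 < m"
    and growth: "\<And>n x. norm (((\<lambda>x. x - (1 / \<mu>) *\<^sub>R L x) ^^ n) x) \<le> m * \<rho> ^ n * norm x"
    using power_growth_of_spectral_bound[OF L \<alpha>] by blast
  obtain c n where c: "0 < c" and obs: "\<And>\<phi>. \<phi> \<in> Q1 \<Longrightarrow>
    c * norm \<phi> \<le> (\<Sum>k<n. norm (hadj (\<lambda>u. P_ext (b u)) ((hadj (\<lambda>x. x - (1 / \<mu>) *\<^sub>R L x) ^^ k) \<phi>)))"
    using observability_of_stabilizability[OF b \<alpha>stab \<alpha> L LQ \<mu> \<rho> m growth] by blast
  have Pob: "bounded_clinear (\<lambda>u. P_ext (b u))" by (rule bounded_clinear_compose[OF P_ext_clinear b(1)])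
  obtain K :: "'x \<Rightarrow> 'u" and m' \<beta> :: real where K: "bounded_clinear K" and \<beta>: "0 < \<beta>" and m': "0 < m'"
    and Kdecay: "\<And>y t. (\<And>t. (y has_vector_derivative L (y t) + P_ext (b (K (y t)))) (at t)) \<Longrightarrow>
      (\<And>t. Po (y t) = y t) \<Longrightarrow> 0 \<le> t \<Longrightarrow> norm (y t) \<le> m' * exp (- \<beta> * t) * norm (y 0)"
  proof (rule stabilizing_feedback_of_observability[OF L Pob Po(1) Po(4), where c = c and n = n and \<kappa> = "1 / \<mu>"])
    show "Po (Po x) = Po x" for x by (rule Po(3)[OF Po(2)])
    then show "L (Po x) = L x" for x by (simp add: L_def)
    show "Po (L x) = L x" for x by (rule Po(3)[OF Lin])
    show "Po (P_ext (b u)) = P_ext (b u)" for u by (rule Po(3)[OF P_ext_in])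
    show "c * norm \<phi> \<le> (\<Sum>k<n. norm (hadj (\<lambda>u. P_ext (b u)) ((hadj (\<lambda>x. x - (1 / \<mu>) *\<^sub>R L x) ^^ k) \<phi>)))"
      if "Po \<phi> = \<phi>" for \<phi>
      using obs[of \<phi>] Po(2)[of \<phi>] that by simp
  qed (use c in auto)
  have decay_comp: "norm (S t (x - P x)) \<le> max C 1 * exp (- \<epsilon> * t) * norm (x - P x)" if t: "0 \<le> t" for t x
  proof (cases "t = 0")
    case True
    then show ?thesis using mult_right_mono[of 1 "max C 1" "norm (x - P x)"] by (simp add: S_zero)
  next
    case False
    then have "norm (S t (x - P x)) \<le> C * exp (- \<epsilon> * t) * norm (x - P x)"
      using decay0[rule_format, OF P(3), of t x] S0[OF t] t by simp
    also have "\<dots> \<le> max C 1 * exp (- \<epsilon> * t) * norm (x - P x)" by (intro mult_right_mono) auto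
    finally show ?thesis .
  qed
  have "\<exists>C>0. \<exists>\<omega>>0. \<forall>y0. \<exists>y. weak_solution (\<lambda>x. b (K (P x))) y0 y \<and>
    (\<forall>t\<ge>0. norm (y t) \<le> C * exp (- \<omega> * t) * norm y0)"
  proof (rule feedback_solution[OF b(1) K L LQ Lin _ \<beta> m' decay_comp \<epsilon>])
    show "norm (y t) \<le> m' * exp (- \<beta> * t) * norm (y 0)"
      if "\<And>t. (y has_vector_derivative L (y t) + P_ext (b (K (y t)))) (at t)" "\<And>t. y t \<in> Q1" "0 \<le> t" for y t
      using Kdecay[OF that(1) Po(3)[OF that(2)] that(3)] .
  qed auto
  then obtain C' \<omega> where C': "C' > 0" and \<omega>: "\<omega> > 0" and ex: "\<And>y0. \<exists>y. weak_solution (\<lambda>x. b (K (P x))) y0 y \<and>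
    (\<forall>t\<ge>0. norm (y t) \<le> C' * exp (- \<omega> * t) * norm y0)" by blast
  have KP: "bounded_clinear (\<lambda>x. K (P x))" by (rule bounded_clinear_compose[OF K P(1)])
  have F: "bounded_clinear (\<lambda>x. b (K (P x)))" by (rule bounded_clinear_compose[OF b(1) KP])
  show ?thesis unfolding stabilizable_bounded_feedback_def
  proof (rule exI[of _ \<omega>], intro conjI \<omega>, rule exI[of _ C'], intro conjI C', rule exI[of _ "\<lambda>x. K (P x)"], intro conjI KP allI)
    fix y0
    obtain y where y: "weak_solution (\<lambda>x. b (K (P x))) y0 y" "\<And>t. 0 \<le> t \<Longrightarrow> norm (y t) \<le> C' * exp (- \<omega> * t) * norm y0"
      using ex by blast
    have uniq: "z t = y t" if "weak_solution (\<lambda>x. b (K (P x))) y0 z" "0 \<le> t" for z t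
      by (rule weak_solution_projection_eqI[OF F _ that(1) y(1) that(2)]) (simp add: P_idem)
    show "\<exists>y. closed_loop_solution D A S B (\<lambda>x. K (P x)) y0 y \<and>
        (\<forall>z. closed_loop_solution D A S B (\<lambda>x. K (P x)) y0 z \<longrightarrow> (\<forall>t\<ge>0. z t = y t)) \<and>
        (\<forall>t>0. norm (y t) \<le> C' * exp (- \<omega> * t) * norm y0)"
      unfolding closed_loop_solution_iff_weak[OF b(2,1) KP]
    proof (intro exI[of _ y] conjI allI impI)
      show "weak_solution (\<lambda>x. b (K (P x))) y0 y" by (rule y(1))
      show "z t = y t" if "weak_solution (\<lambda>x. b (K (P x))) y0 z" "0 \<le> t" for z t by (rule uniq[OF that])
      show "norm (y t) \<le> C' * exp (- \<omega> * t) * norm y0" if "0 < t" for t using that by (intro y(2)) simp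
    qed
  qed
qed

theorem theorem3p2:
  fixes D :: "'x::complex_hilbert_space set"
    and A :: "'x \<Rightarrow> 'x"
    and S :: "real \<Rightarrow> 'x \<Rightarrow> 'x"
    and B :: "'u::complex_hilbert_space \<Rightarrow> 'x \<Rightarrow> complex"
  assumes "separable TYPE('x)"
    and "separable TYPE('u)"
    and "generates D A S"
    and "admissible_control D A S B"
    and "AEDC D A"
  shows "stabilizable D A B \<longleftrightarrow> stabilizable_bounded_feedback D A S B"
proof -
  interpret c0_generator D A S by unfold_locales fact
  have B: "bounded_into_Xm1 D A B" using assms(4) by (simp add: admissible_control_def)
  show ?thesis
    using bounded_feedback_if_stabilizable[OF B assms(5)] stabilizable_if_bounded_feedback[OF B] by blast
qed

end
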